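(* Suppose that the system $\dot x=f(x;\mu)$, $(x,\mu)\in\mathbb R^{2n}\times\mathbb R$, $n\ge2$, $f$ analytic, satisfies assumptions (R1)-(R5) of the context with $n_0=2$, and that $a_2\ne0$ and $b_2\neq0$, where $$a_2=\int_{-\infty}^{\infty}\langle\psi_{n+2}(t),\mathrm D_\mu f(x^{\mathrm h}(t);0)\rangle\,dt,\qquad b_2=\frac12\int_{-\infty}^{\infty}\langle\psi_{n+2}(t),\mathrm D_x^2f(x^{\mathrm h}(t);0)(\varphi_2(t),\varphi_2(t))\rangle\,dt .$$ Then for some open interval $I$ containing $0$ there exists a differentiable function $\phi:I\to\mathbb R$ with $\phi(0)=0$, $\phi'(0)=0$ and $\phi''(0)\ne0$, such that for $\mu=\phi(\alpha)$ ($\alpha\in I$) there exists a symmetric homoclinic orbit to the origin of the form $$x=x^{\mathrm h}(t)+\alpha\varphi_2(t)+O\bigl(\sqrt{|\alpha|^4+|\mu|^2}\bigr),\qquad x(0)\in\mathrm{Fix}(R),$$ i.e., a saddle-node bifurcation of symmetric homoclinic orbits occurs at $\mu=0$. Moreover, it is supercritical if $a_2b_2<0$ and subcritical if $a_2b_2>0$.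
   Context: Assumptions: (R1) The system is reversible: there is a linear involution $R$ with $f(Rx;\mu)+Rf(x;\mu)=0$ for all $(x,\mu)\in\mathbb R^{2n}\times\mathbb R$, and $\dim\mathrm{Fix}(R)=n$, where $\mathrm{Fix}(R)=\{x\in\mathbb R^{2n}\mid Rx=x\}$. (R2) $f(0;\mu)=0$ for all $\mu\in\mathbb R$. (R3) $\mathrm D_xf(0;0)$ has $2n$ eigenvalues $\pm\lambda_1,\dots,\pm\lambda_n$ with $0<\mathrm{Re}\,\lambda_1\le\dots\le\mathrm{Re}\,\lambda_n$. (R4) At $\mu=0$ the equilibrium $x=0$ has a symmetric homoclinic orbit $x^{\mathrm h}(t)$ with $x^{\mathrm h}(0)\in\mathrm{Fix}(R)$. (R5) (with $n_0=2$) The variational equation (VE) $\dot\xi=\mathrm D_xf(x^{\mathrm h}(t);0)\xi$ on $\mathbb R$ has exactly $2$ linearly independent bounded solutions, $\varphi_1(t)=\dot x^{\mathrm h}(t)$ and $\varphi_2(t)$, with $\varphi_2(0)\in\mathrm{Fix}(R)$. A solution $x(t)$ (and its orbit) is symmetric if $x(t)=Rx(-t)$. The scalar product $\langle\cdot,\cdot\rangle$ on $\mathbb R^{2n}$ is chosen so that $\mathrm{Fix}(-R)=\mathrm{Fix}(R)^\perp$, where $\mathrm{Fix}(-R)=\{x\mid Rx=-x\}$. Solutions $\varphi_1,\dots,\varphi_{2n}$ of the VE are chosen linearly independent, with $\varphi_1,\varphi_2$ as in (R5) and: - for $j=3,\dots,n$: $|\varphi_j(t)|\to0$ as $t\to+\infty$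 and $|\varphi_j(t)|\to\infty$ as $t\to-\infty$; - $|\varphi_{n+1}(t)|\to\infty$ as $t\to\pm\infty$ and $\varphi_{n+1}(0)\in\mathrm{Fix}(R)$; - $|\varphi_{n+2}(t)|\to\infty$ as $t\to\pm\infty$ and $\varphi_{n+2}(0)\in\mathrm{Fix}(-R)$; - $\varphi_{n+j}(t)=R\varphi_j(-t)$ for $j=3,\dots,n$. The functions $\psi_j(t)$, $j=1,\dots,2n$, are defined by $\langle\psi_j(t),\varphi_k(t)\rangle=\delta_{jk}$, $j,k=1,\dots,2n$. The bifurcation is called supercritical (resp. subcritical) when the bifurcating orbits on the curve $\mu=\phi(\alpha)$, $\alpha\ne0$ small, occur for $\mu>0$ (resp. $\mu<0$), i.e. when $\phi''(0)>0$ (resp. $\phi''(0)<0$). *)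

theory Defs
  imports "HOL-Analysis.Analysis"
begin

text \<open>Real analyticity: local expansion into a power series in several variables. A multi-index is
  a map \<open>k \<in> Basis \<rightarrow>\<^sub>E UNIV\<close>; the sum is unordered, hence absolutely convergent.\<close>

definition real_analytic_on :: "('a::euclidean_space \<Rightarrow> 'b::euclidean_space) \<Rightarrow> 'a set \<Rightarrow> bool" where
  "real_analytic_on g S \<longleftrightarrow>
     (\<forall>p\<in>S. \<exists>r>0. \<exists>c :: ('a \<Rightarrow> nat) \<Rightarrow> 'b. \<forall>x\<in>ball p r.
        ((\<lambda>k. (\<Prod>b\<in>Basis. ((x - p) \<bullet> b) ^ k b) *\<^sub>R c k) has_sum g x) (Basis \<rightarrow>\<^sub>E UNIV))"

definition Fix :: "('a \<Rightarrow> 'a) \<Rightarrow> 'a set" where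
  "Fix R = {x. R x = x}"

definition is_scalar_product :: "('a::real_vector \<Rightarrow> 'a \<Rightarrow> real) \<Rightarrow> bool" where
  "is_scalar_product sp \<longleftrightarrow>
     (\<forall>y. linear (\<lambda>x. sp x y)) \<and> (\<forall>x. linear (\<lambda>y. sp x y)) \<and>
     (\<forall>x y. sp x y = sp y x) \<and> (\<forall>x. x \<noteq> 0 \<longrightarrow> sp x x > 0)"

definition Dx :: "(real^'m \<Rightarrow> real \<Rightarrow> real^'m) \<Rightarrow> real^'m \<Rightarrow> real \<Rightarrow> real^'m \<Rightarrow> real^'m" where
  "Dx f x \<mu> = frechet_derivative (\<lambda>y. f y \<mu>) (at x)"

definition Dmu :: "(real^'m \<Rightarrow> real \<Rightarrow> real^'m) \<Rightarrow> real^'m \<Rightarrow> real \<Rightarrow> real^'m" where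
  "Dmu f x \<mu> = vector_derivative (\<lambda>\<nu>. f x \<nu>) (at \<mu>)"

definition Dxx :: "(real^'m \<Rightarrow> real \<Rightarrow> real^'m) \<Rightarrow> real^'m \<Rightarrow> real \<Rightarrow> real^'m \<Rightarrow> real^'m \<Rightarrow> real^'m" where
  "Dxx f x \<mu> u v = frechet_derivative (\<lambda>y. Dx f y \<mu> u) (at x) v"

definition solution :: "(real^'m \<Rightarrow> real \<Rightarrow> real^'m) \<Rightarrow> real \<Rightarrow> (real \<Rightarrow> real^'m) \<Rightarrow> bool" where
  "solution f \<mu> x \<longleftrightarrow> (\<forall>t. (x has_vector_derivative f (x t) \<mu>) (at t))"

definition homoclinic_to_origin ::
    "(real^'m \<Rightarrow> real \<Rightarrow> real^'m) \<Rightarrow> real \<Rightarrow> (real \<Rightarrow> real^'m) \<Rightarrow> bool" where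
  "homoclinic_to_origin f \<mu> x \<longleftrightarrow>
     solution f \<mu> x \<and> (x \<longlongrightarrow> 0) at_top \<and> (x \<longlongrightarrow> 0) at_bot \<and> (\<exists>t. x t \<noteq> 0)"

definition symmetric_orbit :: "('a \<Rightarrow> 'a) \<Rightarrow> (real \<Rightarrow> 'a) \<Rightarrow> bool" where
  "symmetric_orbit R x \<longleftrightarrow> (\<forall>t. x t = R (x (- t)))"

definition VE_solution ::
    "(real^'m \<Rightarrow> real \<Rightarrow> real^'m) \<Rightarrow> (real \<Rightarrow> real^'m) \<Rightarrow> (real \<Rightarrow> real^'m) \<Rightarrow> bool" where
  "VE_solution f xh \<xi> \<longleftrightarrow> (\<forall>t. (\<xi> has_vector_derivative Dx f (xh t) 0 (\<xi> t)) (at t))"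

definition lin_indep_family :: "nat set \<Rightarrow> (nat \<Rightarrow> real \<Rightarrow> 'a::real_vector) \<Rightarrow> bool" where
  "lin_indep_family J \<phi> \<longleftrightarrow>
     (\<forall>c. (\<forall>t. (\<Sum>j\<in>J. c j *\<^sub>R \<phi> j t) = 0) \<longrightarrow> (\<forall>j\<in>J. c j = 0))"

definition R1 :: "(real^'m \<Rightarrow> real \<Rightarrow> real^'m) \<Rightarrow> (real^'m \<Rightarrow> real^'m) \<Rightarrow> nat \<Rightarrow> bool" where
  "R1 f R n \<longleftrightarrow> linear R \<and> R \<circ> R = id \<and> (\<forall>x \<mu>. f (R x) \<mu> + R (f x \<mu>) = 0) \<and> dim (Fix R) = n"

definition R2 :: "(real^'m \<Rightarrow> real \<Rightarrow> real^'m) \<Rightarrow> bool" where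
  "R2 f \<longleftrightarrow> (\<forall>\<mu>. f 0 \<mu> = 0)"

text \<open>The eigenvalues are complex and counted with algebraic multiplicity, i.e. they are the roots
  of the characteristic polynomial.\<close>

definition R3 :: "(real^'m \<Rightarrow> real \<Rightarrow> real^'m) \<Rightarrow> nat \<Rightarrow> bool" where
  "R3 f n \<longleftrightarrow> (\<exists>l :: nat \<Rightarrow> complex.
     (\<forall>z. det (mat z - map_matrix complex_of_real (matrix (Dx f 0 0)))
            = (\<Prod>j=1..n. (z - l j) * (z + l j))) \<and>
     0 < Re (l 1) \<and> mono_on {1..n} (\<lambda>j. Re (l j)))"

definition R4 ::
    "(real^'m \<Rightarrow> real \<Rightarrow> real^'m) \<Rightarrow> (real^'m \<Rightarrow> real^'m) \<Rightarrow> (real \<Rightarrow> real^'m) \<Rightarrow> bool" where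
  "R4 f R xh \<longleftrightarrow> homoclinic_to_origin f 0 xh \<and> symmetric_orbit R xh \<and> xh 0 \<in> Fix R"

text \<open>The case \<open>n\<^sub>0 = 2\<close>: \<open>\<phi> 1, \<phi> 2\<close> form a basis of the space of bounded solutions of the
  variational equation.\<close>

definition R5 ::
    "(real^'m \<Rightarrow> real \<Rightarrow> real^'m) \<Rightarrow> (real^'m \<Rightarrow> real^'m) \<Rightarrow> (real \<Rightarrow> real^'m)
      \<Rightarrow> (nat \<Rightarrow> real \<Rightarrow> real^'m) \<Rightarrow> bool" where
  "R5 f R xh \<phi> \<longleftrightarrow>
     (\<forall>j\<in>{1,2}. VE_solution f xh (\<phi> j) \<and> bounded (range (\<phi> j))) \<and>
     lin_indep_family {1,2} \<phi> \<and>
     (\<forall>\<xi>. VE_solution f xh \<xi> \<and> bounded (range \<xi>) \<longrightarrow>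
        (\<exists>c d. \<forall>t. \<xi> t = c *\<^sub>R \<phi> 1 t + d *\<^sub>R \<phi> 2 t)) \<and>
     (\<forall>t. \<phi> 1 t = vector_derivative xh (at t)) \<and>
     \<phi> 2 0 \<in> Fix R"

text \<open>The remaining choices made for the fundamental system \<open>\<phi> 1, \<dots>, \<phi> (2 * n)\<close>, and the
  dual system \<open>\<psi>\<close>.\<close>

definition VE_fundamental_system ::
    "(real^'m \<Rightarrow> real \<Rightarrow> real^'m) \<Rightarrow> (real^'m \<Rightarrow> real^'m) \<Rightarrow> nat \<Rightarrow> (real \<Rightarrow> real^'m)
      \<Rightarrow> (nat \<Rightarrow> real \<Rightarrow> real^'m) \<Rightarrow> bool" where
  "VE_fundamental_system f R n xh \<phi> \<longleftrightarrow>
     (\<forall>j\<in>{1..2*n}. VE_solution f xh (\<phi> j)) \<and>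
     lin_indep_family {1..2*n} \<phi> \<and>
     (\<forall>j\<in>{3..n}. ((\<lambda>t. norm (\<phi> j t)) \<longlongrightarrow> 0) at_top \<and>
                  filterlim (\<lambda>t. norm (\<phi> j t)) at_top at_bot) \<and>
     filterlim (\<lambda>t. norm (\<phi> (n+1) t)) at_top at_top \<and>
     filterlim (\<lambda>t. norm (\<phi> (n+1) t)) at_top at_bot \<and>
     \<phi> (n+1) 0 \<in> Fix R \<and>
     filterlim (\<lambda>t. norm (\<phi> (n+2) t)) at_top at_top \<and>
     filterlim (\<lambda>t. norm (\<phi> (n+2) t)) at_top at_bot \<and>
     \<phi> (n+2) 0 \<in> Fix (\<lambda>x. - R x) \<and>
     (\<forall>j\<in>{3..n}. \<forall>t. \<phi> (n+j) t = R (\<phi> j (- t)))"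

definition dual_system ::
    "('a \<Rightarrow> 'a \<Rightarrow> real) \<Rightarrow> nat \<Rightarrow> (nat \<Rightarrow> real \<Rightarrow> 'a) \<Rightarrow> (nat \<Rightarrow> real \<Rightarrow> 'a) \<Rightarrow> bool" where
  "dual_system sp n \<phi> \<psi> \<longleftrightarrow>
     (\<forall>j\<in>{1..2*n}. \<forall>k\<in>{1..2*n}. \<forall>t. sp (\<psi> j t) (\<phi> k t) = (if j = k then 1 else 0))"

text \<open>The bifurcating orbits on the curve \<open>\<mu> = h \<alpha>\<close>, \<open>\<alpha> \<noteq> 0\<close> small, occur for \<open>\<mu> > 0\<close>
  (supercritical) or \<open>\<mu> < 0\<close> (subcritical). When \<open>h 0 = 0\<close> and \<open>h' 0 = 0\<close>, the sign condition
  on \<open>h'' 0\<close> implies the first conjunct.\<close>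

definition supercritical :: "(real \<Rightarrow> real) \<Rightarrow> bool" where
  "supercritical h \<longleftrightarrow> (\<forall>\<^sub>F \<alpha> in at 0. h \<alpha> > 0) \<and> deriv (deriv h) 0 > 0"

definition subcritical :: "(real \<Rightarrow> real) \<Rightarrow> bool" where
  "subcritical h \<longleftrightarrow> (\<forall>\<^sub>F \<alpha> in at 0. h \<alpha> < 0) \<and> deriv (deriv h) 0 < 0"

end

theory Submission
  imports Defs "HOL-Computational_Algebra.Fundamental_Theorem_Algebra"
begin

text \<open>Why the theorem holds. The curve in the parameter may be prescribed: on the parabola
  \<open>\<mu> = k \<alpha>\<^sup>2\<close> with \<open>k = - b2 / a2\<close> one solves for the orbit. With \<open>A(t) = Dx f (xh t) 0\<close>, insert
  \<open>x = xh + \<alpha> \<phi>\<^sub>2 + \<alpha>\<^sup>2 (w\<^sub>0 + s \<phi>\<^sub>2 + \<alpha> y)\<close> and compare powers of \<open>\<alpha>\<close>. Order \<open>\<alpha>\<^sup>2\<close> is the equation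
  \<open>w\<^sub>0' = A(t) w\<^sub>0 + k Dmu f + 1/2 Dxx f (\<phi>\<^sub>2, \<phi>\<^sub>2)\<close>, and what remains is
  \<open>y' = A(t) y + g + s Dxx f (\<phi>\<^sub>2, \<phi>\<^sub>2)\<close>, where \<open>g\<close> is the rescaled Taylor remainder and depends on
  \<open>(s, y)\<close> with a Lipschitz constant of order \<open>\<alpha>\<close> (\<open>vf_rem_lipschitz\<close>). Both equations are solvable among
  bounded symmetric functions exactly when the forcing is orthogonal to \<open>\<psi>\<close> with index \<open>n + 2\<close>. For the
  first this is \<open>k a2 + b2 = 0\<close>; in the second it determines \<open>s\<close>, because \<open>b2 \<noteq> 0\<close>. Banach's fixed
  point theorem then provides \<open>s\<close> and \<open>y\<close> (\<open>correction_exists\<close>), bounded uniformly in \<open>\<alpha>\<close>, so that the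
  deviation from \<open>xh + \<alpha> \<phi>\<^sub>2\<close> is \<open>O(\<alpha>\<^sup>2)\<close>. The sign of \<open>k\<close> is the one opposite to \<open>a2 b2\<close>.

  By reversibility a half orbit on \<open>[0, \<infinity>)\<close> starting in \<open>Fix R\<close> extends to a symmetric orbit
  (\<open>symmetric_extension\<close>), and \<open>a2\<close> and \<open>2 b2\<close> are twice integrals over the half line, the integrands being
  even. On the half line the bounded solution of the inhomogeneous equation is written down by variation of
  constants (\<open>green\<close>), which rests on the exponential dichotomy of the variational equation
  (\<open>dichotomy\<close>).

  The dichotomy is obtained from a quadratic form \<open>B\<close> with \<open>B (x, A x) \<ge> c |x|\<^sup>2\<close> for the linearisation \<open>A\<close>
  at the origin (\<open>lyapunov_form_exists\<close>), which exists since no eigenvalue is imaginary and which can be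
  chosen to change sign under \<open>R\<close>. Close to the origin the form increases along solutions, linear or
  nonlinear; hence bounded solutions stay where it is negative and decay, and all others end up where it is
  positive and grow. Its antisymmetry under \<open>R\<close> limits the space of solutions bounded on \<open>[0, \<infinity>)\<close>
  to dimension \<open>n\<close>, so it is spanned by \<open>\<phi>\<^sub>1, \<dots>, \<phi>\<^sub>n\<close> (\<open>dim_bounded_data_le\<close>). The Taylor estimates come
  from termwise differentiation of the power series (\<open>real_analytic_on_derivative\<close>).\<close>

section \<open>Termwise differentiation of power series in several variables\<close>

definition monom_term :: "'a::euclidean_space \<Rightarrow> ('a \<Rightarrow> nat) \<Rightarrow> 'a \<Rightarrow> real" where
  "monom_term p k x = (\<Prod>b\<in>Basis. ((x - p) \<bullet> b) ^ k b)"

definition monom_partial :: "'a::euclidean_space \<Rightarrow> ('a \<Rightarrow> nat) \<Rightarrow> 'a \<Rightarrow> 'a \<Rightarrow> real" where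
  "monom_partial p k x b = real (k b) * ((x - p) \<bullet> b) ^ (k b - 1) * (\<Prod>j\<in>Basis - {b}. ((x - p) \<bullet> j) ^ k j)"

lemma has_derivative_monom_term:
  "(monom_term p k has_derivative (\<lambda>h. \<Sum>b\<in>Basis. (h \<bullet> b) * monom_partial p k x b)) (at x within S)"
proof -
  have "((\<lambda>x. \<Prod>b\<in>Basis. ((x - p) \<bullet> b) ^ k b) has_derivative
      (\<lambda>h. \<Sum>b\<in>Basis. (of_nat (k b) * (h \<bullet> b) * ((x - p) \<bullet> b) ^ (k b - 1)) *
         (\<Prod>j\<in>Basis - {b}. ((x - p) \<bullet> j) ^ k j))) (at x within S)"
    by (intro has_derivative_prod) (auto intro!: derivative_eq_intros simp: mult_ac)
  then show ?thesis
    unfolding monom_term_def[abs_def] monom_partial_def by (simp add: mult_ac)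
qed

text \<open>Halving the radius costs a factor \<open>2 ^ k b\<close> in the monomial, which dominates the
  factor \<open>k b\<close> produced by differentiation, uniformly in the multi-index.\<close>

lemma abs_monom_partial_le:
  fixes p :: "'a::euclidean_space"
  assumes r: "\<rho> > 0" and x: "\<And>b. b \<in> Basis \<Longrightarrow> \<bar>(x - p) \<bullet> b\<bar> \<le> \<rho> / 2" and b: "b \<in> Basis"
  shows "\<bar>monom_partial p k x b\<bar> \<le> 2 / \<rho> * (\<Prod>j\<in>Basis. \<rho> ^ k j)"
proof -
  have A: "real (k b) * \<bar>(x - p) \<bullet> b\<bar> ^ (k b - 1) \<le> 2 / \<rho> * \<rho> ^ k b"
  proof (cases "k b")
    case (Suc m)
    have "\<bar>(x - p) \<bullet> b\<bar> ^ m \<le> (\<rho> / 2) ^ m"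
      using x[OF b] by (intro power_mono) auto
    then have "real (Suc m) * \<bar>(x - p) \<bullet> b\<bar> ^ m \<le> real (Suc m) * (\<rho> / 2) ^ m"
      by (intro mult_left_mono) auto
    also have "\<dots> = (real (Suc m) / 2 ^ m) * \<rho> ^ m" by (simp add: power_divide)
    also have "\<dots> \<le> 2 * \<rho> ^ m"
    proof (intro mult_right_mono)
      have "Suc m < 2 ^ Suc m" by (rule less_exp)
      then have "real (Suc m) < 2 ^ Suc m" by (metis of_nat_less_iff of_nat_numeral of_nat_power)
      then show "real (Suc m) / 2 ^ m \<le> 2" by (simp add: field_simps)
    qed (use r in auto)
    also have "\<dots> = 2 / \<rho> * \<rho> ^ Suc m" using r by (simp add: field_simps)
    finally show ?thesis using Suc by simp
  qed (use r in auto)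
  have B: "(\<Prod>j\<in>Basis - {b}. \<bar>(x - p) \<bullet> j\<bar> ^ k j) \<le> (\<Prod>j\<in>Basis - {b}. \<rho> ^ k j)"
  proof (rule prod_mono)
    fix j assume "j \<in> Basis - {b}"
    then have "\<bar>(x - p) \<bullet> j\<bar> \<le> \<rho>" using x[of j] r by auto
    then show "0 \<le> \<bar>(x - p) \<bullet> j\<bar> ^ k j \<and> \<bar>(x - p) \<bullet> j\<bar> ^ k j \<le> \<rho> ^ k j" by (simp add: power_mono)
  qed
  have "\<bar>monom_partial p k x b\<bar> = (real (k b) * \<bar>(x - p) \<bullet> b\<bar> ^ (k b - 1)) * (\<Prod>j\<in>Basis - {b}. \<bar>(x - p) \<bullet> j\<bar> ^ k j)"
    by (simp add: monom_partial_def abs_mult power_abs abs_prod)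
  also have "\<dots> \<le> (2 / \<rho> * \<rho> ^ k b) * (\<Prod>j\<in>Basis - {b}. \<rho> ^ k j)"
    by (rule mult_mono[OF A B]) (use r in \<open>auto intro!: prod_nonneg\<close>)
  also have "\<dots> = 2 / \<rho> * (\<Prod>j\<in>Basis. \<rho> ^ k j)"
    using b by (simp add: prod.remove[of Basis b])
  finally show ?thesis .
qed

lemma summable_on_finite_sum:
  fixes F :: "'j \<Rightarrow> 'i \<Rightarrow> 'b::real_normed_vector"
  assumes "\<And>j. j \<in> J \<Longrightarrow> F j summable_on I"
  shows "(\<lambda>k. \<Sum>j\<in>J. F j k) summable_on I"
  using assms
proof (induction J rule: infinite_finite_induct)
  case (insert j J)
  then have "(\<lambda>k. F j k + (\<Sum>j\<in>J. F j k)) summable_on I"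
    by (intro summable_on_add) blast+
  then show ?case using insert.hyps by simp
qed (simp_all add: summable_on_0)

text \<open>Unordered convergence of real sums is absolute; apply this to each coordinate.\<close>

lemma summable_on_imp_abs_summable_on_euclidean:
  fixes F :: "'i \<Rightarrow> 'b::euclidean_space"
  assumes "F summable_on I"
  shows "(\<lambda>k. norm (F k)) summable_on I"
proof -
  have "(\<lambda>k. \<bar>F k \<bullet> j\<bar>) summable_on I" for j
  proof -
    have "(\<lambda>k. F k \<bullet> j) summable_on I"
      using assms has_sum_bounded_linear[OF bounded_linear_inner_left[of j]] unfolding summable_on_def by blast
    then show ?thesis using summable_on_iff_abs_summable_on_real by fastforce
  qed
  then have "(\<lambda>k. \<Sum>j\<in>Basis. \<bar>F k \<bullet> j\<bar>) summable_on I"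
    by (intro summable_on_finite_sum) auto
  then show ?thesis
    by (rule summable_on_comparison_test) (auto intro: norm_le_l1)
qed

text \<open>An enumeration of the index set turns the unordered sum into a series. The summable bounds
  \<open>M\<close> make the differentiated series converge uniformly, so the theorem on
  differentiation of series applies.\<close>

lemma has_derivative_has_sum:
  fixes F :: "'i \<Rightarrow> 'a::real_normed_vector \<Rightarrow> 'b::banach"
  assumes I: "countable I" "infinite I"
    and S: "convex S"
    and der: "\<And>i x. i \<in> I \<Longrightarrow> x \<in> S \<Longrightarrow> (F i has_derivative F' i x) (at x within S)"
    and bnd: "\<And>i x h. i \<in> I \<Longrightarrow> x \<in> S \<Longrightarrow> norm (F' i x h) \<le> M i * norm h"
    and M: "M summable_on I"
    and g: "\<And>x. x \<in> S \<Longrightarrow> ((\<lambda>i. F i x) has_sum g x) I"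
    and x: "x \<in> S"
  shows "(\<forall>h. ((\<lambda>i. F' i x h) has_sum (\<Sum>\<^sub>\<infinity>i\<in>I. F' i x h)) I)
      \<and> (g has_derivative (\<lambda>h. \<Sum>\<^sub>\<infinity>i\<in>I. F' i x h)) (at x within S)"
proof -
  define e where "e = from_nat_into I"
  have e: "bij_betw e UNIV I" unfolding e_def using I by (rule bij_betw_from_nat_into)
  have eI: "e n \<in> I" for n using e by (auto simp: bij_betw_def)
  define D where "D = (\<lambda>x h. \<Sum>\<^sub>\<infinity>i\<in>I. F' i x h)"
  have Msum: "(\<lambda>n. M (e n)) summable_on UNIV" using M summable_on_reindex_bij_betw[OF e] by blast
  have M0: "summable (\<lambda>n. M (e n))" using Msum by (rule summable_on_imp_summable)
  have Dsum: "((\<lambda>i. F' i x h) has_sum D x h) I" if "x \<in> S" for x h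
  proof -
    have "(\<lambda>i. M i * norm h) summable_on I" using M by (rule summable_on_cmult_left)
    then have "(\<lambda>i. norm (F' i x h)) summable_on I"
      by (rule summable_on_comparison_test) (use bnd that in auto)
    then show ?thesis unfolding D_def by (simp add: abs_summable_summable)
  qed
  have Dsums: "(\<lambda>n. F' (e n) x h) sums D x h" if "x \<in> S" for x h
    using Dsum[OF that] has_sum_reindex_bij_betw[OF e, of "\<lambda>i. F' i x h"] has_sum_imp_sums by blast
  have gsums: "(\<lambda>n. F (e n) x) sums g x" if "x \<in> S" for x
    using g[OF that] has_sum_reindex_bij_betw[OF e, of "\<lambda>i. F i x"] has_sum_imp_sums by blast
  have "\<exists>G. \<forall>x\<in>S. (\<lambda>n. F (e n) x) sums G x \<and> (G has_derivative D x) (at x within S)"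
  proof (rule has_derivative_series[where f = "\<lambda>n. F (e n)" and f' = "\<lambda>n. F' (e n)" and g' = D, OF S _ _ x gsums[OF x]])
    fix n x assume "x \<in> S" then show "(F (e n) has_derivative F' (e n) x) (at x within S)"
      using der eI by blast
  next
    fix \<epsilon> :: real assume "\<epsilon> > 0"
    have "(\<lambda>n. \<Sum>i. M (e (i + n))) \<longlonglongrightarrow> 0"
      using suminf_exist_split2[OF M0] by simp
    then have "\<forall>\<^sub>F n in sequentially. \<bar>\<Sum>i. M (e (i + n))\<bar> < \<epsilon>"
      using \<open>\<epsilon> > 0\<close> by (auto simp: tendsto_iff)
    then show "\<forall>\<^sub>F n in sequentially. \<forall>x\<in>S. \<forall>h. norm (sum (\<lambda>i. F' (e i) x h) {..<n} - D x h) \<le> \<epsilon> * norm h"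
    proof eventually_elim
      case (elim n)
      show ?case
      proof (intro ballI allI)
        fix x h assume xS: "x \<in> S"
        have ss: "summable (\<lambda>i. norm (F' (e (i + n)) x h))"
        proof (rule summable_comparison_test')
          show "summable (\<lambda>i. M (e (i + n)) * norm h)" by (rule summable_mult2[OF summable_ignore_initial_segment[OF M0]])
        qed (use bnd eI xS in auto)
        have "D x h - sum (\<lambda>i. F' (e i) x h) {..<n} = (\<Sum>i. F' (e (i + n)) x h)"
          using Dsums[OF xS, of h] suminf_split_initial_segment[of "\<lambda>i. F' (e i) x h" n]
          by (simp add: sums_iff)
        then have "norm (sum (\<lambda>i. F' (e i) x h) {..<n} - D x h) = norm (\<Sum>i. F' (e (i + n)) x h)"
          by (metis norm_minus_commute)
        also have "\<dots> \<le> (\<Sum>i. norm (F' (e (i + n)) x h))" using ss by (rule summable_norm)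
        also have "\<dots> \<le> (\<Sum>i. M (e (i + n)) * norm h)"
          using ss bnd eI xS summable_ignore_initial_segment[OF M0, of n] by (intro suminf_le) (auto intro!: summable_mult2)
        also have "\<dots> = (\<Sum>i. M (e (i + n))) * norm h"
          using summable_ignore_initial_segment[OF M0, of n] by (intro suminf_mult2[symmetric])
        also have "\<dots> \<le> \<epsilon> * norm h" using elim by (intro mult_right_mono) auto
        finally show "norm (sum (\<lambda>i. F' (e i) x h) {..<n} - D x h) \<le> \<epsilon> * norm h" .
      qed
    qed
  qed
  then obtain G where G: "\<And>x. x \<in> S \<Longrightarrow> (\<lambda>n. F (e n) x) sums G x"
     "\<And>x. x \<in> S \<Longrightarrow> (G has_derivative D x) (at x within S)" by blast
  have "G x = g x" if "x \<in> S" for x using G(1)[OF that] gsums[OF that] sums_unique2 by blast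
  then have "(g has_derivative D x) (at x within S)"
    using G(2)[OF x] x by (metis has_derivative_transform)
  then show ?thesis using Dsum[OF x] unfolding D_def by blast
qed

lemma infinite_multi_indices: "infinite ((Basis :: 'a::euclidean_space set) \<rightarrow>\<^sub>E (UNIV :: nat set))"
proof -
  have "inj (\<lambda>n::nat. restrict (\<lambda>_. n) (Basis :: 'a set))"
    by (metis (mono_tags, lifting) SOME_Basis injI restrict_apply')
  moreover have "range (\<lambda>n::nat. restrict (\<lambda>_. n) (Basis :: 'a set)) \<subseteq> Basis \<rightarrow>\<^sub>E UNIV" by auto
  ultimately show ?thesis using finite_imageD finite_subset infinite_UNIV_nat by blast
qed

text \<open>Convergence of the expansion at the corner \<open>p + \<rho> * (\<Sum>b\<in>Basis. b)\<close>
  of a cube bounds the coefficients, so on the cube of half the size the differentiated series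
  is dominated and gives the derivative. Its terms are again monomials with the exponent of
  \<open>b0\<close> lowered by one, and a shift of the index restores the form of an expansion.
  Iteration yields derivatives of every order.\<close>

lemma real_analytic_on_derivative:
  fixes g :: "'a::euclidean_space \<Rightarrow> 'b::euclidean_space"
  assumes "real_analytic_on g S"
  shows "\<forall>x\<in>S. g differentiable at x"
    and "b0 \<in> Basis \<Longrightarrow> real_analytic_on (\<lambda>x. frechet_derivative g (at x) b0) S"
proof -
  let ?I = "(Basis :: 'a set) \<rightarrow>\<^sub>E (UNIV :: nat set)"
  have main: "g differentiable at p \<and>
     (b0 \<in> Basis \<longrightarrow> (\<exists>r>0. \<exists>c :: ('a \<Rightarrow> nat) \<Rightarrow> 'b. \<forall>x\<in>ball p r.
        ((\<lambda>k. (\<Prod>b\<in>Basis. ((x - p) \<bullet> b) ^ k b) *\<^sub>R c k) has_sum frechet_derivative g (at x) b0) ?I))"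
    if pS: "p \<in> S" for p
  proof -
    obtain r c where r: "r > 0" and
      c0: "\<forall>x\<in>ball p r. ((\<lambda>k. monom_term p k x *\<^sub>R c k) has_sum g x) ?I"
      using bspec[OF assms[unfolded real_analytic_on_def monom_term_def[symmetric]] pS] by (elim exE conjE)
    have c: "((\<lambda>k. monom_term p k x *\<^sub>R c k) has_sum g x) ?I" if "x \<in> ball p r" for x
      using c0 that by (rule bspec)
    define \<rho> where "\<rho> = r / (2 * DIM('a))"
    have \<rho>: "\<rho> > 0" unfolding \<rho>_def using r by simp
    define q where "q = p + (\<Sum>b\<in>Basis. \<rho> *\<^sub>R b)"
    have "norm (q - p) \<le> (\<Sum>b\<in>(Basis::'a set). norm (\<rho> *\<^sub>R b))" unfolding q_def add_diff_cancel_left' by (rule norm_sum)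
    also have "\<dots> = r / 2" using r by (simp add: \<rho>_def)
    finally have qb: "q \<in> ball p r" using r by (simp add: dist_norm norm_minus_commute)
    have qc: "(q - p) \<bullet> b = \<rho>" if "b \<in> Basis" for b
      using that by (simp add: q_def)
    define M where "M k = (\<Prod>j\<in>Basis. \<rho> ^ k j) * norm (c k)" for k
    have mq: "monom_term p k q = (\<Prod>j\<in>Basis. \<rho> ^ k j)" for k
      unfolding monom_term_def by (intro prod.cong) (auto simp: qc)
    have "(\<lambda>k. norm (monom_term p k q *\<^sub>R c k)) summable_on ?I"
      using c[OF qb] by (intro summable_on_imp_abs_summable_on_euclidean) (rule has_sum_imp_summable)
    moreover have "norm (monom_term p k q *\<^sub>R c k) = M k" for k
      using \<rho> by (simp add: M_def mq abs_prod)
    ultimately have M: "M summable_on ?I" by simp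
    define \<delta> where "\<delta> = min (\<rho> / 2) r"
    have \<delta>: "\<delta> > 0" "ball p \<delta> \<subseteq> ball p r" unfolding \<delta>_def using \<rho> r by auto
    have comp: "\<bar>(x - p) \<bullet> b\<bar> \<le> \<rho> / 2" if "x \<in> ball p \<delta>" "b \<in> Basis" for x b
    proof -
      have "\<bar>(x - p) \<bullet> b\<bar> \<le> norm (x - p)" using that by (simp add: Basis_le_norm)
      then show ?thesis using that by (simp add: \<delta>_def dist_norm norm_minus_commute)
    qed
    define F' where "F' k x h = (\<Sum>b\<in>Basis. (h \<bullet> b) * monom_partial p k x b) *\<^sub>R c k" for k x h
    have D: "(\<forall>h. ((\<lambda>k. F' k x h) has_sum (\<Sum>\<^sub>\<infinity>k\<in>?I. F' k x h)) ?I) \<and>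
        (g has_derivative (\<lambda>h. \<Sum>\<^sub>\<infinity>k\<in>?I. F' k x h)) (at x within ball p \<delta>)" if x: "x \<in> ball p \<delta>" for x
    proof (rule has_derivative_has_sum[where F = "\<lambda>k x. monom_term p k x *\<^sub>R c k" and M = "\<lambda>k. DIM('a) * (2 / \<rho>) * M k"])
      show "countable ?I" by (rule countable_PiE) auto
      show "infinite ?I" by (rule infinite_multi_indices)
      show "((\<lambda>x. monom_term p k x *\<^sub>R c k) has_derivative F' k x) (at x within ball p \<delta>)" for k x
        unfolding F'_def by (intro has_derivative_scaleR_left has_derivative_monom_term)
      show "(\<lambda>k. DIM('a) * (2 / \<rho>) * M k) summable_on ?I" using M by (rule summable_on_cmult_right)
      show "((\<lambda>k. monom_term p k x *\<^sub>R c k) has_sum g x) ?I" if "x \<in> ball p \<delta>" for x by (rule c) (use that \<delta> in auto)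
      fix k x h assume x: "x \<in> ball p \<delta>"
      have "\<bar>\<Sum>b\<in>Basis. (h \<bullet> b) * monom_partial p k x b\<bar> \<le> (\<Sum>b\<in>(Basis::'a set). norm h * (2 / \<rho> * (\<Prod>j\<in>Basis. \<rho> ^ k j)))"
      proof (rule order_trans[OF sum_abs], rule sum_mono)
        fix b :: 'a assume b: "b \<in> Basis"
        show "\<bar>(h \<bullet> b) * monom_partial p k x b\<bar> \<le> norm h * (2 / \<rho> * (\<Prod>j\<in>Basis. \<rho> ^ k j))"
          unfolding abs_mult using b abs_monom_partial_le[OF \<rho> comp[OF x], of b k]
          by (intro mult_mono) (auto simp: Basis_le_norm)
      qed
      also have "\<dots> = DIM('a) * (2 / \<rho>) * (\<Prod>j\<in>Basis. \<rho> ^ k j) * norm h" by simp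
      finally have "\<bar>\<Sum>b\<in>Basis. (h \<bullet> b) * monom_partial p k x b\<bar> * norm (c k)
          \<le> DIM('a) * (2 / \<rho>) * (\<Prod>j\<in>Basis. \<rho> ^ k j) * norm h * norm (c k)"
        by (intro mult_right_mono) auto
      then show "norm (F' k x h) \<le> DIM('a) * (2 / \<rho>) * M k * norm h"
        by (simp add: F'_def M_def mult_ac)
    qed (use x in auto)
    have gD: "(g has_derivative (\<lambda>h. \<Sum>\<^sub>\<infinity>k\<in>?I. F' k x h)) (at x)" if "x \<in> ball p \<delta>" for x
      using D[OF that] that by (simp add: at_within_open[OF that])
    have "g differentiable at p" using gD[of p] \<delta> by (auto simp: differentiable_def)
    moreover have "\<exists>r>0. \<exists>c' :: ('a \<Rightarrow> nat) \<Rightarrow> 'b. \<forall>x\<in>ball p r.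
        ((\<lambda>k. (\<Prod>b\<in>Basis. ((x - p) \<bullet> b) ^ k b) *\<^sub>R c' k) has_sum frechet_derivative g (at x) b0) ?I"
      if b0: "b0 \<in> Basis"
    proof (intro exI[of _ \<delta>] conjI exI[of _ "\<lambda>k. real (Suc (k b0)) *\<^sub>R c (k(b0 := Suc (k b0)))"] ballI)
      fix x assume x: "x \<in> ball p \<delta>"
      have F'b: "F' k x b0 = monom_partial p k x b0 *\<^sub>R c k" for k
        using b0 by (simp add: F'_def inner_Basis if_distrib[of "\<lambda>c. c * _"] cong: if_cong)
      have "frechet_derivative g (at x) b0 = (\<Sum>\<^sub>\<infinity>k\<in>?I. F' k x b0)"
        using frechet_derivative_at[OF gD[OF x]] by metis
      then have "((\<lambda>k. F' k x b0) has_sum frechet_derivative g (at x) b0) ?I" using D[OF x] by metis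
      also have "?this \<longleftrightarrow> ((\<lambda>k. F' k x b0) has_sum frechet_derivative g (at x) b0) {k\<in>?I. k b0 > 0}"
        by (intro has_sum_cong_neutral) (auto simp: F'b monom_partial_def)
      also have "\<dots> \<longleftrightarrow> ((\<lambda>k. (\<Prod>b\<in>Basis. ((x - p) \<bullet> b) ^ k b) *\<^sub>R (real (Suc (k b0)) *\<^sub>R c (k(b0 := Suc (k b0)))))
           has_sum frechet_derivative g (at x) b0) ?I"
      proof (rule has_sum_reindex_bij_witness[where i = "\<lambda>k. k(b0 := Suc (k b0))" and j = "\<lambda>k. k(b0 := k b0 - 1)"], goal_cases)
        case (5 k)
        have "(\<Prod>b\<in>Basis. ((x - p) \<bullet> b) ^ (k(b0 := k b0 - 1)) b)
            = ((x - p) \<bullet> b0) ^ (k b0 - 1) * (\<Prod>b\<in>Basis - {b0}. ((x - p) \<bullet> b) ^ k b)"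
          using b0 by (simp add: prod.remove[of Basis b0])
        then show ?case using 5 by (simp add: F'b monom_partial_def)
      qed (use b0 in \<open>auto simp: PiE_iff extensional_def\<close>)
      finally show "((\<lambda>k. (\<Prod>b\<in>Basis. ((x - p) \<bullet> b) ^ k b) *\<^sub>R (real (Suc (k b0)) *\<^sub>R c (k(b0 := Suc (k b0)))))
           has_sum frechet_derivative g (at x) b0) ?I" .
    qed (rule \<delta>)
    ultimately show ?thesis by blast
  qed
  show "\<forall>x\<in>S. g differentiable at x" using main by blast
  show "b0 \<in> Basis \<Longrightarrow> real_analytic_on (\<lambda>x. frechet_derivative g (at x) b0) S"
    unfolding real_analytic_on_def using main by blast
qed

section \<open>Taylor estimates for real analytic maps\<close>

abbreviation "FD g x \<equiv> frechet_derivative g (at x)"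

lemma frechet_derivative_has_derivative:
  "g differentiable at x \<Longrightarrow> (g has_derivative FD g x) (at x within S)"
  unfolding frechet_derivative_works by (rule has_derivative_at_withinI)

lemma frechet_derivative_expand:
  fixes g :: "'a::euclidean_space \<Rightarrow> 'b::real_normed_vector"
  assumes "g differentiable at x"
  shows "FD g x h = (\<Sum>b\<in>Basis. (h \<bullet> b) *\<^sub>R FD g x b)"
proof -
  interpret D: linear "FD g x" using assms by (rule linear_frechet_derivative)
  have "FD g x h = FD g x (\<Sum>b\<in>Basis. (h \<bullet> b) *\<^sub>R b)"
    by (simp add: euclidean_representation)
  then show ?thesis by (simp add: D.sum D.scaleR)
qed

lemma norm_basis_expansion_le:
  fixes c :: "'a::euclidean_space \<Rightarrow> 'b::real_normed_vector"
  assumes "\<And>b. b \<in> Basis \<Longrightarrow> norm (c b) \<le> C b"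
  shows "norm (\<Sum>b\<in>Basis. (h \<bullet> b) *\<^sub>R c b) \<le> (\<Sum>b\<in>Basis. C b) * norm h"
proof -
  have "norm (\<Sum>b\<in>Basis. (h \<bullet> b) *\<^sub>R c b) \<le> (\<Sum>b\<in>Basis. norm h * C b)"
  proof (rule order_trans[OF norm_sum], rule sum_mono)
    fix b :: 'a assume b: "b \<in> Basis"
    show "norm ((h \<bullet> b) *\<^sub>R c b) \<le> norm h * C b"
      unfolding norm_scaleR using assms[OF b] Basis_le_norm[OF b, of h] by (intro mult_mono) auto
  qed
  then show ?thesis by (simp add: sum_distrib_left mult.commute)
qed

context
  fixes g :: "'a::euclidean_space \<Rightarrow> 'b::euclidean_space"
  assumes g: "real_analytic_on g UNIV"
begin

lemma analytic_differentiable: "g differentiable at x"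
  by (rule bspec[OF real_analytic_on_derivative(1)[OF g]]) simp

lemma analytic_continuous: "continuous_on S g"
  by (intro continuous_at_imp_continuous_on ballI differentiable_imp_continuous_within analytic_differentiable)

lemma analytic_partial: "b \<in> Basis \<Longrightarrow> real_analytic_on (\<lambda>x. FD g x b) UNIV"
  by (rule real_analytic_on_derivative(2)[OF g])

end

context
  fixes g :: "'a::euclidean_space \<Rightarrow> 'b::euclidean_space" and r :: real
  assumes g: "real_analytic_on g UNIV"
begin

text \<open>The partial derivatives are analytic again, hence continuous and bounded on the compact ball.\<close>

lemma analytic_derivative_bounded:
  "\<exists>C\<ge>0. \<forall>x\<in>cball 0 r. \<forall>h. norm (FD g x h) \<le> C * norm h"
proof -
  have "\<exists>C. \<forall>x\<in>cball 0 r. norm (FD g x b) \<le> C" if "b \<in> Basis" for b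
  proof -
    have "compact ((\<lambda>x. FD g x b) ` cball 0 r)"
      using analytic_continuous[OF analytic_partial[OF g that]] by (intro compact_continuous_image) auto
    from compact_imp_bounded[OF this] show ?thesis unfolding bounded_iff by auto
  qed
  then obtain C where C: "\<And>b x. b \<in> Basis \<Longrightarrow> x \<in> cball 0 r \<Longrightarrow> norm (FD g x b) \<le> C b"
    by metis
  have "norm (FD g x h) \<le> \<bar>\<Sum>b\<in>Basis. C b\<bar> * norm h" if x: "x \<in> cball 0 r" for x h
  proof -
    have "norm (FD g x h) \<le> (\<Sum>b\<in>Basis. C b) * norm h"
      unfolding frechet_derivative_expand[OF analytic_differentiable[OF g], of x h]
      using C x by (intro norm_basis_expansion_le) auto
    also have "\<dots> \<le> \<bar>\<Sum>b\<in>Basis. C b\<bar> * norm h" by (intro mult_right_mono) auto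
    finally show ?thesis .
  qed
  then show ?thesis by (intro exI[of _ "\<bar>\<Sum>b\<in>Basis. C b\<bar>"]) auto
qed

lemma analytic_lipschitz:
  "\<exists>C\<ge>0. \<forall>x\<in>cball 0 r. \<forall>y\<in>cball 0 r. norm (g x - g y) \<le> C * norm (x - y)"
proof -
  obtain C where C: "C \<ge> 0" "\<And>x h. x \<in> cball 0 r \<Longrightarrow> norm (FD g x h) \<le> C * norm h"
    using analytic_derivative_bounded by blast
  have "norm (g x - g y) \<le> C * norm (x - y)" if "x \<in> cball 0 r" "y \<in> cball 0 r" for x y
    using that C
    by (intro differentiable_bound[where S = "cball 0 r" and f' = "\<lambda>x. FD g x"])
      (auto intro!: frechet_derivative_has_derivative analytic_differentiable[OF g] onorm_le)
  then show ?thesis using C(1) by blast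
qed

end

context
  fixes g :: "'a::euclidean_space \<Rightarrow> 'b::euclidean_space" and r :: real
  assumes g: "real_analytic_on g UNIV"
begin

lemma analytic_derivative_lipschitz:
  "\<exists>C\<ge>0. \<forall>x\<in>cball 0 r. \<forall>y\<in>cball 0 r. \<forall>h.
     norm (FD g x h - FD g y h) \<le> C * norm (x - y) * norm h"
proof -
  have "\<exists>C\<ge>0. \<forall>x\<in>cball 0 r. \<forall>y\<in>cball 0 r.
     norm (FD g x b - FD g y b) \<le> C * norm (x - y)" if "b \<in> Basis" for b
    by (rule analytic_lipschitz[OF analytic_partial[OF g that]])
  then obtain C where C: "\<And>b. b \<in> Basis \<Longrightarrow> C b \<ge> 0" "\<And>b x y. b \<in> Basis \<Longrightarrow> x \<in> cball 0 r \<Longrightarrow> y \<in> cball 0 r \<Longrightarrow>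
     norm (FD g x b - FD g y b) \<le> C b * norm (x - y)"
    by metis
  have "norm (FD g x h - FD g y h) \<le> (\<Sum>b\<in>Basis. C b) * norm (x - y) * norm h"
    if xy: "x \<in> cball 0 r" "y \<in> cball 0 r" for x y h
  proof -
    have "FD g x h - FD g y h
      = (\<Sum>b\<in>Basis. (h \<bullet> b) *\<^sub>R (FD g x b - FD g y b))"
      by (subst (1 2) frechet_derivative_expand[OF analytic_differentiable[OF g]])
        (simp add: sum_subtractf scaleR_diff_right)
    also have "norm \<dots> \<le> (\<Sum>b\<in>Basis. C b * norm (x - y)) * norm h"
      using C(2) xy by (intro norm_basis_expansion_le) auto
    finally show ?thesis by (simp add: sum_distrib_right)
  qed
  then show ?thesis using C(1) by (intro exI[of _ "\<Sum>b\<in>Basis. C b"]) (auto intro: sum_nonneg)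
qed

lemma analytic_taylor1:
  "\<exists>C\<ge>0. \<forall>x p. x \<in> cball 0 r \<longrightarrow> x + p \<in> cball 0 r \<longrightarrow>
     norm (g (x + p) - g x - FD g x p) \<le> C * norm p ^ 2"
proof -
  obtain C where C: "C \<ge> 0" "\<And>x y h. x \<in> cball 0 r \<Longrightarrow> y \<in> cball 0 r \<Longrightarrow>
     norm (FD g x h - FD g y h) \<le> C * norm (x - y) * norm h"
    using analytic_derivative_lipschitz by blast
  have "norm (g (x + p) - g x - FD g x p) \<le> C * norm p ^ 2"
    if xp: "x \<in> cball 0 r" "x + p \<in> cball 0 r" for x p
  proof -
    let ?S = "closed_segment x (x + p)"
    have S: "?S \<subseteq> cball 0 r" using xp by (intro closed_segment_subset) auto
    have "norm (g (x + p) - g x - FD g x (x + p - x)) \<le> norm (x + p - x) * (C * norm p)"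
    proof (rule differentiable_bound_linearization[where S = ?S and f' = "\<lambda>x. FD g x"])
      show "x + t *\<^sub>R (x + p - x) \<in> ?S" if "t \<in> {0..1}" for t :: real
        using that by (auto simp: in_segment algebra_simps intro!: exI[of _ t])
      fix y assume y: "y \<in> ?S"
      have "norm (y - x) \<le> norm p" using segment_bound1[OF y] by simp
      then have "C * norm (y - x) * norm h \<le> C * norm p * norm h" for h :: 'a
        using C(1) by (intro mult_right_mono mult_left_mono) auto
      then show "onorm (FD g y - FD g x) \<le> C * norm p"
        using order_trans[OF C(2)[of y x]] y S xp by (intro onorm_le) auto
    qed (auto intro!: frechet_derivative_has_derivative analytic_differentiable[OF g])
    then show ?thesis by (simp add: power2_eq_square mult_ac)
  qed
  then show ?thesis using C(1) by blast
qed

end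

context
  fixes g :: "'a::euclidean_space \<Rightarrow> 'b::euclidean_space" and r :: real
  assumes g: "real_analytic_on g UNIV"
begin

lemma analytic_derivative_has_derivative:
  "((\<lambda>y. FD g y h) has_derivative
     (\<lambda>p. \<Sum>b\<in>Basis. (h \<bullet> b) *\<^sub>R FD (\<lambda>y. FD g y b) x p)) (at x)"
proof -
  have "((\<lambda>y. \<Sum>b\<in>Basis. (h \<bullet> b) *\<^sub>R FD g y b) has_derivative
     (\<lambda>p. \<Sum>b\<in>Basis. (h \<bullet> b) *\<^sub>R FD (\<lambda>y. FD g y b) x p)) (at x)"
    by (intro has_derivative_sum has_derivative_scaleR_right frechet_derivative_has_derivative
        analytic_differentiable analytic_partial g)
  then show ?thesis
    by (subst frechet_derivative_expand[OF analytic_differentiable[OF g], abs_def]) simp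
qed

lemma analytic_derivative_differentiable:
  "(\<lambda>y. FD g y h) differentiable at x"
  using analytic_derivative_has_derivative by (rule differentiableI)

lemma frechet_derivative2_expand:
  "FD (\<lambda>y. FD g y h) x p
     = (\<Sum>b\<in>Basis. (h \<bullet> b) *\<^sub>R FD (\<lambda>y. FD g y b) x p)"
  by (rule fun_cong[OF frechet_derivative_at[OF analytic_derivative_has_derivative, symmetric]])

lemma analytic_derivative_taylor1:
  "\<exists>C\<ge>0. \<forall>x p h. x \<in> cball 0 r \<longrightarrow> x + p \<in> cball 0 r \<longrightarrow>
     norm (FD g (x + p) h - FD g x h
        - FD (\<lambda>y. FD g y h) x p) \<le> C * norm p ^ 2 * norm h"
proof -
  let ?G = "\<lambda>b y. FD g y b"
  have "\<exists>C\<ge>0. \<forall>x p. x \<in> cball 0 r \<longrightarrow> x + p \<in> cball 0 r \<longrightarrow>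
     norm (?G b (x + p) - ?G b x - FD (?G b) x p) \<le> C * norm p ^ 2" if "b \<in> Basis" for b
    by (rule analytic_taylor1[OF analytic_partial[OF g that]])
  then obtain C where C: "\<And>b. b \<in> Basis \<Longrightarrow> C b \<ge> 0"
    "\<And>b x p. b \<in> Basis \<Longrightarrow> x \<in> cball 0 r \<Longrightarrow> x + p \<in> cball 0 r \<Longrightarrow>
     norm (?G b (x + p) - ?G b x - FD (?G b) x p) \<le> C b * norm p ^ 2"
    by metis
  have "norm (?G h (x + p) - ?G h x - FD (?G h) x p) \<le> (\<Sum>b\<in>Basis. C b) * norm p ^ 2 * norm h"
    if xp: "x \<in> cball 0 r" "x + p \<in> cball 0 r" for x p h
  proof -
    have "?G h (x + p) - ?G h x - FD (?G h) x p
      = (\<Sum>b\<in>Basis. (h \<bullet> b) *\<^sub>R (?G b (x + p) - ?G b x - FD (?G b) x p))"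
      unfolding frechet_derivative2_expand[of h]
      by (subst (1 2) frechet_derivative_expand[OF analytic_differentiable[OF g]])
        (simp add: sum_subtractf scaleR_diff_right)
    also have "norm \<dots> \<le> (\<Sum>b\<in>Basis. C b * norm p ^ 2) * norm h"
      using C(2) xp by (intro norm_basis_expansion_le) auto
    finally show ?thesis by (simp add: sum_distrib_right)
  qed
  then show ?thesis using C(1) by (intro exI[of _ "\<Sum>b\<in>Basis. C b"]) (auto intro: sum_nonneg)
qed

lemma analytic_derivative2_bounded:
  "\<exists>C\<ge>0. \<forall>x\<in>cball 0 r. \<forall>h p. norm (FD (\<lambda>y. FD g y h) x p) \<le> C * norm h * norm p"
proof -
  let ?G = "\<lambda>b y. FD g y b"
  have "\<exists>C\<ge>0. \<forall>x\<in>cball 0 r. \<forall>p. norm (FD (?G b) x p) \<le> C * norm p" if "b \<in> Basis" for b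
    by (rule analytic_derivative_bounded[OF analytic_partial[OF g that]])
  then obtain C where C: "\<And>b. b \<in> Basis \<Longrightarrow> C b \<ge> 0"
    "\<And>b x p. b \<in> Basis \<Longrightarrow> x \<in> cball 0 r \<Longrightarrow> norm (FD (?G b) x p) \<le> C b * norm p"
    by metis
  have "norm (FD (?G h) x p) \<le> (\<Sum>b\<in>Basis. C b) * norm h * norm p"
    if x: "x \<in> cball 0 r" for x p h
  proof -
    have "norm (FD (?G h) x p) \<le> (\<Sum>b\<in>Basis. C b * norm p) * norm h"
      unfolding frechet_derivative2_expand[of h] using C(2) x by (intro norm_basis_expansion_le) auto
    then show ?thesis by (simp add: sum_distrib_right[symmetric] mult_ac)
  qed
  then show ?thesis using C(1) by (intro exI[of _ "\<Sum>b\<in>Basis. C b"]) (auto intro: sum_nonneg)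
qed

lemma analytic_derivative2_continuous:
  "continuous_on S (\<lambda>x. FD (\<lambda>y. FD g y h) x p)"
proof -
  have "continuous_on S (\<lambda>x. FD (\<lambda>y. FD g y b) x p)"
    if b: "b \<in> Basis" for b
    unfolding frechet_derivative_expand[OF analytic_differentiable[OF analytic_partial[OF g b]], of _ p]
    by (intro continuous_on_sum continuous_on_scaleR continuous_on_const
        analytic_continuous[OF analytic_partial[OF analytic_partial[OF g b]]])
  then show ?thesis
    unfolding frechet_derivative2_expand[of h] by (intro continuous_on_sum continuous_on_scaleR continuous_on_const)
qed

text \<open>Along the segment from \<open>x\<close> to \<open>x + p\<close> the curve
  \<open>\<gamma>\<close> is what is left of \<open>g\<close> after the first and second order
  terms are subtracted; its velocity is the first order Taylor remainder of the derivative of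
  \<open>g\<close> in direction \<open>p\<close>.\<close>

lemma analytic_taylor2:
  "\<exists>C\<ge>0. \<forall>x p. x \<in> cball 0 r \<longrightarrow> x + p \<in> cball 0 r \<longrightarrow>
     norm (g (x + p) - g x - FD g x p
        - (1 / 2) *\<^sub>R FD (\<lambda>y. FD g y p) x p) \<le> C * norm p ^ 3"
proof -
  let ?G = "\<lambda>b y. FD g y b"
  obtain C where C: "C \<ge> 0" "\<And>x p h. x \<in> cball 0 r \<Longrightarrow> x + p \<in> cball 0 r \<Longrightarrow>
     norm (?G h (x + p) - ?G h x - FD (?G h) x p) \<le> C * norm p ^ 2 * norm h"
    using analytic_derivative_taylor1 by blast
  have "norm (g (x + p) - g x - ?G p x - (1 / 2) *\<^sub>R FD (?G p) x p) \<le> C * norm p ^ 3"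
    if xp: "x \<in> cball 0 r" "x + p \<in> cball 0 r" for x p
  proof -
    let ?Q = "FD (?G p) x"
    define \<gamma> where "\<gamma> t = g (x + t *\<^sub>R p) - t *\<^sub>R ?G p x - (t\<^sup>2 / 2) *\<^sub>R ?Q p" for t :: real
    have lin: "linear ?Q" using analytic_derivative_differentiable by (rule linear_frechet_derivative)
    have linG: "linear (\<lambda>p. ?G p y)" for y by (rule linear_frechet_derivative[OF analytic_differentiable[OF g]])
    have der: "(\<gamma> has_derivative (\<lambda>s. s *\<^sub>R (?G p (x + t *\<^sub>R p) - ?G p x - ?Q (t *\<^sub>R p)))) (at t within {0..1})" for t
    proof -
      have "((\<lambda>t. g (x + t *\<^sub>R p)) has_derivative (\<lambda>s. ?G (s *\<^sub>R p) (x + t *\<^sub>R p))) (at t within {0..1})"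
        by (rule has_derivative_compose[OF _ frechet_derivative_has_derivative[OF analytic_differentiable[OF g]],
              where f = "\<lambda>t. x + t *\<^sub>R p"])
          (auto intro!: derivative_eq_intros)
      then have "(\<gamma> has_derivative (\<lambda>s. ?G (s *\<^sub>R p) (x + t *\<^sub>R p) - s *\<^sub>R ?G p x - (t * s) *\<^sub>R ?Q p)) (at t within {0..1})"
        unfolding \<gamma>_def[abs_def] by (auto intro!: derivative_eq_intros)
      then show ?thesis
        by (simp add: linear_scale[OF lin] linear_scale[OF linG] scaleR_diff_right mult_ac)
    qed
    have "norm (\<gamma> 1 - \<gamma> 0) \<le> (C * norm p ^ 3) * norm (1 - 0 :: real)"
    proof (rule differentiable_bound[OF _ der])
      fix t :: real assume t: "t \<in> {0..1}"
      have "x + t *\<^sub>R p \<in> closed_segment x (x + p)" using t by (auto simp: in_segment algebra_simps intro!: exI[of _ t])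
      then have "x + t *\<^sub>R p \<in> cball 0 r" using xp closed_segment_subset[of x "cball 0 r" "x + p"] by auto
      then have "norm (?G p (x + t *\<^sub>R p) - ?G p x - ?Q (t *\<^sub>R p)) \<le> C * norm (t *\<^sub>R p) ^ 2 * norm p"
        using C(2) xp by blast
      also have "\<dots> = t\<^sup>2 * (C * norm p ^ 3)" by (simp add: power2_eq_square power3_eq_cube)
      also have "\<dots> \<le> 1 * (C * norm p ^ 3)" using t C(1) by (intro mult_right_mono) (auto simp: abs_square_le_1)
      finally show "onorm (\<lambda>s. s *\<^sub>R (?G p (x + t *\<^sub>R p) - ?G p x - ?Q (t *\<^sub>R p))) \<le> C * norm p ^ 3"
        by (intro onorm_le) (simp add: mult_left_mono mult.commute)
    qed auto
    then show ?thesis by (simp add: \<gamma>_def linear_0[OF linG] algebra_simps)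
  qed
  then show ?thesis using C(1) by blast
qed

end

section \<open>Lyapunov forms of hyperbolic matrices\<close>

text \<open>The vector \<open>p(A) v\<close>, evaluated by Horner's scheme.\<close>

definition poly_apply :: "complex^'m^'m \<Rightarrow> complex poly \<Rightarrow> complex^'m \<Rightarrow> complex^'m" where
  "poly_apply A p v = fold_coeffs (\<lambda>a w. a *s v + A *v w) p 0"

definition shift :: "complex^'m^'m \<Rightarrow> complex \<Rightarrow> complex^'m \<Rightarrow> complex^'m" where
  "shift A z x = A *v x - z *s x"

lemma poly_apply_0 [simp]: "poly_apply A 0 v = 0"
  by (simp add: poly_apply_def)

lemma poly_apply_pCons [simp]: "poly_apply A (pCons a p) v = a *s v + A *v poly_apply A p v"
proof (cases "a = 0 \<and> p = 0")
  case False
  then show ?thesis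
    by (metis (no_types, lifting) comp_apply fold_coeffs_pCons_coeff_not_0_eq
        fold_coeffs_pCons_not_0_0_eq poly_apply_def)
qed (auto simp: poly_apply_def)

lemma poly_apply_add: "poly_apply A (p + q) v = poly_apply A p v + poly_apply A q v"
proof (induction p q rule: poly_induct2)
  case (pCons a p b q)
  then show ?case
    by (simp add: vec.scale_left_distrib matrix_vector_right_distrib)
qed simp

lemma poly_apply_smult: "poly_apply A (smult c p) v = c *s poly_apply A p v"
proof (induction p)
  case (pCons a p)
  show ?case
    by (simp add: pCons.IH vec.scale_right_distrib vector_scalar_commute)
qed simp

lemma poly_apply_monom: "poly_apply A (monom c i) v = c *s ((*v) A ^^ i) v"
proof (induction i)
  case (Suc i)
  show ?case
    by (simp add: monom_Suc Suc.IH vector_scalar_commute)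
qed (simp add: monom_0)

lemma poly_apply_sum: "poly_apply A (\<Sum>i\<in>I. p i) v = (\<Sum>i\<in>I. poly_apply A (p i) v)"
proof (induction I rule: infinite_finite_induct)
  case (insert i I)
  show ?case
    by (simp add: insert poly_apply_add)
qed simp_all

lemma poly_apply_linear_factor:
  "poly_apply A ([:- z, 1:] * q) v = shift A z (poly_apply A q v)"
proof -
  have "[:- z, 1:] * q = smult (- z) q + pCons 0 q" by simp
  then show ?thesis
    by (simp only: poly_apply_add poly_apply_smult poly_apply_pCons) (simp add: shift_def)
qed

lemma shift_linear:
  "shift A z (x + y) = shift A z x + shift A z y" "shift A z (c *s x) = c *s shift A z x" "shift A z 0 = 0"
  by (simp_all add: shift_def matrix_vector_right_distrib vector_add_ldistrib vector_scalar_commute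
      vector_ssub_ldistrib vector_smult_assoc mult.commute)

lemma poly_apply_shift: "poly_apply A q (shift A z v) = shift A z (poly_apply A q v)"
proof (induction q)
  case (pCons a p)
  have "shift A z (A *v w) = A *v shift A z w" for w
    by (simp add: shift_def matrix_vector_mult_diff_distrib vector_scalar_commute)
  then show ?case using pCons by (simp add: shift_linear)
qed (simp add: shift_linear)

text \<open>The vectors \<open>v, A v, \<dots>, A\<^sup>m v\<close> are too many to be linearly
  independent.\<close>

lemma annihilating_poly_exists:
  fixes A :: "complex^'m^'m"
  shows "\<exists>p. p \<noteq> 0 \<and> poly_apply A p v = 0"
proof -
  let ?w = "\<lambda>i. ((*v) A ^^ i) v"
  let ?J = "{.. CARD('m)}"
  show ?thesis
  proof (cases "inj_on ?w ?J")
    case False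
    then obtain i j where ij: "i \<noteq> j" "?w i = ?w j" by (auto simp: inj_on_def)
    have "coeff (monom 1 i + monom (-1) j :: complex poly) i \<noteq> 0" using ij by simp
    then have "monom 1 i + monom (-1) j \<noteq> (0 :: complex poly)" by (metis coeff_0)
    moreover have "poly_apply A (monom 1 i + monom (-1) j) v = 0"
      using ij by (simp add: poly_apply_add poly_apply_monom)
    ultimately show ?thesis by blast
  next
    case True
    then have card: "card (?w ` ?J) = Suc CARD('m)" by (simp add: card_image)
    have "vec.dependent (?w ` ?J)"
    proof (rule ccontr)
      assume "\<not> vec.dependent (?w ` ?J)"
      from vec.independent_card_le_dim[OF subset_UNIV this] card show False
        by (simp add: card_cart_basis)
    qed
    then obtain u where u: "\<exists>x\<in>?w ` ?J. u x \<noteq> 0" "(\<Sum>x\<in>?w ` ?J. u x *s x) = 0"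
      by (subst (asm) vec.dependent_finite) auto
    define p where "p = (\<Sum>i\<in>?J. monom (u (?w i)) i)"
    have "poly_apply A p v = (\<Sum>i\<in>?J. u (?w i) *s ?w i)"
      by (simp add: p_def poly_apply_sum poly_apply_monom)
    also have "\<dots> = 0" using u(2) True by (simp add: sum.reindex)
    finally have "poly_apply A p v = 0" .
    moreover obtain i where i: "i \<in> ?J" "u (?w i) \<noteq> 0" using u(1) by auto
    have "coeff p i = u (?w i)"
      using i(1) by (simp add: p_def coeff_sum)
    then have "p \<noteq> 0" using i(2) by (metis coeff_0)
    ultimately show ?thesis by blast
  qed
qed

fun shifts :: "complex^'m^'m \<Rightarrow> complex list \<Rightarrow> complex^'m \<Rightarrow> complex^'m" where
  "shifts A [] x = x"
| "shifts A (z # zs) x = shifts A zs (shift A z x)"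

lemma shifts_linear:
  "shifts A zs (x + y) = shifts A zs x + shifts A zs y" "shifts A zs (c *s x) = c *s shifts A zs x"
  "shifts A zs 0 = 0"
  by (induction zs arbitrary: x y) (simp_all add: shift_linear)

lemma shifts_append: "shifts A (zs @ ws) x = shifts A ws (shifts A zs x)"
  by (induction zs arbitrary: x) simp_all

lemma shift_commute: "shift A z (shift A w x) = shift A w (shift A z x)"
proof -
  have "z *s (w *s x) = w *s (z *s x)" by (simp add: vector_smult_assoc mult.commute)
  then show ?thesis
    by (simp add: shift_def matrix_vector_mult_diff_distrib vector_scalar_commute vec.scale_right_diff_distrib
        del: vec.scale_scale vector_smult_assoc)
qed

lemma shifts_shift: "shifts A zs (shift A w x) = shift A w (shifts A zs x)"
proof (induction zs arbitrary: x)
  case (Cons z zs)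
  then show ?case by (simp add: shift_commute[of A z w])
qed simp

lemma shifts_commute: "shifts A zs (shifts A ws x) = shifts A ws (shifts A zs x)"
  by (induction zs arbitrary: x) (simp_all add: shifts_shift)

definition eigenvalue :: "complex^'m^'m \<Rightarrow> complex \<Rightarrow> bool" where
  "eigenvalue A z \<longleftrightarrow> (\<exists>w. w \<noteq> 0 \<and> shift A z w = 0)"

text \<open>Split off a root of \<open>p\<close>. If it is an eigenvalue, it joins the list; otherwise the
  factor belonging to it is injective and can be cancelled.\<close>

lemma eigenvalue_shifts_kill_poly:
  assumes "p \<noteq> 0" "poly_apply A p v = 0"
  shows "\<exists>zs. (\<forall>z\<in>set zs. eigenvalue A z) \<and> shifts A zs v = 0"
  using assms
proof (induction "degree p" arbitrary: p v rule: less_induct)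
  case less
  show ?case
  proof (cases "degree p = 0")
    case True
    then obtain a where p: "p = [:a:]" using degree_eq_zeroE by blast
    then have "v = 0" using less.prems by simp
    then show ?thesis by (intro exI[of _ "[]"]) simp
  next
    case False
    then have "\<not> constant (poly p)" by (simp add: constant_degree)
    then obtain z where "poly p z = 0" using fundamental_theorem_of_algebra by blast
    then obtain q where q: "p = [:- z, 1:] * q" by (metis dvd_def poly_eq_0_iff_dvd)
    have q0: "q \<noteq> 0" using q less.prems by auto
    have deg: "degree q < degree p" using q0 unfolding q by (simp add: degree_mult_eq del: mult_pCons_left)
    have sh: "shift A z (poly_apply A q v) = 0" using less.prems q poly_apply_linear_factor by metis
    show ?thesis
    proof (cases "eigenvalue A z")
      case True
      have "poly_apply A q (shift A z v) = 0" using sh by (simp add: poly_apply_shift)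
      from less.hyps[OF deg q0 this] obtain zs where "\<forall>z\<in>set zs. eigenvalue A z" "shifts A zs (shift A z v) = 0" by blast
      then show ?thesis using True by (intro exI[of _ "z # zs"]) simp
    next
      case False
      then have "poly_apply A q v = 0" using sh eigenvalue_def by blast
      then show ?thesis using less.hyps[OF deg q0] by blast
    qed
  qed
qed

text \<open>A weak form of the Cayley-Hamilton theorem: some product of factors \<open>A - z\<close> with
  eigenvalues \<open>z\<close> vanishes. Since the factors commute, the lists that belong to
  the coordinate vectors can simply be concatenated.\<close>

lemma eigenvalue_shifts_kill_all: "\<exists>zs. (\<forall>z\<in>set zs. eigenvalue A z) \<and> (\<forall>x. shifts A zs x = 0)"
proof -
  have "\<exists>zs. (\<forall>z\<in>set zs. eigenvalue A z) \<and> (\<forall>i\<in>J. shifts A zs (axis i 1) = 0)" if "finite J" for J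
    using that
  proof (induction J)
    case (insert j J)
    then obtain zs where zs: "\<forall>z\<in>set zs. eigenvalue A z" "\<forall>i\<in>J. shifts A zs (axis i 1) = 0" by blast
    obtain ws where ws: "\<forall>z\<in>set ws. eigenvalue A z" "shifts A ws (axis j 1) = 0"
      using annihilating_poly_exists eigenvalue_shifts_kill_poly by metis
    have "shifts A (zs @ ws) (axis i 1) = 0" if "i \<in> insert j J" for i
      using that zs(2) ws(2) by (metis insert_iff shifts_append shifts_commute shifts_linear(3))
    then show ?case using zs(1) ws(1) by (intro exI[of _ "zs @ ws"]) auto
  qed (auto intro: exI[of _ "[]"])
  from this[of UNIV] obtain zs where zs: "\<forall>z\<in>set zs. eigenvalue A z" "\<And>i. shifts A zs (axis i 1) = 0" by auto
  have sum: "shifts A zs (sum F I) = (\<Sum>i\<in>I. shifts A zs (F i))" for F and I :: "'a set"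
    by (induction I rule: infinite_finite_induct) (simp_all add: shifts_linear)
  have "shifts A zs x = 0" for x
  proof -
    have "shifts A zs x = shifts A zs (\<Sum>i\<in>UNIV. (x $ i) *s axis i 1)" by (simp add: basis_expansion)
    also have "\<dots> = 0" by (simp add: sum shifts_linear zs(2))
    finally show ?thesis .
  qed
  then show ?thesis using zs(1) by blast
qed

lemma inner_complex_smult:
  fixes x :: "complex^'m"
  shows "x \<bullet> (z *s x) = Re z * (norm x)\<^sup>2"
proof -
  have "x $ i \<bullet> (z * x $ i) = Re z * (x $ i \<bullet> x $ i)" for i
    unfolding inner_complex_def times_complex.simps by algebra
  then show ?thesis
    by (simp add: inner_vec_def power2_norm_eq_inner sum_distrib_left)
qed

lemma linear_shift: "linear (shift A z)"
proof (rule linearI)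
  show "shift A z (r *\<^sub>R x) = r *\<^sub>R shift A z x" for r x
  proof -
    have "r *\<^sub>R y = complex_of_real r *s y" for y :: "complex^'a"
      by (simp add: vec_eq_iff complex_eq_iff)
    then show ?thesis by (simp only: shift_linear)
  qed
qed (rule shift_linear)

lemma bilinear_from_linear: "(\<And>y. linear (\<lambda>x. B x y)) \<Longrightarrow> (\<And>x. linear (\<lambda>y. B x y)) \<Longrightarrow> bilinear B"
  unfolding bilinear_def by blast

text \<open>The factor \<open>N = A - z\<close> commutes with \<open>A\<close> and maps the kernel for
  \<open>z # zs\<close> into the one for \<open>zs\<close>, so a form for the latter can be
  pulled back along \<open>N\<close>. Adding \<open>sgn (Re z)\<close> times the inner product
  contributes \<open>\<bar>Re z\<bar> * (norm x)\<^sup>2\<close> up to an error \<open>norm x *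
  norm (N x)\<close>, because \<open>A x = z x + N x\<close>; a large multiple of the pulled
  back form absorbs the error.\<close>

lemma lyapunov_form_on_kernel:
  fixes A :: "complex^'m^'m"
  assumes "\<forall>z\<in>set zs. Re z \<noteq> 0"
  shows "\<exists>B c. bilinear B \<and> (\<forall>x y. B x y = B y x) \<and> c > (0::real) \<and>
            (\<forall>x. shifts A zs x = 0 \<longrightarrow> c * (norm x)\<^sup>2 \<le> B x (A *v x))"
  using assms
proof (induction zs)
  case Nil
  show ?case
    by (intro exI[of _ "\<lambda>x y. 0"] exI[of _ 1]) (auto simp: bilinear_def linear_iff)
next
  case (Cons z zs)
  then obtain B c where B: "bilinear B" "\<And>x y. B x y = B y x" "c > 0"
    and Bc: "\<And>x. shifts A zs x = 0 \<Longrightarrow> c * (norm x)\<^sup>2 \<le> B x (A *v x)" by auto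
  define \<rho> where "\<rho> = \<bar>Re z\<bar>"
  have \<rho>: "\<rho> > 0" using Cons.prems by (simp add: \<rho>_def)
  \<comment> \<open>with this factor the pulled back form yields exactly the term needed in Young's inequality\<close>
  define M where "M = 1 / (2 * \<rho> * c)"
  define N where "N = shift A z"
  define B' where "B' x y = M * B (N x) (N y) + sgn (Re z) * (x \<bullet> y)" for x y
  have linN: "linear N" unfolding N_def by (rule linear_shift)
  have "bilinear B'"
  proof (rule bilinear_from_linear)
    show "linear (\<lambda>x. B' x y)" for y
      unfolding B'_def by (rule linearI)
        (simp_all add: linear_add[OF linN] linear_scale[OF linN] bilinear_ladd[OF B(1)] bilinear_lmul[OF B(1)]
          inner_left_distrib algebra_simps)
    show "linear (\<lambda>y. B' x y)" for x
      unfolding B'_def by (rule linearI)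
        (simp_all add: linear_add[OF linN] linear_scale[OF linN] bilinear_radd[OF B(1)] bilinear_rmul[OF B(1)]
          inner_right_distrib algebra_simps)
  qed
  moreover have "B' x y = B' y x" for x y by (simp add: B'_def B(2)[of "N x"] inner_commute)
  moreover have "\<rho> / 2 * (norm x)\<^sup>2 \<le> B' x (A *v x)" if x: "shifts A (z # zs) x = 0" for x
  proof -
    have NA: "N (A *v x) = A *v N x"
      by (simp add: N_def shift_def matrix_vector_mult_diff_distrib vector_scalar_commute)
    have Ax: "A *v x = z *s x + N x" by (simp add: N_def shift_def)
    have "M * (c * (norm (N x))\<^sup>2) \<le> M * B (N x) (N (A *v x))"
      unfolding NA using x \<rho> B(3) by (intro mult_left_mono Bc) (simp_all add: N_def M_def)
    moreover have "M * (c * (norm (N x))\<^sup>2) = (norm (N x))\<^sup>2 / (2 * \<rho>)"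
      using B(3) by (simp add: M_def)
    moreover have "sgn (Re z) * (x \<bullet> (A *v x)) = \<rho> * (norm x)\<^sup>2 + sgn (Re z) * (x \<bullet> N x)"
      unfolding Ax inner_right_distrib inner_complex_smult by (simp add: \<rho>_def algebra_simps abs_sgn)
    moreover have "- (norm x * norm (N x)) \<le> sgn (Re z) * (x \<bullet> N x)"
    proof -
      have "\<bar>sgn (Re z) * (x \<bullet> N x)\<bar> \<le> 1 * (norm x * norm (N x))"
        unfolding abs_mult by (intro mult_mono Cauchy_Schwarz_ineq2) (auto simp: sgn_if)
      then show ?thesis by linarith
    qed
    moreover have "norm x * norm (N x) \<le> \<rho> / 2 * (norm x)\<^sup>2 + (norm (N x))\<^sup>2 / (2 * \<rho>)"
    proof -
      have "0 \<le> (\<rho> * norm x - norm (N x))\<^sup>2 / (2 * \<rho>)" using \<rho> by simp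
      also have "\<dots> = \<rho> / 2 * (norm x)\<^sup>2 + (norm (N x))\<^sup>2 / (2 * \<rho>) - norm x * norm (N x)"
        using \<rho> by (simp add: power2_diff field_simps power2_eq_square)
      finally show ?thesis by simp
    qed
    ultimately show ?thesis by (simp add: B'_def field_simps)
  qed
  ultimately show ?case using \<rho> by (intro exI[of _ B'] exI[of _ "\<rho> / 2"]) auto
qed

definition cvec :: "real^'m \<Rightarrow> complex^'m" where
  "cvec x = (\<chi> i. complex_of_real (x $ i))"

lemma norm_cvec [simp]: "norm (cvec x) = norm x"
  unfolding cvec_def norm_vec_def L2_set_def
    by simp

lemma cvec_matrix: "map_matrix complex_of_real M *v cvec x = cvec (M *v x)"
  by (simp add: cvec_def vec_eq_iff matrix_vector_mult_def)

lemma linear_cvec: "linear cvec"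
proof (rule linearI)
  show "cvec (x + y) = cvec x + cvec y" for x y
    by (simp add: cvec_def vec_eq_iff)
  show "cvec (r *\<^sub>R x) = r *\<^sub>R cvec x" for r x
    by (simp add: cvec_def vec_eq_iff complex_eq_iff)
qed

lemma eigenvalue_det:
  assumes "eigenvalue A z" shows "det (mat z - A) = 0"
proof -
  obtain w where w: "w \<noteq> 0" "shift A z w = 0" using assms eigenvalue_def by blast
  have "mat z *v w = z *s w"
    by (simp add: mat_def matrix_vector_mult_def vec_eq_iff if_distrib[of "\<lambda>c. c * _"] cong: if_cong)
  then have "(mat z - A) *v w = 0"
    using w(2) by (simp add: matrix_vector_mult_diff_rdistrib shift_def)
  then have "\<not> invertible (mat z - A)" using w(1)
    by (metis invertible_left_inverse matrix_left_invertible_ker)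
  then show ?thesis by (simp add: invertible_det_nz)
qed

text \<open>The form on complex vectors restricts to real ones. As \<open>L\<close> anticommutes with the
  involution \<open>R\<close>, the form \<open>- B (R x) (R y)\<close> is positive on
  \<open>(x, L x)\<close> as well, and averaging the two makes the form change sign under
  \<open>R\<close>.\<close>

lemma lyapunov_form_exists:
  fixes L R :: "real^'m \<Rightarrow> real^'m"
  assumes L: "linear L"
    and hyp: "\<And>z. det (mat z - map_matrix complex_of_real (matrix L)) = 0 \<Longrightarrow> Re z \<noteq> 0"
    and R: "linear R" "\<And>x. R (R x) = x" "\<And>x. L (R x) = - R (L x)"
  shows "\<exists>B c. bilinear B \<and> (\<forall>x y. B x y = B y x) \<and> (\<forall>x y. B (R x) (R y) = - B x y) \<and>
            c > (0::real) \<and> (\<forall>x. c * (norm x)\<^sup>2 \<le> B x (L x))"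
proof -
  let ?A = "map_matrix complex_of_real (matrix L)"
  obtain zs where zs: "\<forall>z\<in>set zs. eigenvalue ?A z" "\<And>x. shifts ?A zs x = 0"
    using eigenvalue_shifts_kill_all by blast
  have "\<forall>z\<in>set zs. Re z \<noteq> 0" using zs(1) eigenvalue_det hyp by blast
  from lyapunov_form_on_kernel[OF this, of ?A] obtain B c where B: "bilinear B" "\<And>x y. B x y = B y x" "c > (0::real)"
    "\<And>x. c * (norm x)\<^sup>2 \<le> B x (?A *v x)" using zs(2) by metis
  define B' where "B' x y = (B (cvec x) (cvec y) - B (cvec (R x)) (cvec (R y))) / 2" for x y
  note lins = linear_add[OF linear_cvec] linear_scale[OF linear_cvec] linear_add[OF R(1)] linear_scale[OF R(1)]
  have "bilinear B'"
  proof (rule bilinear_from_linear)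
    show "linear (\<lambda>x. B' x y)" for y
      unfolding B'_def by (rule linearI)
        (simp_all add: lins bilinear_ladd[OF B(1)] bilinear_lmul[OF B(1)] field_simps)
    show "linear (\<lambda>y. B' x y)" for x
      unfolding B'_def by (rule linearI)
        (simp_all add: lins bilinear_radd[OF B(1)] bilinear_rmul[OF B(1)] field_simps)
  qed
  moreover have "B' x y = B' y x" for x y by (simp add: B'_def B(2)[of "cvec x"] B(2)[of "cvec (R x)"])
  moreover have "B' (R x) (R y) = - B' x y" for x y by (simp add: B'_def R(2) field_simps)
  moreover have "c / 2 * (norm x)\<^sup>2 \<le> B' x (L x)" for x
  proof -
    have AL: "?A *v cvec x = cvec (L x)" for x
      unfolding cvec_matrix by (simp add: matrix_works L)
    have "cvec (R (L x)) = - cvec (L (R x))" by (simp add: R(3) linear_neg[OF linear_cvec])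
    then have "- B (cvec (R x)) (cvec (R (L x))) = B (cvec (R x)) (cvec (L (R x)))"
      by (simp add: bilinear_rneg[OF B(1)])
    moreover have "0 \<le> c * (norm (cvec (R x)))\<^sup>2" using B(3) by simp
    ultimately show ?thesis using B(4)[of "cvec x"] B(4)[of "cvec (R x)"] by (simp add: B'_def AL)
  qed
  ultimately show ?thesis using B(3) by (intro exI[of _ B'] exI[of _ "c / 2"]) auto
qed

section \<open>Growth and decay along curves controlled by a Lyapunov form\<close>

lemma exp_growth:
  fixes w w' :: "real \<Rightarrow> real"
  assumes der: "\<And>t. t \<ge> T \<Longrightarrow> (w has_real_derivative w' t) (at t within {T..})"
    and ge: "\<And>t. t \<ge> T \<Longrightarrow> a * w t \<le> w' t"
    and st: "T \<le> s" "s \<le> t"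
  shows "exp (a * (t - s)) * w s \<le> w t"
proof -
  define u where "u t = exp (- a * t) * w t" for t
  have du: "(u has_real_derivative exp (- a * t) * (w' t - a * w t)) (at t within {T..})" if "t \<ge> T" for t
    unfolding u_def[abs_def] using der[OF that] by (auto intro!: derivative_eq_intros simp: algebra_simps)
  have "u s \<le> u t"
  proof (rule DERIV_nonneg_imp_increasing_open[OF st(2)])
    fix r assume r: "s < r" "r < t"
    have "at r within {T..} = at r" using r st by (intro at_within_interior) auto
    then have "(u has_real_derivative exp (- a * r) * (w' r - a * w r)) (at r)"
      using du[of r] r st by simp
    then show "\<exists>y. (u has_real_derivative y) (at r) \<and> 0 \<le> y"
      using ge[of r] r st by (intro exI[of _ "exp (- a * r) * (w' r - a * w r)"]) auto
  next
    show "continuous_on {s..t} u"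
    proof (rule DERIV_continuous_on)
      show "(u has_real_derivative exp (- a * r) * (w' r - a * w r)) (at r within {s..t})" if "r \<in> {s..t}" for r
        by (rule DERIV_subset[OF du]) (use that st in auto)
    qed
  qed
  then have "exp (a * t) * (exp (- a * s) * w s) \<le> exp (a * t) * (exp (- a * t) * w t)"
    by (intro mult_left_mono) (auto simp: u_def)
  moreover have "exp (a * t) * (exp (- a * s) * w s) = exp (a * (t - s)) * w s"
    by (simp add: right_diff_distrib exp_diff exp_minus field_simps)
  moreover have "exp (a * t) * (exp (- a * t) * w t) = w t"
    by (simp add: exp_minus)
  ultimately show ?thesis by (simp only:)
qed

text \<open>If the derivative of \<open>B (x t) (x t)\<close> along a curve dominates \<open>(norm (x
  t))\<^sup>2\<close>, then a bounded curve stays where the form is negative and decays, while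
  a curve that enters the region where the form is positive stays there and grows, both at an
  exponential rate.\<close>

locale lyapunov =
  fixes B :: "'a::euclidean_space \<Rightarrow> 'a \<Rightarrow> real" and c h L :: real
  assumes bil: "bounded_bilinear B" and sym: "B x y = B y x"
    and c: "c > 0" and L: "L > 0" and h: "h > 0" and B_le: "\<bar>B x x\<bar> \<le> h * (norm x)\<^sup>2"
begin

text \<open>The form may be perturbed by \<open>\<tau> * (norm x)\<^sup>2\<close> with
  \<open>\<bar>\<tau>\<bar> \<le> \<kappa>\<close> without losing its monotonicity along the
  curves; \<open>\<sigma>\<close> and \<open>K\<close> are the rate and the constant of the
  exponential estimates.\<close>

definition "\<kappa> = c / (2 * L)"
definition "\<sigma> = c / (2 * h)"
definition "K = sqrt (2 * h / \<kappa>)"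

lemma \<kappa>: "\<kappa> > 0" and \<sigma>: "\<sigma> > 0" and K: "K > 0"
  using c L h by (auto simp: \<kappa>_def \<sigma>_def K_def)

definition lyap_curve :: "real \<Rightarrow> (real \<Rightarrow> 'a) \<Rightarrow> (real \<Rightarrow> 'a) \<Rightarrow> bool" where
  "lyap_curve T x v \<longleftrightarrow> (\<forall>t\<ge>T. (x has_vector_derivative v t) (at t within {T..}) \<and>
      norm (v t) \<le> L * norm (x t) \<and> c * (norm (x t))\<^sup>2 \<le> B (x t) (v t))"

context
  fixes T x v assumes xv: "lyap_curve T x v"
begin

lemma form_derivative:
  assumes t: "t \<ge> T"
  shows "((\<lambda>t. B (x t) (x t) + \<tau> * (norm (x t))\<^sup>2) has_real_derivative 2 * B (x t) (v t) + \<tau> * (2 * (x t \<bullet> v t)))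
     (at t within {T..})"
proof -
  have "(x has_vector_derivative v t) (at t within {T..})" using xv t by (auto simp: lyap_curve_def)
  then have x: "(x has_derivative (\<lambda>h. h *\<^sub>R v t)) (at t within {T..})"
    by (simp add: has_vector_derivative_def)
  have "((\<lambda>t. B (x t) (x t) + \<tau> * (x t \<bullet> x t)) has_derivative
      (\<lambda>h. (B (x t) (h *\<^sub>R v t) + B (h *\<^sub>R v t) (x t)) + \<tau> * (x t \<bullet> (h *\<^sub>R v t) + (h *\<^sub>R v t) \<bullet> x t))) (at t within {T..})"
    by (intro has_derivative_add has_derivative_mult_right has_derivative_inner
        bounded_bilinear.FDERIV[OF bil] x)
  also have "(\<lambda>h. (B (x t) (h *\<^sub>R v t) + B (h *\<^sub>R v t) (x t)) + \<tau> * (x t \<bullet> (h *\<^sub>R v t) + (h *\<^sub>R v t) \<bullet> x t))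
      = (*) (2 * B (x t) (v t) + \<tau> * (2 * (x t \<bullet> v t)))"
    by (simp add: fun_eq_iff sym[of "v t"] inner_commute[of "v t"] bounded_bilinear.scaleR_right[OF bil]
        bounded_bilinear.scaleR_left[OF bil] algebra_simps)
  finally show ?thesis by (simp add: has_field_derivative_def power2_norm_eq_inner)
qed

lemma form_derivative_ge:
  assumes t: "t \<ge> T" and \<tau>: "\<bar>\<tau>\<bar> \<le> \<kappa>"
  shows "c * (norm (x t))\<^sup>2 \<le> 2 * B (x t) (v t) + \<tau> * (2 * (x t \<bullet> v t))"
proof -
  have v: "norm (v t) \<le> L * norm (x t)" "c * (norm (x t))\<^sup>2 \<le> B (x t) (v t)"
    using xv t by (auto simp: lyap_curve_def)
  have "\<bar>x t \<bullet> v t\<bar> \<le> norm (x t) * norm (v t)" by (rule Cauchy_Schwarz_ineq2)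
  also have "\<dots> \<le> norm (x t) * (L * norm (x t))" using v(1) by (intro mult_left_mono) auto
  finally have "\<bar>\<tau>\<bar> * (2 * \<bar>x t \<bullet> v t\<bar>) \<le> \<kappa> * (2 * (L * (norm (x t))\<^sup>2))"
    using \<tau> \<kappa> by (intro mult_mono) (auto simp: power2_eq_square mult_ac)
  also have "\<dots> = c * (norm (x t))\<^sup>2" using L by (simp add: \<kappa>_def)
  finally have "\<bar>\<tau> * (2 * (x t \<bullet> v t))\<bar> \<le> c * (norm (x t))\<^sup>2" by (simp add: abs_mult)
  then show ?thesis using v(2) by linarith
qed

lemma form_growth:
  assumes st: "T \<le> s" "s \<le> t" and \<tau>: "\<bar>\<tau>\<bar> \<le> \<kappa>"
    and a: "\<And>t. t \<ge> T \<Longrightarrow> a * (B (x t) (x t) + \<tau> * (norm (x t))\<^sup>2) \<le> c * (norm (x t))\<^sup>2"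
  shows "exp (a * (t - s)) * (B (x s) (x s) + \<tau> * (norm (x s))\<^sup>2) \<le> B (x t) (x t) + \<tau> * (norm (x t))\<^sup>2"
  by (rule exp_growth[OF form_derivative order_trans[OF a form_derivative_ge[OF _ \<tau>]] st])

text \<open>Where the perturbed form is positive it grows exponentially, and the curve with it.\<close>

lemma bounded_imp_form_neg:
  assumes bdd: "\<And>t. t \<ge> T \<Longrightarrow> norm (x t) \<le> M" and s: "s \<ge> T"
  shows "B (x s) (x s) + \<kappa> * (norm (x s))\<^sup>2 \<le> 0"
proof (rule ccontr)
  let ?W = "\<lambda>t. B (x t) (x t) + \<kappa> * (norm (x t))\<^sup>2"
  assume "\<not> ?thesis"
  then have pos: "?W s > 0" by simp
  have W_le: "?W t \<le> (h + \<kappa>) * (norm (x t))\<^sup>2" for t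
    using B_le[of "x t"] by (simp add: algebra_simps)
  define a where "a = c / (h + \<kappa>)"
  have a: "a > 0" using c h \<kappa> by (simp add: a_def)
  have aW: "a * ?W t \<le> c * (norm (x t))\<^sup>2" for t
  proof -
    have "a * ?W t \<le> a * ((h + \<kappa>) * (norm (x t))\<^sup>2)" using W_le a by (intro mult_left_mono) auto
    also have "\<dots> = c * (norm (x t))\<^sup>2" using h \<kappa> by (simp add: a_def)
    finally show ?thesis .
  qed
  define N where "N = (h + \<kappa>) * M\<^sup>2"
  have N: "?W t \<le> N" if "t \<ge> T" for t
  proof -
    have "(h + \<kappa>) * (norm (x t))\<^sup>2 \<le> N"
      unfolding N_def using bdd[OF that] h \<kappa> by (intro mult_left_mono power_mono) auto
    then show ?thesis using W_le[of t] by linarith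
  qed
  then have N0: "N > 0" using pos s by (meson less_le_trans)
  \<comment> \<open>by this time even the linear lower bound \<open>1 + a (t - s)\<close> of the exponential exceeds the bound \<open>N\<close>\<close>
  define t where "t = s + N / (a * ?W s)"
  have st: "s \<le> t" using N0 a pos by (simp add: t_def)
  have "?W s + N = (1 + a * (t - s)) * ?W s" using a pos by (simp add: t_def distrib_right)
  also have "\<dots> \<le> exp (a * (t - s)) * ?W s" using pos by (intro mult_right_mono exp_ge_add_one_self) auto
  also have "\<dots> \<le> ?W t" using \<kappa> by (intro form_growth s st aW) auto
  also have "\<dots> \<le> N" using N s st by simp
  finally show False using pos by simp
qed

lemma decay_from_squares:
  assumes "p\<^sup>2 \<le> (2 * h / \<kappa>) * exp (- (2 * \<sigma>) * r) * q\<^sup>2" "q \<ge> 0"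
  shows "p \<le> K * exp (- \<sigma> * r) * q"
proof (rule power2_le_imp_le)
  have "exp (- \<sigma> * r) ^ 2 = exp (- (2 * \<sigma>) * r)" by (simp add: exp_double[symmetric] mult_ac)
  moreover have "K\<^sup>2 = 2 * h / \<kappa>" using h \<kappa> by (simp add: K_def)
  ultimately show "p\<^sup>2 \<le> (K * exp (- \<sigma> * r) * q)\<^sup>2" using assms by (simp add: power_mult_distrib)
qed (use K assms in auto)

text \<open>On a bounded curve the negative of the form is comparable with \<open>(norm x)\<^sup>2\<close>,
  and it decreases exponentially.\<close>

lemma bounded_imp_decay:
  assumes bdd: "\<And>t. t \<ge> T \<Longrightarrow> norm (x t) \<le> M" and st: "T \<le> s" "s \<le> t"
  shows "norm (x t) \<le> K * exp (- \<sigma> * (t - s)) * norm (x s)"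
proof (rule decay_from_squares)
  have "(- 2 * \<sigma>) * (B (x t) (x t) + 0 * (norm (x t))\<^sup>2) \<le> c * (norm (x t))\<^sup>2" for t
  proof -
    have "(2 * \<sigma>) * (- B (x t) (x t)) \<le> (2 * \<sigma>) * (h * (norm (x t))\<^sup>2)"
      using B_le[of "x t"] \<sigma> by (intro mult_left_mono) auto
    then show ?thesis using h by (simp add: \<sigma>_def)
  qed
  then have "exp ((- 2 * \<sigma>) * (t - s)) * (B (x s) (x s) + 0 * (norm (x s))\<^sup>2) \<le> B (x t) (x t) + 0 * (norm (x t))\<^sup>2"
    using \<kappa> by (intro form_growth st) auto
  moreover have "\<kappa> * (norm (x t))\<^sup>2 \<le> - B (x t) (x t)" using bounded_imp_form_neg[OF bdd, of t] st by simp
  moreover have "exp ((- 2 * \<sigma>) * (t - s)) * - B (x s) (x s) \<le> exp ((- 2 * \<sigma>) * (t - s)) * (h * (norm (x s))\<^sup>2)"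
    using B_le[of "x s"] by (intro mult_left_mono) auto
  ultimately have "\<kappa> * (norm (x t))\<^sup>2 \<le> exp ((- 2 * \<sigma>) * (t - s)) * (h * (norm (x s))\<^sup>2)" by simp
  also have "\<dots> \<le> 2 * (exp ((- 2 * \<sigma>) * (t - s)) * (h * (norm (x s))\<^sup>2))" using h by simp
  finally show "(norm (x t))\<^sup>2 \<le> (2 * h / \<kappa>) * exp (- (2 * \<sigma>) * (t - s)) * (norm (x s))\<^sup>2"
    using \<kappa> by (simp add: field_simps)
qed auto

lemma form_pos_imp_growth:
  assumes pos: "\<kappa> / 2 * (norm (x s))\<^sup>2 \<le> B (x s) (x s)" and st: "T \<le> s" "s \<le> t"
  shows "norm (x s) \<le> K * exp (- \<sigma> * (t - s)) * norm (x t)"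
proof (rule decay_from_squares)
  have "(2 * \<sigma>) * (B (x t) (x t) + 0 * (norm (x t))\<^sup>2) \<le> c * (norm (x t))\<^sup>2" for t
  proof -
    have "(2 * \<sigma>) * B (x t) (x t) \<le> (2 * \<sigma>) * (h * (norm (x t))\<^sup>2)"
      using B_le[of "x t"] \<sigma> by (intro mult_left_mono) auto
    then show ?thesis using h by (simp add: \<sigma>_def)
  qed
  then have "exp ((2 * \<sigma>) * (t - s)) * (B (x s) (x s) + 0 * (norm (x s))\<^sup>2) \<le> B (x t) (x t) + 0 * (norm (x t))\<^sup>2"
    using \<kappa> by (intro form_growth st) auto
  then have 1: "exp ((2 * \<sigma>) * (t - s)) * B (x s) (x s) \<le> B (x t) (x t)" by simp
  have 2: "exp ((2 * \<sigma>) * (t - s)) * (\<kappa> / 2 * (norm (x s))\<^sup>2) \<le> exp ((2 * \<sigma>) * (t - s)) * B (x s) (x s)"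
    using pos by (intro mult_left_mono) auto
  have "B (x t) (x t) \<le> h * (norm (x t))\<^sup>2" using B_le[of "x t"] by simp
  with 1 2 have "exp ((2 * \<sigma>) * (t - s)) * (\<kappa> / 2 * (norm (x s))\<^sup>2) \<le> h * (norm (x t))\<^sup>2"
    by (meson order_trans)
  then show "(norm (x s))\<^sup>2 \<le> (2 * h / \<kappa>) * exp (- (2 * \<sigma>) * (t - s)) * (norm (x t))\<^sup>2"
  proof -
    define E where "E = exp ((2 * \<sigma>) * (t - s))"
    assume "exp ((2 * \<sigma>) * (t - s)) * (\<kappa> / 2 * (norm (x s))\<^sup>2) \<le> h * (norm (x t))\<^sup>2"
    then have "E * (\<kappa> / 2 * (norm (x s))\<^sup>2) \<le> h * (norm (x t))\<^sup>2" by (simp only: E_def)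
    moreover have e: "exp (- (2 * \<sigma>) * (t - s)) = 1 / E" and "E > 0"
      unfolding E_def mult_minus_left exp_minus by (simp_all add: inverse_eq_divide)
    ultimately show ?thesis unfolding e using \<kappa> by (simp add: field_simps)
  qed
qed auto

lemma form_pos_persists:
  assumes pos: "\<kappa> / 2 * (norm (x s))\<^sup>2 < B (x s) (x s)" and st: "T \<le> s" "s \<le> t"
  shows "\<kappa> / 2 * (norm (x t))\<^sup>2 < B (x t) (x t)"
proof -
  have "exp (0 * (t - s)) * (B (x s) (x s) + - (\<kappa> / 2) * (norm (x s))\<^sup>2) \<le> B (x t) (x t) + - (\<kappa> / 2) * (norm (x t))\<^sup>2"
    using \<kappa> c by (intro form_growth st) auto
  then show ?thesis using pos by simp
qed

text \<open>The form minus \<open>\<kappa> * (norm x)\<^sup>2\<close> never falls below its initial value,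
  so the form is positive once the norm is large.\<close>

lemma unbounded_imp_form_pos:
  assumes unb: "\<And>M. \<exists>t\<ge>T. norm (x t) > M"
  shows "\<exists>t\<ge>T. \<kappa> / 2 * (norm (x t))\<^sup>2 < B (x t) (x t)"
proof -
  define W where "W = B (x T) (x T) - \<kappa> * (norm (x T))\<^sup>2"
  obtain t where t: "t \<ge> T" "norm (x t) > sqrt (2 * \<bar>W\<bar> / \<kappa>)" using unb by blast
  have "sqrt (2 * \<bar>W\<bar> / \<kappa>) ^ 2 < (norm (x t))\<^sup>2" using t(2) \<kappa> by (intro power_strict_mono) auto
  then have "\<bar>W\<bar> < \<kappa> / 2 * (norm (x t))\<^sup>2" using \<kappa> by (simp add: field_simps)
  moreover have "exp (0 * (t - T)) * (B (x T) (x T) + - \<kappa> * (norm (x T))\<^sup>2) \<le> B (x t) (x t) + - \<kappa> * (norm (x t))\<^sup>2"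
    using \<kappa> c t by (intro form_growth) auto
  then have "W \<le> B (x t) (x t) - \<kappa> * (norm (x t))\<^sup>2" by (simp add: W_def)
  ultimately have "\<kappa> / 2 * (norm (x t))\<^sup>2 < B (x t) (x t)" by linarith
  then show ?thesis using t(1) by blast
qed

end

end

section \<open>The vector field and its reversing symmetry\<close>

text \<open>The function \<open>w = (norm x)\<^sup>2\<close> satisfies \<open>w' \<le> 2 * L * w\<close>.\<close>

lemma gronwall_zero:
  fixes x v :: "real \<Rightarrow> 'a::real_inner"
  assumes der: "\<And>t. t \<ge> T \<Longrightarrow> (x has_vector_derivative v t) (at t within {T..})"
    and v: "\<And>t. t \<ge> T \<Longrightarrow> norm (v t) \<le> L * norm (x t)" and x0: "x T = 0" and t: "t \<ge> T"
  shows "x t = 0"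
proof -
  have "exp (2 * L * (t - T)) * (- (x T \<bullet> x T)) \<le> - (x t \<bullet> x t)"
  proof (rule exp_growth[where w' = "\<lambda>t. - (2 * (x t \<bullet> v t))" and T = T])
    fix t assume t: "T \<le> t"
    have "((\<lambda>t. - (x t \<bullet> x t)) has_derivative (\<lambda>h. - (x t \<bullet> (h *\<^sub>R v t) + (h *\<^sub>R v t) \<bullet> x t))) (at t within {T..})"
      using der[OF t] unfolding has_vector_derivative_def
      by (intro has_derivative_minus has_derivative_inner)
    also have "(\<lambda>h. - (x t \<bullet> (h *\<^sub>R v t) + (h *\<^sub>R v t) \<bullet> x t)) = (*) (- (2 * (x t \<bullet> v t)))"
      by (simp add: fun_eq_iff inner_commute[of "v t"])
    finally show "((\<lambda>t. - (x t \<bullet> x t)) has_real_derivative - (2 * (x t \<bullet> v t))) (at t within {T..})"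
      unfolding has_field_derivative_def .
    have "x t \<bullet> v t \<le> norm (x t) * norm (v t)" by (rule norm_cauchy_schwarz)
    also have "\<dots> \<le> norm (x t) * (L * norm (x t))" using v[OF t] by (intro mult_left_mono) auto
    also have "\<dots> = L * (x t \<bullet> x t)" by (simp add: power2_norm_eq_inner[symmetric] power2_eq_square)
    finally show "2 * L * (- (x t \<bullet> x t)) \<le> - (2 * (x t \<bullet> v t))" by simp
  qed (use t in auto)
  then have "x t \<bullet> x t \<le> 0" using x0 by simp
  then show ?thesis using inner_gt_zero_iff[of "x t"] by linarith
qed

lemma uminus_vector_derivative: "((uminus :: real \<Rightarrow> real) has_vector_derivative - 1) net"
  by (rule has_vector_derivative_minus[OF has_vector_derivative_id])

locale homoclinic_setting =
  fixes f :: "real^'m \<Rightarrow> real \<Rightarrow> real^'m"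
    and R :: "real^'m \<Rightarrow> real^'m"
    and sp :: "real^'m \<Rightarrow> real^'m \<Rightarrow> real"
    and n :: nat
    and xh :: "real \<Rightarrow> real^'m"
    and \<phi> \<psi> :: "nat \<Rightarrow> real \<Rightarrow> real^'m"
  assumes card: "CARD('m) = 2 * n" and n2: "n \<ge> 2"
    and analytic: "real_analytic_on (\<lambda>(x, \<mu>). f x \<mu>) UNIV"
    and R1: "R1 f R n" and R2: "R2 f" and R3: "R3 f n" and R4: "R4 f R xh" and R5: "R5 f R xh \<phi>"
    and sp: "is_scalar_product sp"
    and Fix_orth: "Fix (\<lambda>x. - R x) = {y. \<forall>x\<in>Fix R. sp x y = 0}"
    and fund: "VE_fundamental_system f R n xh \<phi>"
    and dual: "dual_system sp n \<phi> \<psi>"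
begin

abbreviation "F \<equiv> (\<lambda>(x, \<mu>). f x \<mu>)"
abbreviation "DF z \<equiv> frechet_derivative F (at z)"
abbreviation "D2F z h \<equiv> frechet_derivative (\<lambda>z. DF z h) (at z)"

lemma F_der: "(F has_derivative DF z) (at z)"
  by (rule frechet_derivative_has_derivative[OF analytic_differentiable[OF analytic]])

lemma lin_DF: "linear (DF z)"
  by (rule linear_frechet_derivative[OF analytic_differentiable[OF analytic]])

lemma Pair_der:
  "((\<lambda>y. (y, b)) has_derivative (\<lambda>u. (u, 0))) (at x)" "((\<lambda>y. (a, y)) has_derivative (\<lambda>u. (0, u))) (at x)"
  by (intro has_derivative_Pair has_derivative_ident has_derivative_const)+

lemma f_der: "((\<lambda>y. f y \<mu>) has_derivative (\<lambda>u. DF (x, \<mu>) (u, 0))) (at x)"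
  using has_derivative_compose[OF Pair_der(1) F_der] by simp

lemma Dx_eq: "Dx f x \<mu> u = DF (x, \<mu>) (u, 0)"
  unfolding Dx_def by (rule fun_cong[OF frechet_derivative_at[OF f_der, symmetric]])

lemma f_der': "((\<lambda>y. f y \<mu>) has_derivative Dx f x \<mu>) (at x)"
  using f_der[of \<mu> x] by (simp add: Dx_eq[abs_def])

lemma lin_Dx: "linear (Dx f x \<mu>)"
  using f_der' by (rule has_derivative_linear)

lemma f_der_mu: "((\<lambda>\<nu>. f x \<nu>) has_vector_derivative DF (x, \<mu>) (0, 1)) (at \<mu>)"
proof -
  have "((\<lambda>\<nu>. f x \<nu>) has_derivative (\<lambda>u. DF (x, \<mu>) (0, u))) (at \<mu>)"
    using has_derivative_compose[OF Pair_der(2) F_der] by simp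
  also have "(\<lambda>u. DF (x, \<mu>) (0, u)) = (\<lambda>u. u *\<^sub>R DF (x, \<mu>) (0, 1))"
  proof
    fix u :: real
    have "(0, u) = u *\<^sub>R (0 :: real^'m, 1)" by simp
    then have "DF (x, \<mu>) (0, u) = DF (x, \<mu>) (u *\<^sub>R (0, 1))" by (rule arg_cong)
    also have "\<dots> = u *\<^sub>R DF (x, \<mu>) (0, 1)" by (rule linear_scale[OF lin_DF])
    finally show "DF (x, \<mu>) (0, u) = u *\<^sub>R DF (x, \<mu>) (0, 1)" .
  qed
  finally show ?thesis unfolding has_vector_derivative_def .
qed

lemma Dmu_eq: "Dmu f x \<mu> = DF (x, \<mu>) (0, 1)"
  unfolding Dmu_def using f_der_mu by (rule vector_derivative_at)

lemma D2F_der: "((\<lambda>z. DF z h) has_derivative D2F z h) (at z)"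
  by (rule frechet_derivative_has_derivative[OF analytic_derivative_differentiable[OF analytic]])

lemma lin_D2F: "linear (D2F z h)"
  using D2F_der by (rule has_derivative_linear)

lemma Dx_der: "((\<lambda>y. Dx f y \<mu> u) has_derivative (\<lambda>v. D2F (x, \<mu>) (u, 0) (v, 0))) (at x)"
  unfolding Dx_eq
  by (rule has_derivative_compose[OF Pair_der(1) D2F_der])

lemma Dxx_eq: "Dxx f x \<mu> u v = D2F (x, \<mu>) (u, 0) (v, 0)"
  unfolding Dxx_def by (rule fun_cong[OF frechet_derivative_at[OF Dx_der, symmetric]])

lemma Dx_der': "((\<lambda>y. Dx f y \<mu> u) has_derivative Dxx f x \<mu> u) (at x)"
  using Dx_der[of \<mu> u x] by (simp add: Dxx_eq[abs_def])

lemma linR: "linear R" and RR: "R (R x) = x" and fR: "f (R x) \<mu> = - R (f x \<mu>)" and dimR: "dim (Fix R) = n"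
  using R1 unfolding R1_def by (auto simp: o_def id_def fun_eq_iff add_eq_0_iff)

lemma bounded_linear_R: "bounded_linear R"
  using linR by (rule linear_conv_bounded_linear[THEN iffD1])

lemma R_der: "(R has_derivative R) net"
  by (rule bounded_linear_imp_has_derivative[OF bounded_linear_R])

lemmas R_simps = linear_add[OF linR] linear_diff[OF linR] linear_neg[OF linR] linear_0[OF linR]
  linear_scale[OF linR] linear_sum[OF linR] RR

lemma Dx_R: "Dx f (R x) \<mu> (R u) = - R (Dx f x \<mu> u)"
proof -
  have "((\<lambda>y. f (R y) \<mu>) has_derivative (\<lambda>u. Dx f (R x) \<mu> (R u))) (at x)"
    by (rule has_derivative_compose[OF R_der f_der'])
  moreover have "((\<lambda>y. - R (f y \<mu>)) has_derivative (\<lambda>u. - R (Dx f x \<mu> u))) (at x)"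
    by (intro has_derivative_minus has_derivative_compose[OF f_der' R_der])
  ultimately show ?thesis
    unfolding fR by (rule has_derivative_unique[THEN fun_cong])
qed

lemma Dmu_R: "Dmu f (R x) \<mu> = - R (Dmu f x \<mu>)"
proof -
  have "((\<lambda>\<nu>. - R (f x \<nu>)) has_vector_derivative - R (Dmu f x \<mu>)) (at \<mu>)"
    unfolding Dmu_eq
    by (intro has_vector_derivative_minus bounded_linear.has_vector_derivative[OF bounded_linear_R] f_der_mu)
  then show ?thesis
    using f_der_mu[of "R x" \<mu>] unfolding fR Dmu_eq by (rule vector_derivative_unique_at[OF _ _, symmetric])
qed

lemma Dxx_R: "Dxx f (R x) \<mu> (R u) (R v) = - R (Dxx f x \<mu> u v)"
proof -
  have "((\<lambda>y. Dx f (R y) \<mu> (R u)) has_derivative (\<lambda>v. Dxx f (R x) \<mu> (R u) (R v))) (at x)"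
    by (rule has_derivative_compose[OF R_der Dx_der'])
  moreover have "((\<lambda>y. - R (Dx f y \<mu> u)) has_derivative (\<lambda>v. - R (Dxx f x \<mu> u v))) (at x)"
    by (intro has_derivative_minus has_derivative_compose[OF Dx_der' R_der])
  ultimately show ?thesis
    unfolding Dx_R by (rule has_derivative_unique[THEN fun_cong])
qed

section \<open>The homoclinic orbit\<close>

lemma xh_sol: "(xh has_vector_derivative f (xh t) 0) (at t)"
  and xh_top: "(xh \<longlongrightarrow> 0) at_top" and xh_bot: "(xh \<longlongrightarrow> 0) at_bot" and xh_nz: "\<exists>t. xh t \<noteq> 0"
  using R4 unfolding R4_def homoclinic_to_origin_def solution_def by blast+

lemma xh_sym: "xh t = R (xh (- t))"
  using R4 unfolding R4_def symmetric_orbit_def by blast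

lemma xh_cont: "continuous_on S xh"
  by (intro continuous_at_imp_continuous_on ballI has_vector_derivative_continuous[OF xh_sol])

lemma bounded_half_line:
  fixes x :: "real \<Rightarrow> 'a::real_normed_vector"
  assumes "continuous_on {T..} x" "((\<lambda>t. norm (x t)) \<longlongrightarrow> l) at_top"
  shows "\<exists>M. \<forall>t\<ge>T. norm (x t) \<le> M"
proof -
  have "\<forall>\<^sub>F t in at_top. norm (x t) < l + 1" using assms(2) by (rule order_tendstoD) simp
  then obtain N where N: "\<And>t. t \<ge> N \<Longrightarrow> norm (x t) < l + 1" by (auto simp: eventually_at_top_linorder)
  have "compact (x ` {T..N})"
    using assms(1) by (intro compact_continuous_image continuous_on_subset[OF assms(1)]) auto
  from compact_imp_bounded[OF this] have "\<exists>M. \<forall>t\<in>{T..N}. norm (x t) \<le> M"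
    unfolding bounded_iff by simp
  then obtain M where M: "\<And>t. t \<in> {T..N} \<Longrightarrow> norm (x t) \<le> M" by blast
  have "norm (x t) \<le> max M (l + 1)" if "t \<ge> T" for t
    using M[of t] N[of t] that by (cases "t \<le> N") (auto simp: max_def)
  then show ?thesis by blast
qed

lemma xh_bounded_ex: "\<exists>C. \<forall>t. norm (xh t) \<le> C"
proof -
  obtain M where M: "\<And>t. t \<ge> 0 \<Longrightarrow> norm (xh t) \<le> M"
    using bounded_half_line[OF xh_cont tendsto_norm[OF xh_top], of 0] by auto
  obtain C where C: "\<And>x. norm (R x) \<le> norm x * C" "C > 0"
    using bounded_linear.pos_bounded[OF bounded_linear_R] by blast
  have "norm (xh t) \<le> max M (M * C)" for t
  proof (cases "t \<ge> 0")
    case False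
    have "norm (xh t) \<le> norm (xh (- t)) * C" by (subst xh_sym) (rule C)
    also have "\<dots> \<le> M * C" using M[of "- t"] False C(2) by (intro mult_right_mono) auto
    finally show ?thesis by simp
  qed (use M in \<open>auto simp: le_max_iff_disj\<close>)
  then show ?thesis by blast
qed

definition "xh_bound = (SOME C. \<forall>t. norm (xh t) \<le> C)"

lemma xh_bounded: "norm (xh t) \<le> xh_bound"
  unfolding xh_bound_def using someI_ex[OF xh_bounded_ex] by blast

lemma xh0_in: "(xh t, 0 :: real) \<in> cball 0 (xh_bound + r)" if "r \<ge> 0"
  using xh_bounded[of t] that by (simp add: mem_cball_0 norm_Pair)

lemma VE_bound_ex: "\<exists>L>0. \<forall>t u. norm (Dx f (xh t) 0 u) \<le> L * norm u"
proof -
  obtain C where C: "C \<ge> 0" "\<And>z h. z \<in> cball 0 xh_bound \<Longrightarrow> norm (DF z h) \<le> C * norm h"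
    using analytic_derivative_bounded[OF analytic, of xh_bound] by blast
  have "norm (Dx f (xh t) 0 u) \<le> (C + 1) * norm u" for t u
  proof -
    have "norm (DF (xh t, 0) (u, 0)) \<le> C * norm (u, 0 :: real)" by (rule C(2)) (use xh0_in[of 0 t] in simp)
    then have "norm (DF (xh t, 0) (u, 0)) \<le> C * norm u" by (simp only: norm_Pair norm_zero) simp
    then show ?thesis unfolding Dx_eq distrib_right using norm_ge_zero[of u] by linarith
  qed
  then show ?thesis using C(1) by (intro exI[of _ "C + 1"]) auto
qed

section \<open>Solutions of the variational equation\<close>

lemma VE_unique:
  assumes "VE_solution f xh \<xi>" "\<xi> t0 = 0"
  shows "\<xi> t = 0"
proof -
  obtain L where L: "\<And>t u. norm (Dx f (xh t) 0 u) \<le> L * norm u" using VE_bound_ex by blast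
  have d: "(\<xi> has_vector_derivative Dx f (xh t) 0 (\<xi> t)) (at t within S)" for t S
    using assms(1) unfolding VE_solution_def using has_vector_derivative_at_within by blast
  show ?thesis
  proof (cases "t \<ge> t0")
    case True
    show ?thesis by (rule gronwall_zero[OF d L assms(2) True])
  next
    case False
    have d': "((\<lambda>s. \<xi> (- s)) has_vector_derivative - Dx f (xh (- s)) 0 (\<xi> (- s))) (at s within S)" for s S
      using vector_diff_chain_within[OF uminus_vector_derivative d] by (simp add: o_def)
    have "\<xi> (- (- t)) = 0"
      by (rule gronwall_zero[where x = "\<lambda>s. \<xi> (- s)" and T = "- t0" and L = L, OF d']) (use L assms(2) False in auto)
    then show ?thesis by simp
  qed
qed

lemma VE_lincomb:
  assumes "\<And>k. k \<in> J \<Longrightarrow> VE_solution f xh (\<xi> k)"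
  shows "VE_solution f xh (\<lambda>t. \<Sum>k\<in>J. c k *\<^sub>R \<xi> k t)"
proof -
  have "((\<lambda>t. \<Sum>k\<in>J. c k *\<^sub>R \<xi> k t) has_vector_derivative (\<Sum>k\<in>J. c k *\<^sub>R Dx f (xh t) 0 (\<xi> k t))) (at t)" for t
    using assms unfolding VE_solution_def
    by (intro has_vector_derivative_sum bounded_linear.has_vector_derivative[OF bounded_linear_scaleR_right]) auto
  then show ?thesis
    unfolding VE_solution_def by (simp add: linear_sum[OF lin_Dx] linear_scale[OF lin_Dx])
qed

lemma VE_diff:
  assumes "VE_solution f xh \<xi>" "VE_solution f xh \<eta>"
  shows "VE_solution f xh (\<lambda>t. \<xi> t - \<eta> t)"
  using assms unfolding VE_solution_def
  by (auto simp: linear_diff[OF lin_Dx] intro!: has_vector_derivative_diff)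

lemma VE_eqI:
  assumes "VE_solution f xh \<xi>" "VE_solution f xh \<eta>" "\<xi> t0 = \<eta> t0"
  shows "\<xi> t = \<eta> t"
  using VE_unique[OF VE_diff[OF assms(1,2)], of t0 t] assms(3) by simp

lemma VE_reverse:
  assumes "VE_solution f xh \<xi>"
  shows "VE_solution f xh (\<lambda>t. R (\<xi> (- t)))"
  unfolding VE_solution_def
proof
  fix t
  have "(\<xi> has_vector_derivative Dx f (xh (- t)) 0 (\<xi> (- t))) (at (- t))"
    using assms by (simp add: VE_solution_def)
  then have "((\<lambda>s. \<xi> (- s)) has_vector_derivative - Dx f (xh (- t)) 0 (\<xi> (- t))) (at t)"
    using vector_diff_chain_at[OF uminus_vector_derivative] by (fastforce simp: o_def)
  then have "((\<lambda>s. R (\<xi> (- s))) has_vector_derivative R (- Dx f (xh (- t)) 0 (\<xi> (- t)))) (at t)"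
    by (rule bounded_linear.has_vector_derivative[OF bounded_linear_R])
  also have "R (- Dx f (xh (- t)) 0 (\<xi> (- t))) = Dx f (xh t) 0 (R (\<xi> (- t)))"
    by (subst (2) xh_sym) (simp add: Dx_R R_simps)
  finally show "((\<lambda>s. R (\<xi> (- s))) has_vector_derivative Dx f (xh t) 0 (R (\<xi> (- t)))) (at t)" .
qed

lemma phi_VE: "k \<in> {1..2*n} \<Longrightarrow> VE_solution f xh (\<phi> k)"
  using fund unfolding VE_fundamental_system_def by blast

lemma phi_der: "k \<in> {1..2*n} \<Longrightarrow> (\<phi> k has_vector_derivative Dx f (xh t) 0 (\<phi> k t)) (at t)"
  using phi_VE unfolding VE_solution_def by blast

lemma phi_cont: "k \<in> {1..2*n} \<Longrightarrow> continuous_on S (\<phi> k)"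
  by (intro continuous_at_imp_continuous_on ballI has_vector_derivative_continuous[OF phi_der])

lemma phi1: "\<phi> 1 t = f (xh t) 0"
  using R5 vector_derivative_at[OF xh_sol] unfolding R5_def by simp

lemma phi1_rev: "R (\<phi> 1 t) = - \<phi> 1 (- t)"
  unfolding phi1 using fR[of "xh t" 0] xh_sym[of "- t"] by simp

text \<open>Since reversal maps solutions to solutions, the parity of a solution is decided at \<open>t =
  0\<close>.\<close>

lemma phi2_rev: "R (\<phi> 2 t) = \<phi> 2 (- t)"
proof -
  have e: "R (\<phi> 2 0) = \<phi> 2 0" using R5 unfolding R5_def Fix_def by simp
  have v: "VE_solution f xh (\<phi> 2)" using n2 by (intro phi_VE) auto
  show ?thesis using VE_eqI[OF v VE_reverse[OF v], of 0 "- t"] e by simp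
qed

lemma phin1_rev: "R (\<phi> (n+1) t) = \<phi> (n+1) (- t)"
proof -
  have e: "R (\<phi> (n+1) 0) = \<phi> (n+1) 0" using fund unfolding VE_fundamental_system_def Fix_def by simp
  have v: "VE_solution f xh (\<phi> (n+1))" using n2 by (intro phi_VE) auto
  show ?thesis using VE_eqI[OF v VE_reverse[OF v], of 0 "- t"] e by simp
qed

lemma phin2_rev: "R (\<phi> (n+2) t) = - \<phi> (n+2) (- t)"
proof -
  have e: "- R (\<phi> (n+2) 0) = \<phi> (n+2) 0" using fund unfolding VE_fundamental_system_def Fix_def by simp
  have v: "VE_solution f xh (\<phi> (n+2))" using n2 by (intro phi_VE) auto
  have "VE_solution f xh (\<lambda>t. \<Sum>k\<in>{()}. (-1) *\<^sub>R R (\<phi> (n+2) (- t)))"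
    by (rule VE_lincomb) (rule VE_reverse[OF v])
  then have w: "VE_solution f xh (\<lambda>t. - R (\<phi> (n+2) (- t)))" by simp
  have "\<phi> (n+2) (- t) = - R (\<phi> (n+2) t)" using VE_eqI[OF v w, of 0 "- t"] e by simp
  then show ?thesis by simp
qed

lemma phinj_rev: "j \<in> {3..n} \<Longrightarrow> R (\<phi> (n+j) t) = \<phi> j (- t)"
  and phij_rev: "j \<in> {3..n} \<Longrightarrow> R (\<phi> j t) = \<phi> (n+j) (- t)"
  using fund unfolding VE_fundamental_system_def by (simp_all add: RR)


section \<open>The scalar product and the dual system\<close>

lemma sp_bilinear: "bilinear sp" and sp_sym: "sp x y = sp y x" and sp_pos: "x \<noteq> 0 \<Longrightarrow> sp x x > 0"
  using sp unfolding is_scalar_product_def bilinear_def by blast+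

lemma sp_bb: "bounded_bilinear sp"
  using sp_bilinear by (simp add: bilinear_conv_bounded_bilinear)

lemmas sp_simps = bilinear_ladd[OF sp_bilinear] bilinear_radd[OF sp_bilinear] bilinear_lsub[OF sp_bilinear]
  bilinear_rsub[OF sp_bilinear] bilinear_lneg[OF sp_bilinear] bilinear_rneg[OF sp_bilinear]
  bilinear_lmul[OF sp_bilinear] bilinear_rmul[OF sp_bilinear]
  bounded_bilinear.zero_left[OF sp_bb] bounded_bilinear.zero_right[OF sp_bb]

lemma sp_sum_right: "sp x (\<Sum>k\<in>J. y k) = (\<Sum>k\<in>J. sp x (y k))"
  by (rule bounded_bilinear.sum_right[OF sp_bb])

text \<open>The involution is \<open>1\<close> on \<open>Fix R\<close> and \<open>-1\<close> on the
  orthogonal complement.\<close>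

lemma sp_R: "sp (R x) (R y) = sp x y"
proof -
  have orth: "sp p q = 0" if "R p = p" "R q = - q" for p q
  proof -
    have "q \<in> Fix (\<lambda>x. - R x)" using that by (simp add: Fix_def)
    then show ?thesis using that(1) unfolding Fix_orth by (simp add: Fix_def)
  qed
  have "sp (x + R x) (y - R y) = 0" by (rule orth) (simp_all add: R_simps)
  moreover have "sp (y + R y) (x - R x) = 0" by (rule orth) (simp_all add: R_simps)
  ultimately show ?thesis
    by (simp add: sp_simps sp_sym[of y] sp_sym[of "R y"])
qed

lemma psi_phi: "j \<in> {1..2*n} \<Longrightarrow> k \<in> {1..2*n} \<Longrightarrow> sp (\<psi> j t) (\<phi> k t) = (if j = k then 1 else 0)"
  using dual unfolding dual_system_def by blast

lemma psi_coeff: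
  assumes J: "J \<subseteq> {1..2*n}" and j: "j \<in> {1..2*n}"
  shows "sp (\<psi> j t) (\<Sum>k\<in>J. c k *\<^sub>R \<phi> k t) = (if j \<in> J then c j else 0)"
proof -
  have fin: "finite J" using J finite_subset by blast
  have "sp (\<psi> j t) (\<Sum>k\<in>J. c k *\<^sub>R \<phi> k t) = (\<Sum>k\<in>J. c k * (if j = k then 1 else 0))"
    unfolding sp_sum_right using J j by (intro sum.cong) (auto simp: sp_simps psi_phi)
  also have "\<dots> = (if j \<in> J then c j else 0)" using fin by (simp add: if_distrib cong: if_cong)
  finally show ?thesis .
qed

lemma phi_inj: "inj_on (\<lambda>k. \<phi> k t) {1..2*n}"
proof (rule inj_onI)
  fix j k assume jk: "j \<in> {1..2*n}" "k \<in> {1..2*n}" "\<phi> j t = \<phi> k t"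
  then have "sp (\<psi> j t) (\<phi> j t) = sp (\<psi> j t) (\<phi> k t)" by simp
  then show "j = k" using jk(1,2) by (simp add: psi_phi split: if_splits)
qed

lemma phi_independent:
  assumes J: "J \<subseteq> {1..2*n}"
  shows "independent ((\<lambda>k. \<phi> k t) ` J)" and "card ((\<lambda>k. \<phi> k t) ` J) = card J"
proof -
  have inj: "inj_on (\<lambda>k. \<phi> k t) J" using phi_inj J inj_on_subset by blast
  then show "card ((\<lambda>k. \<phi> k t) ` J) = card J" by (rule card_image)
  have fin: "finite J" using J finite_subset by blast
  show "independent ((\<lambda>k. \<phi> k t) ` J)"
  proof (rule independent_if_scalars_zero)
    fix u x assume u: "(\<Sum>x\<in>(\<lambda>k. \<phi> k t) ` J. u x *\<^sub>R x) = 0" and x: "x \<in> (\<lambda>k. \<phi> k t) ` J"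
    obtain j where j: "j \<in> J" "x = \<phi> j t" using x by blast
    have "(\<Sum>k\<in>J. u (\<phi> k t) *\<^sub>R \<phi> k t) = 0" using u inj by (simp add: sum.reindex)
    then have "sp (\<psi> j t) (\<Sum>k\<in>J. u (\<phi> k t) *\<^sub>R \<phi> k t) = 0" by (simp add: sp_simps)
    then show "u x = 0" using psi_coeff[OF J, of j t "\<lambda>k. u (\<phi> k t)"] j J by auto
  qed (use fin in auto)
qed

lemma phi_expand: "y = (\<Sum>k\<in>{1..2*n}. sp (\<psi> k t) y *\<^sub>R \<phi> k t)"
proof -
  let ?S = "(\<lambda>k. \<phi> k t) ` {1..2*n}"
  have "UNIV \<subseteq> span ?S"
    using phi_independent[of "{1..2*n}" t] card by (intro card_ge_dim_independent) auto
  then have "y \<in> span ?S" by blast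
  also have "span ?S = range (\<lambda>u. \<Sum>v\<in>?S. u v *\<^sub>R v)" by (rule span_finite) simp
  finally obtain u where "y = (\<Sum>v\<in>?S. u v *\<^sub>R v)" by blast
  then have y: "y = (\<Sum>k\<in>{1..2*n}. u (\<phi> k t) *\<^sub>R \<phi> k t)" unfolding sum.reindex[OF phi_inj] o_def .
  have "sp (\<psi> k t) y = u (\<phi> k t)" if "k \<in> {1..2*n}" for k
    using psi_coeff[of "{1..2*n}" k t "\<lambda>k. u (\<phi> k t)"] that y by simp
  then have "(\<Sum>k\<in>{1..2*n}. sp (\<psi> k t) y *\<^sub>R \<phi> k t) = (\<Sum>k\<in>{1..2*n}. u (\<phi> k t) *\<^sub>R \<phi> k t)"
    by (intro sum.cong) auto
  then show ?thesis unfolding y[symmetric] by (rule sym)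
qed

lemma sp_phi_zero:
  assumes "\<And>k. k \<in> {1..2*n} \<Longrightarrow> sp z (\<phi> k t) = 0"
  shows "z = 0"
proof (rule ccontr)
  assume "z \<noteq> 0"
  have "sp z z = (\<Sum>k\<in>{1..2*n}. sp (\<psi> k t) z * sp z (\<phi> k t))"
    by (subst (2) phi_expand[of z t]) (simp add: sp_sum_right sp_simps)
  then show False using sp_pos[OF \<open>z \<noteq> 0\<close>] assms by simp
qed

lemma psi_expand: "y = (\<Sum>k\<in>{1..2*n}. sp y (\<phi> k t) *\<^sub>R \<psi> k t)"
proof -
  have "y - (\<Sum>k\<in>{1..2*n}. sp y (\<phi> k t) *\<^sub>R \<psi> k t) = 0"
  proof (rule sp_phi_zero)
    fix j assume j: "j \<in> {1..2*n}"
    have "sp (\<Sum>k\<in>{1..2*n}. sp y (\<phi> k t) *\<^sub>R \<psi> k t) (\<phi> j t) = (\<Sum>k\<in>{1..2*n}. sp y (\<phi> k t) * (if k = j then 1 else 0))"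
      unfolding bounded_bilinear.sum_left[OF sp_bb] using j by (intro sum.cong) (auto simp: sp_simps psi_phi)
    also have "\<dots> = sp y (\<phi> j t)" using j by (simp add: if_distrib cong: if_cong)
    finally show "sp (y - (\<Sum>k\<in>{1..2*n}. sp y (\<phi> k t) *\<^sub>R \<psi> k t)) (\<phi> j t) = 0" by (simp add: sp_simps)
  qed
  then show ?thesis by simp
qed

text \<open>The dual basis depends continuously on the basis. Expanding \<open>\<psi> j t - \<psi> j
  t0\<close> in the dual basis at time \<open>t\<close> bounds the total change \<open>D
  t\<close> by \<open>e t * (P + D t)\<close>, where \<open>e\<close> tends to \<open>0\<close>
  because the solutions \<open>\<phi> k\<close> are continuous.\<close>

lemma psi_cont:
  assumes j: "j \<in> {1..2*n}"
  shows "continuous_on S (\<psi> j)"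
proof (rule continuous_at_imp_continuous_on, rule ballI)
  fix t0
  let ?J = "{1..2*n}"
  obtain s where s: "s > 0" "\<And>x y. norm (sp x y) \<le> norm x * norm y * s"
    using bounded_bilinear.pos_bounded[OF sp_bb] by blast
  define D where "D t = (\<Sum>j\<in>?J. norm (\<psi> j t - \<psi> j t0))" for t
  define P where "P = (\<Sum>j\<in>?J. norm (\<psi> j t0))"
  define e where "e t = s * P * (\<Sum>k\<in>?J. norm (\<phi> k t0 - \<phi> k t))" for t
  have D_ge: "norm (\<psi> k t - \<psi> k t0) \<le> D t" if "k \<in> ?J" for k t
    unfolding D_def using that by (intro member_le_sum) auto
  have P_ge: "norm (\<psi> k t0) \<le> P" if "k \<in> ?J" for k
    unfolding P_def using that by (intro member_le_sum) auto
  have P0: "P \<ge> 0" unfolding P_def by (intro sum_nonneg) auto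
  have psi_le: "norm (\<psi> k t) \<le> P + D t" if "k \<in> ?J" for k t
    using D_ge[OF that, of t] P_ge[OF that] norm_triangle_sub[of "\<psi> k t" "\<psi> k t0"] by linarith
  have D_le: "D t \<le> e t * (P + D t)" for t
  proof -
    have "norm (\<psi> i t - \<psi> i t0) \<le> (\<Sum>k\<in>?J. norm (\<psi> i t0) * norm (\<phi> k t0 - \<phi> k t) * s * (P + D t))"
      if i: "i \<in> ?J" for i
    proof -
      have "\<psi> i t - \<psi> i t0 = (\<Sum>k\<in>?J. sp (\<psi> i t - \<psi> i t0) (\<phi> k t) *\<^sub>R \<psi> k t)"
        by (rule psi_expand)
      also have "\<dots> = (\<Sum>k\<in>?J. sp (\<psi> i t0) (\<phi> k t0 - \<phi> k t) *\<^sub>R \<psi> k t)"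
        using i by (intro sum.cong) (simp_all add: sp_simps psi_phi)
      also have "norm \<dots> \<le> (\<Sum>k\<in>?J. norm (sp (\<psi> i t0) (\<phi> k t0 - \<phi> k t)) * norm (\<psi> k t))"
        by (rule order_trans[OF norm_sum]) simp
      also have "\<dots> \<le> (\<Sum>k\<in>?J. norm (\<psi> i t0) * norm (\<phi> k t0 - \<phi> k t) * s * (P + D t))"
        using s psi_le by (intro sum_mono mult_mono) auto
      finally show ?thesis .
    qed
    then have "D t \<le> (\<Sum>i\<in>?J. \<Sum>k\<in>?J. norm (\<psi> i t0) * norm (\<phi> k t0 - \<phi> k t) * s * (P + D t))"
      unfolding D_def by (intro sum_mono)
    also have "\<dots> = e t * (P + D t)"
      unfolding e_def P_def by (simp add: sum_distrib_left sum_distrib_right mult_ac, rule sum.swap)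
    finally show ?thesis .
  qed
  have "(e \<longlongrightarrow> s * P * (\<Sum>k\<in>?J. norm (\<phi> k t0 - \<phi> k t0))) (at t0)"
    unfolding e_def[abs_def]
    by (intro tendsto_intros has_vector_derivative_continuous[OF phi_der, unfolded continuous_at]) auto
  then have e0: "(e \<longlongrightarrow> 0) (at t0)" by simp
  then have "\<forall>\<^sub>F t in at t0. e t < 1 / 2" by (rule order_tendstoD) simp
  then have "\<forall>\<^sub>F t in at t0. norm (\<psi> j t - \<psi> j t0) \<le> 2 * e t * P"
  proof eventually_elim
    case (elim t)
    have "0 \<le> D t" unfolding D_def by (intro sum_nonneg) auto
    then have "e t * D t \<le> 1 / 2 * D t" using elim by (intro mult_right_mono) auto
    then have "D t \<le> 2 * e t * P" using D_le[of t] by (simp add: algebra_simps)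
    then show ?case using D_ge[OF j, of t] by linarith
  qed
  moreover have "((\<lambda>t. 2 * e t * P) \<longlongrightarrow> 0) (at t0)" using e0 by (auto intro!: tendsto_eq_intros)
  ultimately have "((\<lambda>t. \<psi> j t - \<psi> j t0) \<longlongrightarrow> 0) (at t0)" by (rule Lim_null_comparison)
  then show "isCont (\<psi> j) t0" unfolding isCont_def using LIM_zero_iff by blast
qed

text \<open>Reversal permutes the solutions \<open>\<phi> k\<close> up to signs and sends \<open>\<phi>
  (n+2)\<close> to its negative; an orthogonal involution does the same to the dual system.\<close>

lemma psi_rev: "R (\<psi> (n+2) t) = - \<psi> (n+2) (- t)"
proof -
  let ?t = "- t"
  have "R (\<psi> (n+2) t) + \<psi> (n+2) ?t = 0"
  proof (rule sp_phi_zero)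
    fix k assume k: "k \<in> {1..2*n}"
    have "sp (R (\<psi> (n+2) t)) (\<phi> k ?t) = sp (\<psi> (n+2) t) (R (\<phi> k ?t))"
      using sp_R[of "\<psi> (n+2) t" "R (\<phi> k ?t)"] by (simp add: RR)
    also have "\<dots> = (if n + 2 = k then - 1 else 0)"
    proof -
      consider "k = 1" | "k = 2" | "k \<in> {3..n}" | "k = n + 1" | "k = n + 2" | j where "k = n + j" "j \<in> {3..n}"
      proof (cases "k \<le> n + 2")
        case True
        then have "k = 1 \<or> k = 2 \<or> k \<in> {3..n} \<or> k = n + 1 \<or> k = n + 2"
          using k unfolding atLeastAtMost_iff by arith
        then show ?thesis using that(1-5) by blast
      next
        case False
        then have "k = n + (k - n)" "k - n \<in> {3..n}" using k by auto
        then show ?thesis by (rule that(6))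
      qed
      then show ?thesis
      proof cases
        case 1 then show ?thesis using n2 phi1_rev[of ?t] psi_phi[of "n+2" 1 t] by (simp add: sp_simps)
      next
        case 2 then show ?thesis using n2 phi2_rev[of ?t] psi_phi[of "n+2" 2 t] by (simp add: sp_simps)
      next
        case 3 then show ?thesis using n2 phij_rev[of k ?t] psi_phi[of "n+2" "n+k" t] by (simp add: sp_simps)
      next
        case 4 then show ?thesis using n2 phin1_rev[of ?t] psi_phi[of "n+2" "n+1" t] by (simp add: sp_simps)
      next
        case 5 then show ?thesis using n2 phin2_rev[of ?t] psi_phi[of "n+2" "n+2" t] by (simp add: sp_simps)
      next
        case (6 j) then show ?thesis using n2 phinj_rev[of j ?t] psi_phi[of "n+2" j t] by (simp add: sp_simps)
      qed
    qed
    finally show "sp (R (\<psi> (n+2) t) + \<psi> (n+2) ?t) (\<phi> k ?t) = 0"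
      using n2 k psi_phi[of "n+2" k ?t] by (simp add: sp_simps)
  qed
  then show ?thesis by (simp add: eq_neg_iff_add_eq_0)
qed

end

section \<open>Exponential dichotomy of the variational equation on the half line\<close>

text \<open>A Lyapunov form of the linearisation at the origin that changes sign under \<open>R\<close>.
  Within the radius \<open>\<delta>\<close> its inequalities hold for the vector field at all
  small parameters and for the linearisation at every point.\<close>

locale homoclinic_lyapunov = homoclinic_setting f R sp n xh \<phi> \<psi> + lyapunov B c h L
  for f :: "real^'m \<Rightarrow> real \<Rightarrow> real^'m"
    and R :: "real^'m \<Rightarrow> real^'m"
    and sp :: "real^'m \<Rightarrow> real^'m \<Rightarrow> real"
    and n :: nat
    and xh :: "real \<Rightarrow> real^'m"
    and \<phi> \<psi> :: "nat \<Rightarrow> real \<Rightarrow> real^'m"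
    and B :: "real^'m \<Rightarrow> real^'m \<Rightarrow> real" and c h L :: real +
  fixes \<delta> :: real
  assumes B_R: "B (R x) (R y) = - B x y"
    and \<delta>: "\<delta> > 0"
    and near_vf: "norm x \<le> \<delta> \<Longrightarrow> \<bar>\<mu>\<bar> \<le> \<delta> \<Longrightarrow> norm (f x \<mu>) \<le> L * norm x \<and> c * (norm x)\<^sup>2 \<le> B x (f x \<mu>)"
    and near_lin: "norm x \<le> \<delta> \<Longrightarrow> norm (Dx f x 0 y) \<le> L * norm y \<and> c * (norm y)\<^sup>2 \<le> B y (Dx f x 0 y)"

context homoclinic_setting
begin

lemma hyperbolic:
  assumes "det (mat z - map_matrix complex_of_real (matrix (Dx f 0 0))) = 0"
  shows "Re z \<noteq> 0"
proof -
  obtain l :: "nat \<Rightarrow> complex" where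
    det: "\<And>z. det (mat z - map_matrix complex_of_real (matrix (Dx f 0 0))) = (\<Prod>j=1..n. (z - l j) * (z + l j))"
    and l1: "0 < Re (l 1)" and mono: "mono_on {1..n} (\<lambda>j. Re (l j))"
    using R3 unfolding R3_def by blast
  have "(\<Prod>j=1..n. (z - l j) * (z + l j)) = 0" using assms det by simp
  then obtain j where j: "j \<in> {1..n}" "(z - l j) * (z + l j) = 0" by (meson finite_atLeastAtMost prod_zero_iff)
  have "Re (l 1) \<le> Re (l j)" using mono j(1) by (auto simp: mono_on_def)
  moreover have "z = l j \<or> z = - l j" using j(2) by (auto simp: add_eq_0_iff2)
  ultimately show ?thesis using l1 by auto
qed

lemma f0: "f 0 \<mu> = 0"
  using R2 by (simp add: R2_def)

lemma Dx0_R: "Dx f 0 0 (R x) = - R (Dx f 0 0 x)"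
  using Dx_R[of 0 0 x] by (simp add: R_simps)

text \<open>Near the origin, \<open>f x \<mu>\<close> and \<open>Dx f x 0 y\<close> differ from the
  linearisation at the origin by at most \<open>\<eta>\<close> times the norm of the argument,
  which costs at most half of the constant \<open>c0\<close>.\<close>

lemma lyapunov_exists: "\<exists>B c h L \<delta>. homoclinic_lyapunov f R sp n xh \<phi> \<psi> B c h L \<delta>"
proof -
  let ?A = "Dx f 0 0"
  obtain B c0 where B: "bilinear B" "\<And>x y. B x y = B y x" "\<And>x y. B (R x) (R y) = - B x y"
    and c0: "c0 > (0::real)" "\<And>x. c0 * (norm x)\<^sup>2 \<le> B x (?A x)"
    using lyapunov_form_exists[OF lin_Dx hyperbolic linR RR Dx0_R] by blast
  have bb: "bounded_bilinear B" using B(1) by (simp add: bilinear_conv_bounded_bilinear)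
  obtain h where h: "h > 0" "\<And>x y. norm (B x y) \<le> norm x * norm y * h"
    using bounded_bilinear.pos_bounded[OF bb] by blast
  obtain C0 where C0: "C0 > 0" "\<And>t u. norm (?A u) \<le> C0 * norm u"
  proof -
    have "bounded_linear ?A" using lin_Dx by (rule linear_conv_bounded_linear[THEN iffD1])
    from bounded_linear.pos_bounded[OF this] show ?thesis using that by (metis mult.commute)
  qed
  obtain C1 where C1: "C1 \<ge> 0" "\<And>z w u. z \<in> cball 0 2 \<Longrightarrow> w \<in> cball 0 2 \<Longrightarrow>
      norm (DF z u - DF w u) \<le> C1 * norm (z - w) * norm u"
    using analytic_derivative_lipschitz[OF analytic, of 2] by blast
  \<comment> \<open>\<open>C1\<close> may be \<open>0\<close>, hence the denominator \<open>C1 + 1\<close>\<close>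
  define \<delta> where "\<delta> = min 1 (c0 / (4 * h * (C1 + 1)))"
  have \<delta>: "\<delta> > 0" "\<delta> \<le> 1" using c0 h C1 by (auto simp: \<delta>_def)
  define \<eta> where "\<eta> = 2 * C1 * \<delta>"
  have \<eta>: "0 \<le> \<eta>" "\<eta> \<le> 2 * C1" "h * \<eta> \<le> c0 / 2"
  proof -
    show "0 \<le> \<eta>" "\<eta> \<le> 2 * C1" using \<delta> C1 by (simp_all add: \<eta>_def mult_left_le)
    have eq: "h * (2 * C1 * (c0 / (4 * h * D))) = c0 / 2 * (C1 / D)" for D
      using h(1) by (cases "D = 0") (simp_all add: field_simps)
    have "h * \<eta> \<le> h * (2 * C1 * (c0 / (4 * h * (C1 + 1))))"
      unfolding \<eta>_def \<delta>_def using h C1 by (intro mult_left_mono) auto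
    also have "\<dots> = c0 / 2 * (C1 / (C1 + 1))" by (rule eq)
    also have "\<dots> \<le> c0 / 2 * 1" using c0 C1 by (intro mult_left_mono) auto
    finally show "h * \<eta> \<le> c0 / 2" by simp
  qed
  have dA: "norm (Dx f x \<mu> u - ?A u) \<le> \<eta> * norm u" if "norm x \<le> \<delta>" "\<bar>\<mu>\<bar> \<le> \<delta>" for x \<mu> u
  proof -
    have n: "norm (x, \<mu>) \<le> 2 * \<delta>" using norm_Pair_le[of x \<mu>] that by simp
    have "norm (Dx f x \<mu> u - ?A u) \<le> C1 * norm ((x, \<mu>) - (0, 0)) * norm (u, 0::real)"
      unfolding Dx_eq using n \<delta> by (intro C1) (simp_all add: mem_cball_0 del: mem_cball)
    also have "\<dots> = C1 * norm (x, \<mu>) * norm u" by (simp add: norm_Pair)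
    also have "\<dots> \<le> C1 * (2 * \<delta>) * norm u" using n C1 by (intro mult_right_mono mult_left_mono) auto
    finally show ?thesis by (simp add: \<eta>_def)
  qed
  have key: "norm v \<le> (C0 + 2 * C1) * norm x \<and> c0 / 2 * (norm x)\<^sup>2 \<le> B x v"
    if v: "norm (v - ?A x) \<le> \<eta> * norm x" for v x
  proof
    have "norm v \<le> norm (?A x) + norm (v - ?A x)" by (metis add.commute diff_add_cancel norm_triangle_ineq)
    also have "\<dots> \<le> C0 * norm x + \<eta> * norm x" using C0(2) v by (intro add_mono) auto
    also have "\<dots> \<le> C0 * norm x + 2 * C1 * norm x" using \<eta> by (intro add_left_mono mult_right_mono) auto
    finally show "norm v \<le> (C0 + 2 * C1) * norm x" by (simp add: distrib_right)
    have "B x v = B x (?A x) + B x (v - ?A x)" by (simp add: bilinear_rsub[OF B(1)])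
    moreover have "\<bar>B x (v - ?A x)\<bar> \<le> c0 / 2 * (norm x)\<^sup>2"
    proof -
      have "\<bar>B x (v - ?A x)\<bar> \<le> norm x * norm (v - ?A x) * h" using h(2)[of x "v - ?A x"] by simp
      also have "\<dots> \<le> norm x * (\<eta> * norm x) * h" using v h by (intro mult_right_mono mult_left_mono) auto
      also have "\<dots> = (h * \<eta>) * (norm x)\<^sup>2" by (simp add: power2_eq_square mult_ac)
      also have "\<dots> \<le> c0 / 2 * (norm x)\<^sup>2" using \<eta> by (intro mult_right_mono) auto
      finally show ?thesis .
    qed
    ultimately show "c0 / 2 * (norm x)\<^sup>2 \<le> B x v" using c0(2)[of x] by linarith
  qed
  have "homoclinic_lyapunov f R sp n xh \<phi> \<psi> B (c0 / 2) h (C0 + 2 * C1) \<delta>"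
  proof (intro homoclinic_lyapunov.intro lyapunov.intro homoclinic_lyapunov_axioms.intro)
    show "homoclinic_setting f R sp n xh \<phi> \<psi>" by (rule homoclinic_setting_axioms)
    show "bounded_bilinear B" by (rule bb)
    show "B x y = B y x" for x y by (rule B)
    show "0 < c0 / 2" "0 < C0 + 2 * C1" "0 < h" "0 < \<delta>" using c0 C0 C1 h \<delta> by auto
    show "\<bar>B x x\<bar> \<le> h * (norm x)\<^sup>2" for x using h(2)[of x x] by (simp add: power2_eq_square mult_ac)
    show "B (R x) (R y) = - B x y" for x y by (rule B)
    show "norm (Dx f x 0 y) \<le> (C0 + 2 * C1) * norm y \<and> c0 / 2 * (norm y)\<^sup>2 \<le> B y (Dx f x 0 y)"
      if "norm x \<le> \<delta>" for x y
      using dA[OF that, of 0 y] \<delta> by (intro key) simp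
    show "norm (f x \<mu>) \<le> (C0 + 2 * C1) * norm x \<and> c0 / 2 * (norm x)\<^sup>2 \<le> B x (f x \<mu>)"
      if x: "norm x \<le> \<delta>" and \<mu>: "\<bar>\<mu>\<bar> \<le> \<delta>" for x \<mu>
    proof (rule key)
      have linA: "linear ?A" by (rule lin_Dx)
      have "norm ((f x \<mu> - ?A x) - (f 0 \<mu> - ?A 0)) \<le> \<eta> * norm (x - 0)"
      proof (rule differentiable_bound[where S = "cball 0 \<delta>" and f' = "\<lambda>y u. Dx f y \<mu> u - ?A u"])
        show "((\<lambda>x. f x \<mu> - ?A x) has_derivative (\<lambda>u. Dx f y \<mu> u - ?A u)) (at y within cball 0 \<delta>)" for y
          by (intro has_derivative_diff has_derivative_at_withinI[OF f_der'] linear_imp_has_derivative linA)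
        show "onorm (\<lambda>u. Dx f y \<mu> u - ?A u) \<le> \<eta>" if "y \<in> cball 0 \<delta>" for y
          using dA[OF _ \<mu>] that by (intro onorm_le) (simp add: mem_cball_0 del: mem_cball)
      qed (use x \<delta> in auto)
      then show "norm (f x \<mu> - ?A x) \<le> \<eta> * norm x" by (simp add: f0 linear_0[OF linA])
    qed
  qed
  then show ?thesis by blast
qed

text \<open>The transition operator of the variational equation from time \<open>s\<close> to time
  \<open>t\<close>, composed with the projection onto the span of the solutions \<open>\<phi>
  k\<close> with \<open>k \<in> I\<close>.\<close>

definition "evol I t s y = (\<Sum>k\<in>I. sp (\<psi> k s) y *\<^sub>R \<phi> k t)"

lemma evol_VE: "I \<subseteq> {1..2*n} \<Longrightarrow> VE_solution f xh (\<lambda>t. evol I t s y)"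
  unfolding evol_def by (intro VE_lincomb phi_VE) blast

lemma evol_comp: "I \<subseteq> {1..2*n} \<Longrightarrow> evol I t r (evol I r s y) = evol I t s y"
  unfolding evol_def
proof (intro sum.cong refl arg_cong2[of _ _ _ _ scaleR])
  fix k assume "I \<subseteq> {1..2*n}" "k \<in> I"
  then show "sp (\<psi> k r) (\<Sum>k\<in>I. sp (\<psi> k s) y *\<^sub>R \<phi> k r) = sp (\<psi> k s) y"
    using psi_coeff[of I k r "\<lambda>k. sp (\<psi> k s) y"] by (simp add: subset_iff)
qed

lemma evol_split: "evol {1..n} t t y + evol {n+1..2*n} t t y = y"
proof -
  have "{1..n} \<union> {n+1..2*n} = {1..2*n}" using n2 by auto
  then have "evol {1..n} t t y + evol {n+1..2*n} t t y = (\<Sum>k\<in>{1..2*n}. sp (\<psi> k t) y *\<^sub>R \<phi> k t)"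
    unfolding evol_def by (subst sum.union_disjoint[symmetric]) auto
  then show ?thesis using phi_expand[of y t] by simp
qed

lemma linear_evol: "linear (evol I t s)"
  unfolding evol_def
  by (rule linearI) (simp_all add: sp_simps scaleR_left_distrib sum.distrib scaleR_sum_right)

lemma evol_bound:
  "\<exists>M\<ge>0. \<forall>I s t y. I \<subseteq> {1..2*n} \<longrightarrow> s \<in> {0..T} \<longrightarrow> t \<in> {0..T} \<longrightarrow> norm (evol I t s y) \<le> M * norm y"
proof -
  obtain C where C: "C > 0" "\<And>x y. norm (sp x y) \<le> norm x * norm y * C"
    using bounded_bilinear.pos_bounded[OF sp_bb] by blast
  have bd: "\<exists>M. \<forall>t\<in>{0..T}. norm (x t) \<le> M" if "continuous_on {0..T} x" for x :: "real \<Rightarrow> real^'m"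
  proof -
    have "compact (x ` {0..T})" using that by (intro compact_continuous_image) auto
    from compact_imp_bounded[OF this] show ?thesis unfolding bounded_iff by simp
  qed
  have "\<forall>k\<in>{1..2*n}. \<exists>M. \<forall>t\<in>{0..T}. norm (\<phi> k t) \<le> M" using bd[OF phi_cont] by blast
  then obtain P where P: "\<And>k t. k \<in> {1..2*n} \<Longrightarrow> t \<in> {0..T} \<Longrightarrow> norm (\<phi> k t) \<le> P k" by metis
  have "\<forall>k\<in>{1..2*n}. \<exists>M. \<forall>t\<in>{0..T}. norm (\<psi> k t) \<le> M" using bd[OF psi_cont] by blast
  then obtain Q where Q: "\<And>k t. k \<in> {1..2*n} \<Longrightarrow> t \<in> {0..T} \<Longrightarrow> norm (\<psi> k t) \<le> Q k" by metis
  define M where "M = (\<Sum>k\<in>{1..2*n}. \<bar>Q k\<bar> * C * \<bar>P k\<bar>)"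
  have "norm (evol I t s y) \<le> M * norm y" if I: "I \<subseteq> {1..2*n}" and s: "s \<in> {0..T}" and t: "t \<in> {0..T}" for I s t y
  proof -
    have "norm (evol I t s y) \<le> (\<Sum>k\<in>I. norm (sp (\<psi> k s) y *\<^sub>R \<phi> k t))" unfolding evol_def by (rule norm_sum)
    also have "\<dots> \<le> (\<Sum>k\<in>I. (\<bar>Q k\<bar> * C * \<bar>P k\<bar>) * norm y)"
    proof (rule sum_mono)
      fix k assume k: "k \<in> I"
      then have k': "k \<in> {1..2*n}" using I by blast
      have "norm (sp (\<psi> k s) y) \<le> norm (\<psi> k s) * norm y * C" by (rule C)
      also have "\<dots> \<le> \<bar>Q k\<bar> * norm y * C" using Q[OF k' s] C by (intro mult_right_mono) auto
      finally have 1: "norm (sp (\<psi> k s) y) \<le> \<bar>Q k\<bar> * norm y * C" .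
      have 2: "norm (\<phi> k t) \<le> \<bar>P k\<bar>" using P[OF k' t] by linarith
      have "norm (sp (\<psi> k s) y *\<^sub>R \<phi> k t) \<le> (\<bar>Q k\<bar> * norm y * C) * \<bar>P k\<bar>"
        unfolding norm_scaleR using 1 2 C by (intro mult_mono) (auto simp: real_norm_def)
      then show "norm (sp (\<psi> k s) y *\<^sub>R \<phi> k t) \<le> (\<bar>Q k\<bar> * C * \<bar>P k\<bar>) * norm y" by (simp add: mult_ac)
    qed
    also have "\<dots> = (\<Sum>k\<in>I. \<bar>Q k\<bar> * C * \<bar>P k\<bar>) * norm y" by (rule sum_distrib_right[symmetric])
    also have "\<dots> \<le> M * norm y"
      unfolding M_def using I C by (intro mult_right_mono sum_mono2) auto
    finally show ?thesis .
  qed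
  moreover have "M \<ge> 0" unfolding M_def using C by (intro sum_nonneg) auto
  ultimately show ?thesis by blast
qed

lemma phi_stable_bounded:
  assumes k: "k \<in> {1..n}"
  shows "\<exists>M. \<forall>t\<ge>T. norm (\<phi> k t) \<le> M"
proof -
  consider "k \<in> {1, 2}" | "k \<in> {3..n}" using k by fastforce
  then show ?thesis
  proof cases
    case 1
    then have "bounded (range (\<phi> k))" using R5 unfolding R5_def by blast
    then show ?thesis unfolding bounded_iff by auto
  next
    case 2
    then have "((\<lambda>t. norm (\<phi> k t)) \<longlongrightarrow> 0) at_top" using fund unfolding VE_fundamental_system_def by blast
    moreover have "continuous_on {T..} (\<phi> k)" using k by (intro phi_cont) auto
    ultimately show ?thesis using bounded_half_line by blast
  qed
qed

lemma sum_stable_bounded: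
  "\<exists>M. \<forall>t\<ge>T. norm (\<Sum>k\<in>{1..n}. u k *\<^sub>R \<phi> k t) \<le> M"
proof -
  have "\<forall>k\<in>{1..n}. \<exists>M. \<forall>t\<ge>T. norm (\<phi> k t) \<le> M" using phi_stable_bounded by blast
  then obtain P where P: "\<And>k t. k \<in> {1..n} \<Longrightarrow> t \<ge> T \<Longrightarrow> norm (\<phi> k t) \<le> P k" by metis
  have "norm (\<Sum>k\<in>{1..n}. u k *\<^sub>R \<phi> k t) \<le> (\<Sum>k\<in>{1..n}. \<bar>u k\<bar> * P k)" if "t \<ge> T" for t
    using P that by (intro order_trans[OF norm_sum] sum_mono) (auto intro!: mult_left_mono)
  then show ?thesis by blast
qed

end

context homoclinic_lyapunov
begin

lemma xh_small_ex: "\<exists>T\<ge>0. \<forall>t\<ge>T. norm (xh t) \<le> \<delta> / 2"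
proof -
  have "\<forall>\<^sub>F t in at_top. norm (xh t) < \<delta> / 2"
    using tendsto_norm[OF xh_top] \<delta> by (intro order_tendstoD) auto
  then obtain N where "\<And>t. t \<ge> N \<Longrightarrow> norm (xh t) < \<delta> / 2" by (auto simp: eventually_at_top_linorder)
  then show ?thesis by (intro exI[of _ "max 0 N"]) (auto intro: less_imp_le)
qed

definition "tail_time = (SOME T. T \<ge> 0 \<and> (\<forall>t\<ge>T. norm (xh t) \<le> \<delta> / 2))"

lemma tail_time: "tail_time \<ge> 0" and xh_small: "t \<ge> tail_time \<Longrightarrow> norm (xh t) \<le> \<delta> / 2"
  using someI_ex[OF xh_small_ex] unfolding tail_time_def by blast+

lemma VE_lyap_curve:
  assumes "VE_solution f xh \<xi>"
  shows "lyap_curve tail_time \<xi> (\<lambda>t. Dx f (xh t) 0 (\<xi> t))"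
  unfolding lyap_curve_def
proof (intro allI impI conjI)
  fix t assume t: "t \<ge> tail_time"
  show "(\<xi> has_vector_derivative Dx f (xh t) 0 (\<xi> t)) (at t within {tail_time..})"
    using assms unfolding VE_solution_def using has_vector_derivative_at_within by blast
  have "norm (xh t) \<le> \<delta>" using xh_small[OF t] \<delta> by simp
  then show "norm (Dx f (xh t) 0 (\<xi> t)) \<le> L * norm (\<xi> t)" "c * (norm (\<xi> t))\<^sup>2 \<le> B (\<xi> t) (Dx f (xh t) 0 (\<xi> t))"
    using near_lin by blast+
qed

definition "bounded_data = {y. \<exists>\<eta>. VE_solution f xh \<eta> \<and> \<eta> tail_time = y \<and> (\<exists>M. \<forall>t\<ge>tail_time. norm (\<eta> t) \<le> M)}"

lemma bounded_data_neg: "y \<in> bounded_data \<Longrightarrow> B y y + \<kappa> * (norm y)\<^sup>2 \<le> 0"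
  unfolding bounded_data_def using bounded_imp_form_neg[OF VE_lyap_curve] by blast

lemma subspace_bounded_data: "subspace bounded_data"
proof (rule subspaceI)
  have "VE_solution f xh (\<lambda>t. 0)"
    using VE_lincomb[of "{}" "\<lambda>k t. 0" "\<lambda>k. 0"] by simp
  then show "0 \<in> bounded_data" unfolding bounded_data_def
    by (intro CollectI exI[of _ "\<lambda>t. 0"]) auto
next
  fix x y assume "x \<in> bounded_data" "y \<in> bounded_data"
  then obtain \<xi> \<eta> M N where x: "VE_solution f xh \<xi>" "\<xi> tail_time = x" "\<And>t. t \<ge> tail_time \<Longrightarrow> norm (\<xi> t) \<le> M"
    and y: "VE_solution f xh \<eta>" "\<eta> tail_time = y" "\<And>t. t \<ge> tail_time \<Longrightarrow> norm (\<eta> t) \<le> N"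
    unfolding bounded_data_def by blast
  have "VE_solution f xh (\<lambda>t. \<xi> t + \<eta> t)"
    using x(1) y(1) unfolding VE_solution_def
    by (auto simp: linear_add[OF lin_Dx] intro!: has_vector_derivative_add)
  moreover have "norm (\<xi> t + \<eta> t) \<le> M + N" if "t \<ge> tail_time" for t
    using x(3)[OF that] y(3)[OF that] norm_triangle_ineq[of "\<xi> t" "\<eta> t"] by linarith
  ultimately show "x + y \<in> bounded_data" unfolding bounded_data_def using x(2) y(2)
    by (intro CollectI exI[of _ "\<lambda>t. \<xi> t + \<eta> t"]) auto
next
  fix a x assume "x \<in> bounded_data"
  then obtain \<xi> M where x: "VE_solution f xh \<xi>" "\<xi> tail_time = x" "\<And>t. t \<ge> tail_time \<Longrightarrow> norm (\<xi> t) \<le> M"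
    unfolding bounded_data_def by blast
  have "VE_solution f xh (\<lambda>t. \<Sum>b\<in>{()}. a *\<^sub>R \<xi> t)" by (rule VE_lincomb) (rule x)
  then have "VE_solution f xh (\<lambda>t. a *\<^sub>R \<xi> t)" by simp
  moreover have "norm (a *\<^sub>R \<xi> t) \<le> \<bar>a\<bar> * M" if "t \<ge> tail_time" for t
    using x(3)[OF that] by (simp add: mult_left_mono)
  ultimately show "a *\<^sub>R x \<in> bounded_data" unfolding bounded_data_def using x(2)
    by (intro CollectI exI[of _ "\<lambda>t. a *\<^sub>R \<xi> t"]) auto
qed

text \<open>The form is negative on this space and positive on its image under \<open>R\<close>. Hence the
  two spaces, which have the same dimension, meet only in \<open>0\<close>, and together they
  fit into a space of dimension \<open>2 * n\<close>.\<close>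

lemma dim_bounded_data_le: "dim bounded_data \<le> n"
proof -
  have sR: "subspace (R ` bounded_data)" by (rule linear_subspace_image[OF linR subspace_bounded_data])
  have "bounded_data \<inter> R ` bounded_data \<subseteq> {0}"
  proof
    fix y assume "y \<in> bounded_data \<inter> R ` bounded_data"
    then obtain z where y: "y \<in> bounded_data" "y = R z" "z \<in> bounded_data" by blast
    have "B y y + \<kappa> * (norm y)\<^sup>2 \<le> 0" "B z z + \<kappa> * (norm z)\<^sup>2 \<le> 0" using bounded_data_neg y by blast+
    moreover have "B y y = - B z z" unfolding y(2) by (rule B_R)
    moreover have "\<kappa> * (norm z)\<^sup>2 \<ge> 0" using \<kappa> by simp
    ultimately have "\<kappa> * (norm y)\<^sup>2 \<le> 0" by linarith
    then show "y \<in> {0}" using \<kappa> by (simp add: mult_le_0_iff)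
  qed
  then have "bounded_data \<inter> R ` bounded_data = {0}"
    using subspace_0[OF subspace_bounded_data] subspace_0[OF sR] by blast
  then have "dim {x + y |x y. x \<in> bounded_data \<and> y \<in> R ` bounded_data} = dim bounded_data + dim (R ` bounded_data)"
    using dim_sums_Int[OF subspace_bounded_data sR] by simp
  moreover have "dim (R ` bounded_data) = dim bounded_data"
  proof (rule dim_image_eq[OF linR])
    show "inj_on R (span bounded_data)" by (metis RR inj_on_def)
  qed
  moreover have "dim {x + y |x y. x \<in> bounded_data \<and> y \<in> R ` bounded_data} \<le> 2 * n"
    using dim_subset_UNIV[of "{x + y |x y. x \<in> bounded_data \<and> y \<in> R ` bounded_data}"] card by simp
  ultimately show ?thesis by simp
qed

text \<open>The solutions \<open>\<phi> 1, \<dots>, \<phi> n\<close> already exhaust the dimension that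
  bounded solutions can have.\<close>

lemma unstable_unbounded:
  assumes nz: "evol {n+1..2*n} tail_time tail_time y \<noteq> 0"
  shows "\<exists>t\<ge>tail_time. norm (evol {n+1..2*n} t tail_time y) > M"
proof (rule ccontr)
  let ?\<xi> = "\<lambda>t. evol {n+1..2*n} t tail_time y"
  let ?V = "(\<lambda>k. \<phi> k tail_time) ` {1..n}"
  assume "\<not> ?thesis"
  then have bd: "\<exists>M. \<forall>t\<ge>tail_time. norm (?\<xi> t) \<le> M" by (meson not_le)
  have I: "{n+1..2*n} \<subseteq> {1..2*n}" "{1..n} \<subseteq> {1..2*n}" by auto
  have ve: "VE_solution f xh ?\<xi>" by (rule evol_VE[OF I(1)])
  have 1: "?\<xi> tail_time \<in> bounded_data" unfolding bounded_data_def using bd ve by blast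
  have 2: "?V \<subseteq> bounded_data"
  proof
    fix v assume "v \<in> ?V"
    then obtain k where k: "k \<in> {1..n}" "v = \<phi> k tail_time" by blast
    then have "VE_solution f xh (\<phi> k)" by (intro phi_VE) auto
    then show "v \<in> bounded_data" unfolding bounded_data_def using phi_stable_bounded[OF k(1), of tail_time] k(2) by blast
  qed
  have notin: "?\<xi> tail_time \<notin> span ?V"
  proof
    assume "?\<xi> tail_time \<in> span ?V"
    also have "span ?V = range (\<lambda>u. \<Sum>v\<in>?V. u v *\<^sub>R v)" by (rule span_finite) simp
    finally obtain u where u: "?\<xi> tail_time = (\<Sum>v\<in>?V. u v *\<^sub>R v)" by blast
    have inj: "inj_on (\<lambda>k. \<phi> k tail_time) {1..n}" using phi_inj I(2) inj_on_subset by blast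
    have u': "?\<xi> tail_time = (\<Sum>k\<in>{1..n}. u (\<phi> k tail_time) *\<^sub>R \<phi> k tail_time)" unfolding u sum.reindex[OF inj] o_def ..
    have "sp (\<psi> j tail_time) y = 0" if j: "j \<in> {n+1..2*n}" for j
    proof -
      have j': "j \<in> {1..2*n}" "j \<notin> {1..n}" using j by auto
      have "sp (\<psi> j tail_time) (?\<xi> tail_time) = sp (\<psi> j tail_time) y"
        unfolding evol_def using psi_coeff[OF I(1) j'(1), of tail_time "\<lambda>k. sp (\<psi> k tail_time) y"]
        unfolding if_P[OF j] .
      moreover have "sp (\<psi> j tail_time) (?\<xi> tail_time) = 0"
        unfolding u' using psi_coeff[OF I(2) j'(1), of tail_time "\<lambda>k. u (\<phi> k tail_time)"]
        unfolding if_not_P[OF j'(2)] .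
      ultimately show ?thesis by simp
    qed
    then have "?\<xi> tail_time = 0" unfolding evol_def by (intro sum.neutral) auto
    then show False using nz by simp
  qed
  have ind: "independent (insert (?\<xi> tail_time) ?V)"
    by (rule independent_insertI[OF notin phi_independent(1)[OF I(2)]])
  have "card (insert (?\<xi> tail_time) ?V) = Suc n"
    using notin span_base[of "?\<xi> tail_time" ?V] phi_independent(2)[OF I(2), of tail_time] by (subst card_insert_disjoint) auto
  moreover have "card (insert (?\<xi> tail_time) ?V) \<le> dim bounded_data"
    using 1 2 by (intro independent_card_le_dim[OF _ ind]) auto
  ultimately show False using dim_bounded_data_le by simp
qed

text \<open>Each unstable solution enters the region where the form is positive and stays there. By
  compactness of the unit sphere one time serves all of them.\<close>

lemma unstable_eventually_pos_ex:
  "\<exists>T\<ge>tail_time. \<forall>y. evol {n+1..2*n} tail_time tail_time y = y \<longrightarrow>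
     \<kappa> / 2 * (norm (evol {n+1..2*n} T tail_time y))\<^sup>2 \<le> B (evol {n+1..2*n} T tail_time y) (evol {n+1..2*n} T tail_time y)"
proof -
  let ?e = "\<lambda>t y. evol {n+1..2*n} t tail_time y"
  define Q where "Q t y = B (?e t y) (?e t y) - \<kappa> / 2 * (norm (?e t y))\<^sup>2" for t y
  define S where "S = {y. ?e tail_time y = y} \<inter> sphere 0 1"
  have I: "{n+1..2*n} \<subseteq> {1..2*n}" by auto
  have ce: "continuous_on UNIV (?e t)" for t
    by (rule linear_continuous_on) (rule linear_conv_bounded_linear[THEN iffD1, OF linear_evol])
  have cQ: "continuous_on UNIV (Q t)" for t
    unfolding Q_def by (intro continuous_intros bounded_bilinear.continuous_on[OF bil] ce)
  have "closed {y. ?e tail_time y = y}" by (intro closed_Collect_eq ce continuous_on_id)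
  then have cS: "compact S" unfolding S_def by (intro closed_Int_compact) auto
  have lc: "lyap_curve tail_time (\<lambda>t. ?e t y) (\<lambda>t. Dx f (xh t) 0 (?e t y))" for y
    by (rule VE_lyap_curve[OF evol_VE[OF I]])
  have mono: "Q t y > 0" if "Q s y > 0" "tail_time \<le> s" "s \<le> t" for s t y
    using form_pos_persists[OF lc _ that(2,3)] that(1) unfolding Q_def by simp
  have cover: "S \<subseteq> (\<Union>i\<in>(UNIV::nat set). {y. Q (tail_time + real i) y > 0})"
  proof
    fix y assume y: "y \<in> S"
    then have "y \<noteq> 0" "?e tail_time y = y" by (auto simp: S_def)
    then have "\<exists>t\<ge>tail_time. norm (?e t y) > M" for M using unstable_unbounded[of y M] by simp
    from unbounded_imp_form_pos[OF lc this] obtain t where t: "t \<ge> tail_time" "Q t y > 0" unfolding Q_def by auto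
    obtain i :: nat where "t - tail_time \<le> real i" using real_arch_simple by blast
    then have "Q (tail_time + real i) y > 0" by (intro mono[OF t(2,1)]) simp
    then show "y \<in> (\<Union>i\<in>(UNIV::nat set). {y. Q (tail_time + real i) y > 0})" by blast
  qed
  have op: "open {y. Q (tail_time + real i) y > 0}" for i
    by (intro open_Collect_less cQ continuous_on_const)
  obtain J where J: "finite J" "S \<subseteq> (\<Union>i\<in>J. {y. Q (tail_time + real i) y > 0})"
    by (rule compactE_image[OF cS op cover])
  define N where "N = Max (insert 0 J)"
  have N: "Q (tail_time + real N) y > 0" if "y \<in> S" for y
  proof -
    obtain i where i: "i \<in> J" "Q (tail_time + real i) y > 0" using J(2) \<open>y \<in> S\<close> by blast
    have "i \<le> N" unfolding N_def using i J(1) by (intro Max_ge) auto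
    then show ?thesis by (intro mono[OF i(2)]) simp_all
  qed
  have "0 \<le> Q (tail_time + real N) y" if y: "?e tail_time y = y" for y
  proof (cases "y = 0")
    case True
    then show ?thesis unfolding Q_def
      by (simp add: linear_0[OF linear_evol] bounded_bilinear.zero_left[OF bil])
  next
    case False
    define z where "z = (1 / norm y) *\<^sub>R y"
    have "?e tail_time z = z" by (simp only: z_def linear_scale[OF linear_evol] y)
    moreover have "norm z = 1" using False by (simp add: z_def)
    ultimately have zpos: "Q (tail_time + real N) z > 0" by (intro N) (simp add: S_def)
    have yz: "y = norm y *\<^sub>R z" using False by (simp add: z_def)
    have hom: "Q t (a *\<^sub>R z) = a\<^sup>2 * Q t z" for t a
      unfolding Q_def linear_scale[OF linear_evol]
      by (simp add: bounded_bilinear.scaleR_left[OF bil] bounded_bilinear.scaleR_right[OF bil]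
          power_mult_distrib power2_eq_square[of a] right_diff_distrib)
    have "Q (tail_time + real N) y = Q (tail_time + real N) (norm y *\<^sub>R z)" using yz by (rule arg_cong)
    also have "\<dots> = (norm y)\<^sup>2 * Q (tail_time + real N) z" by (rule hom)
    finally show ?thesis using zpos by simp
  qed
  then show ?thesis by (intro exI[of _ "tail_time + real N"]) (simp add: Q_def)
qed

definition "cone_time = (SOME T. T \<ge> tail_time \<and> (\<forall>y. evol {n+1..2*n} tail_time tail_time y = y \<longrightarrow>
     \<kappa> / 2 * (norm (evol {n+1..2*n} T tail_time y))\<^sup>2 \<le> B (evol {n+1..2*n} T tail_time y) (evol {n+1..2*n} T tail_time y)))"

lemma cone_time: "cone_time \<ge> tail_time"
  and cone_time_pos: "evol {n+1..2*n} tail_time tail_time y = y \<Longrightarrow>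
     \<kappa> / 2 * (norm (evol {n+1..2*n} cone_time tail_time y))\<^sup>2 \<le> B (evol {n+1..2*n} cone_time tail_time y) (evol {n+1..2*n} cone_time tail_time y)"
  using someI_ex[OF unstable_eventually_pos_ex] unfolding cone_time_def by blast+


abbreviation "stab \<equiv> evol {1..n}"
abbreviation "unst \<equiv> evol {n+1..2*n}"

lemma stab_curve: "lyap_curve tail_time (\<lambda>t. stab t s y) (\<lambda>t. Dx f (xh t) 0 (stab t s y))"
  and unst_curve: "lyap_curve tail_time (\<lambda>t. unst t s y) (\<lambda>t. Dx f (xh t) 0 (unst t s y))"
  by (intro VE_lyap_curve evol_VE; auto)+

lemma unst_comp: "unst t r (unst r s y) = unst t s y"
  by (intro evol_comp) auto

lemma stab_bdd: "\<exists>M. \<forall>t\<ge>T. norm (stab t s y) \<le> M"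
  unfolding evol_def by (rule sum_stable_bounded)

lemma stab_neg: "t \<ge> tail_time \<Longrightarrow> B (stab t s y) (stab t s y) + \<kappa> * (norm (stab t s y))\<^sup>2 \<le> 0"
  using stab_bdd[of tail_time s y] bounded_imp_form_neg[OF stab_curve, of s y] by blast

lemma unst_pos: 
  assumes t: "t \<ge> cone_time"
  shows "\<kappa> / 2 * (norm (unst t s y))\<^sup>2 \<le> B (unst t s y) (unst t s y)"
proof -
  let ?z = "unst tail_time s y"
  have "unst tail_time tail_time ?z = ?z" by (rule unst_comp)
  from cone_time_pos[OF this] have 1: "\<kappa> / 2 * (norm (unst cone_time s y))\<^sup>2 \<le> B (unst cone_time s y) (unst cone_time s y)"
    by (simp only: unst_comp)
  have "exp (0 * (t - cone_time)) * (B (unst cone_time s y) (unst cone_time s y) + - (\<kappa> / 2) * (norm (unst cone_time s y))\<^sup>2)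
      \<le> B (unst t s y) (unst t s y) + - (\<kappa> / 2) * (norm (unst t s y))\<^sup>2"
    using \<kappa> c cone_time t by (intro form_growth[OF unst_curve]) auto
  then show ?thesis using 1 by simp
qed

text \<open>For \<open>y = u + p\<close> split into its unstable and stable parts, the form is bounded
  below on \<open>u\<close> and above on \<open>p\<close>, so \<open>B (u + p) (u - p) = B u u
  - B p p\<close> dominates the squares of both norms.\<close>

lemma projection_bound: "\<exists>P\<ge>0. \<forall>t\<ge>cone_time. \<forall>y. norm (stab t t y) \<le> P * norm y \<and> norm (unst t t y) \<le> P * norm y"
proof -
  obtain h' where h': "h' > 0" "\<And>x y. norm (B x y) \<le> norm x * norm y * h'"
    using bounded_bilinear.pos_bounded[OF bil] by blast
  define P where "P = 4 * h' / \<kappa>"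
  have "norm (stab t t y) + norm (unst t t y) \<le> P * norm y" if t: "t \<ge> cone_time" for t y
  proof -
    define p u where "p = stab t t y" and "u = unst t t y"
    define S where "S = norm p + norm u"
    have y: "y = u + p" unfolding p_def u_def using evol_split[of t y] by (simp only: add.commute)
    have "\<kappa> * (norm p)\<^sup>2 \<le> - B p p" using stab_neg[of t t y] t cone_time unfolding p_def by linarith
    then have p: "\<kappa> / 2 * (norm p)\<^sup>2 \<le> - B p p" using \<kappa> by (smt (verit) field_sum_of_halves mult_nonneg_nonneg zero_le_power2 distrib_right)
    have u: "\<kappa> / 2 * (norm u)\<^sup>2 \<le> B u u" unfolding u_def by (rule unst_pos[OF t])
    have "B (u + p) (u - p) = B u u - B p p"
      by (simp add: bounded_bilinear.add_left[OF bil] bounded_bilinear.diff_right[OF bil] sym[of p u])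
    moreover have "B (u + p) (u - p) \<le> norm y * S * h'"
    proof -
      have "B (u + p) (u - p) \<le> norm (u + p) * norm (u - p) * h'" using h'(2)[of "u + p" "u - p"] by simp
      also have "\<dots> \<le> norm (u + p) * S * h'"
        using norm_triangle_ineq4[of u p] h' by (intro mult_right_mono mult_left_mono) (auto simp: S_def)
      finally show ?thesis by (simp add: y)
    qed
    ultimately have "\<kappa> / 2 * ((norm p)\<^sup>2 + (norm u)\<^sup>2) \<le> norm y * S * h'" using p u by (simp add: distrib_left)
    moreover have "S\<^sup>2 / 2 \<le> (norm p)\<^sup>2 + (norm u)\<^sup>2"
      using sum_squares_bound[of "norm p" "norm u"] by (simp add: S_def power2_sum)
    then have "\<kappa> / 2 * (S\<^sup>2 / 2) \<le> \<kappa> / 2 * ((norm p)\<^sup>2 + (norm u)\<^sup>2)" using \<kappa> by (intro mult_left_mono) auto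
    ultimately have "(\<kappa> / 4 * S) * S \<le> (norm y * h') * S" by (simp add: power2_eq_square mult_ac)
    moreover have "S \<ge> 0" by (simp add: S_def)
    ultimately have "\<kappa> / 4 * S \<le> norm y * h' \<or> S = 0"
      using mult_right_le_imp_le[of "\<kappa> / 4 * S" S "norm y * h'"] by linarith
    then have "S \<le> P * norm y"
    proof
      assume "\<kappa> / 4 * S \<le> norm y * h'"
      then show ?thesis using \<kappa> by (simp add: P_def field_simps)
    qed (use \<kappa> h'(1) in \<open>simp add: P_def\<close>)
    then show ?thesis unfolding S_def p_def u_def .
  qed
  moreover have "norm p \<le> norm p + norm u" "norm u \<le> norm p + norm u" for p u :: "real^'m" by auto
  ultimately have "\<forall>t\<ge>cone_time. \<forall>y. norm (stab t t y) \<le> P * norm y \<and> norm (unst t t y) \<le> P * norm y"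
    by (meson order_trans)
  moreover have "P \<ge> 0" using h' \<kappa> by (simp add: P_def)
  ultimately show ?thesis by blast
qed

text \<open>Beyond \<open>cone_time\<close> the form gives the rates and \<open>projection_bound\<close>
  the bounds at equal times. The remaining times lie in a compact interval and only enlarge the
  constant.\<close>

lemma dichotomy:
  "\<exists>C\<ge>0. \<forall>s t y. 0 \<le> s \<longrightarrow> s \<le> t \<longrightarrow>
     norm (stab t s y) \<le> C * exp (- \<sigma> * (t - s)) * norm y \<and>
     norm (unst s t y) \<le> C * exp (- \<sigma> * (t - s)) * norm y"
proof -
  obtain P where P: "P \<ge> 0" "\<And>t y. t \<ge> cone_time \<Longrightarrow> norm (stab t t y) \<le> P * norm y"
    "\<And>t y. t \<ge> cone_time \<Longrightarrow> norm (unst t t y) \<le> P * norm y" using projection_bound by blast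
  obtain M where M: "M \<ge> 0" "\<And>I s t y. I \<subseteq> {1..2*n} \<Longrightarrow> s \<in> {0..cone_time} \<Longrightarrow> t \<in> {0..cone_time} \<Longrightarrow>
      norm (evol I t s y) \<le> M * norm y" using evol_bound[of cone_time] by blast
  have I: "{1..n} \<subseteq> {1..2*n}" "{n+1..2*n} \<subseteq> {1..2*n}" by auto
  have T1': "0 \<le> cone_time" using tail_time cone_time by simp
  define C where "C = exp (\<sigma> * cone_time) * (K * P + K * M + M + M * (K * P))"
  have KP: "0 \<le> K * P" "0 \<le> K * M" "0 \<le> M * (K * P)" using K P M by auto
  have E: "exp (\<sigma> * cone_time) \<ge> 1" using \<sigma> T1' by simp
  have C0: "C \<ge> 0" unfolding C_def using KP M(1) by (intro mult_nonneg_nonneg[OF exp_ge_zero]) linarith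
  have fin: "a * b * r \<le> C * exp (- \<sigma> * (t - s)) * r"
    if "a \<in> {K * P, K * M, M, M * (K * P)}" "b \<le> exp (\<sigma> * cone_time) * exp (- \<sigma> * (t - s))" "r \<ge> 0" for a b r s t
  proof -
    have a: "0 \<le> a" "a \<le> K * P + K * M + M + M * (K * P)" using that(1) KP M(1) by auto
    have "a * b \<le> a * (exp (\<sigma> * cone_time) * exp (- \<sigma> * (t - s)))" using that(2) a(1) by (rule mult_left_mono)
    also have "\<dots> \<le> (K * P + K * M + M + M * (K * P)) * (exp (\<sigma> * cone_time) * exp (- \<sigma> * (t - s)))"
      using a(2) by (rule mult_right_mono) simp
    also have "\<dots> = C * exp (- \<sigma> * (t - s))" by (simp add: C_def mult_ac)
    finally show ?thesis using that(3) by (rule mult_right_mono)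
  qed
  have b1: "exp (- \<sigma> * (t - s)) \<le> exp (\<sigma> * cone_time) * exp (- \<sigma> * (t - s))" for s t
    using mult_right_mono[OF E, of "exp (- \<sigma> * (t - s))"] by simp
  have b2: "exp (- \<sigma> * (t - cone_time)) \<le> exp (\<sigma> * cone_time) * exp (- \<sigma> * (t - s))" if "0 \<le> s" for s t
    using that \<sigma> by (simp add: exp_add[symmetric] algebra_simps)
  have b3: "1 \<le> exp (\<sigma> * cone_time) * exp (- \<sigma> * (t - s))" if "0 \<le> s" "t \<le> cone_time" for s t
  proof -
    have "\<sigma> * (t - s) \<le> \<sigma> * cone_time" using that \<sigma> by (intro mult_left_mono) auto
    then show ?thesis by (simp add: exp_add[symmetric])
  qed
  have stab_decay: "norm (stab t s' y) \<le> K * exp (- \<sigma> * (t - s)) * norm (stab s s' y)"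
    if "cone_time \<le> s" "s \<le> t" for s t s' y
  proof -
    obtain M where "\<And>t. t \<ge> tail_time \<Longrightarrow> norm (stab t s' y) \<le> M" using stab_bdd by blast
    then show ?thesis using that cone_time by (intro bounded_imp_decay[OF stab_curve]) auto
  qed
  have unst_growth: "norm (unst s s' y) \<le> K * exp (- \<sigma> * (t - s)) * norm (unst t s' y)"
    if "cone_time \<le> s" "s \<le> t" for s t s' y
    using that cone_time unst_pos[OF that(1)] by (intro form_pos_imp_growth[OF unst_curve]) auto
  have "norm (stab t s y) \<le> C * exp (- \<sigma> * (t - s)) * norm y \<and>
     norm (unst s t y) \<le> C * exp (- \<sigma> * (t - s)) * norm y" if st: "0 \<le> s" "s \<le> t" for s t y
  proof -
    consider "cone_time \<le> s" | "s < cone_time" "cone_time \<le> t" | "t < cone_time" by linarith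
    then show ?thesis
    proof cases
      case 1
      have "norm (stab t s y) \<le> K * exp (- \<sigma> * (t - s)) * norm (stab s s y)" by (rule stab_decay[OF 1 st(2)])
      also have "\<dots> \<le> K * exp (- \<sigma> * (t - s)) * (P * norm y)" using P(2)[OF 1] K by (intro mult_left_mono) auto
      also have "\<dots> = K * P * exp (- \<sigma> * (t - s)) * norm y" by (simp add: mult_ac)
      also have "\<dots> \<le> C * exp (- \<sigma> * (t - s)) * norm y" by (rule fin[OF _ b1]) auto
      finally have *: "norm (stab t s y) \<le> C * exp (- \<sigma> * (t - s)) * norm y" .
      have "norm (unst s t y) \<le> K * exp (- \<sigma> * (t - s)) * norm (unst t t y)" by (rule unst_growth[OF 1 st(2)])
      also have "\<dots> \<le> K * exp (- \<sigma> * (t - s)) * (P * norm y)" using P(3)[of t] 1 st K by (intro mult_left_mono) auto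
      also have "\<dots> = K * P * exp (- \<sigma> * (t - s)) * norm y" by (simp add: mult_ac)
      also have "\<dots> \<le> C * exp (- \<sigma> * (t - s)) * norm y" by (rule fin[OF _ b1]) auto
      finally show ?thesis using * by blast
    next
      case 2
      have s: "s \<in> {0..cone_time}" "cone_time \<in> {0..cone_time}" using st 2 T1' by auto
      have "norm (stab t s y) \<le> K * exp (- \<sigma> * (t - cone_time)) * norm (stab cone_time s y)" by (rule stab_decay[OF order_refl 2(2)])
      also have "\<dots> \<le> K * exp (- \<sigma> * (t - cone_time)) * (M * norm y)" using M(2)[OF I(1) s] K by (intro mult_left_mono) auto
      also have "\<dots> = K * M * exp (- \<sigma> * (t - cone_time)) * norm y" by (simp add: mult_ac)
      also have "\<dots> \<le> C * exp (- \<sigma> * (t - s)) * norm y" by (rule fin[OF _ b2[OF st(1)]]) auto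
      finally have *: "norm (stab t s y) \<le> C * exp (- \<sigma> * (t - s)) * norm y" .
      have "norm (unst cone_time t y) \<le> K * exp (- \<sigma> * (t - cone_time)) * norm (unst t t y)"
        by (rule unst_growth[OF order_refl 2(2)])
      also have "\<dots> \<le> K * exp (- \<sigma> * (t - cone_time)) * (P * norm y)" using P(3)[OF 2(2)] K by (intro mult_left_mono) auto
      finally have 3: "norm (unst cone_time t y) \<le> K * exp (- \<sigma> * (t - cone_time)) * (P * norm y)" .
      have "norm (unst s t y) = norm (unst s cone_time (unst cone_time t y))" by (simp only: unst_comp)
      also have "\<dots> \<le> M * norm (unst cone_time t y)" by (rule M(2)[OF I(2) s(2,1)])
      also have "\<dots> \<le> M * (K * exp (- \<sigma> * (t - cone_time)) * (P * norm y))" using 3 M(1) by (rule mult_left_mono)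
      also have "\<dots> = M * (K * P) * exp (- \<sigma> * (t - cone_time)) * norm y" by (simp add: mult_ac)
      also have "\<dots> \<le> C * exp (- \<sigma> * (t - s)) * norm y" by (rule fin[OF _ b2[OF st(1)]]) auto
      finally show ?thesis using * by blast
    next
      case 3
      have st': "s \<in> {0..cone_time}" "t \<in> {0..cone_time}" using st 3 by auto
      have "M * 1 * norm y \<le> C * exp (- \<sigma> * (t - s)) * norm y"
        using 3 by (intro fin[OF _ b3[OF st(1)]]) auto
      then show ?thesis using M(2)[OF I(1) st', of y] M(2)[OF I(2) st'(2,1), of y] by simp
    qed
  qed
  then show ?thesis using C0 by blast
qed

text \<open>As long as it is small, a solution of the nonlinear equation is itself a curve to which the
  exponential decay applies.\<close>

lemma small_solution_tends_to_0:
  assumes x: "\<And>t. t \<ge> T \<Longrightarrow> (x has_vector_derivative f (x t) \<mu>) (at t within {T..})"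
    and small: "\<And>t. t \<ge> T \<Longrightarrow> norm (x t) \<le> \<delta>" and \<mu>: "\<bar>\<mu>\<bar> \<le> \<delta>"
  shows "(x \<longlongrightarrow> 0) at_top"
proof -
  have curve: "lyap_curve T x (\<lambda>t. f (x t) \<mu>)"
    unfolding lyap_curve_def using x near_vf[OF small \<mu>] by blast
  have "\<forall>\<^sub>F t in at_top. norm (x t) \<le> K * exp (- \<sigma> * (t - T)) * norm (x T)"
    unfolding eventually_at_top_linorder
    by (intro exI[of _ T] allI impI bounded_imp_decay[OF curve small]) auto
  moreover have "((\<lambda>t. K * exp (- \<sigma> * (t - T)) * norm (x T)) \<longlongrightarrow> 0) at_top"
  proof -
    have "LIM t at_top. - T + t :> at_top"
      by (rule filterlim_tendsto_add_at_top[OF tendsto_const filterlim_ident])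
    from filterlim_tendsto_pos_mult_at_top[OF tendsto_const \<sigma> this]
    have "LIM t at_top. \<sigma> * (t - T) :> at_top" by simp
    then have "LIM t at_top. - (\<sigma> * (t - T)) :> at_bot" by (simp add: filterlim_uminus_at_bot)
    then have "((\<lambda>t. exp (- \<sigma> * (t - T))) \<longlongrightarrow> 0) at_top"
      by (auto intro: filterlim_compose[OF exp_at_bot])
    then show ?thesis by (intro tendsto_mult_left_zero tendsto_mult_right_zero)
  qed
  ultimately show ?thesis by (rule Lim_null_comparison)
qed

end

section \<open>Fixed points and integrals on the half line\<close>

text \<open>Banach's theorem for bounded continuous functions on the line; a function on the half line is
  represented by its extension that is constant to the left of \<open>0\<close>.\<close>

lemma half_line_fixed_point:
  fixes \<Phi> :: "(real \<Rightarrow> 'a::banach) \<Rightarrow> real \<Rightarrow> 'a"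
  assumes G: "G \<ge> 0"
    and maps: "\<And>g. continuous_on {0..} g \<Longrightarrow> (\<And>t. t \<ge> 0 \<Longrightarrow> norm (g t) \<le> G) \<Longrightarrow>
        continuous_on {0..} (\<Phi> g) \<and> (\<forall>t\<ge>0. norm (\<Phi> g t) \<le> G)"
    and contr: "\<And>g g' d. continuous_on {0..} g \<Longrightarrow> (\<And>t. t \<ge> 0 \<Longrightarrow> norm (g t) \<le> G) \<Longrightarrow>
        continuous_on {0..} g' \<Longrightarrow> (\<And>t. t \<ge> 0 \<Longrightarrow> norm (g' t) \<le> G) \<Longrightarrow>
        (\<And>t. t \<ge> 0 \<Longrightarrow> norm (g t - g' t) \<le> d) \<Longrightarrow> \<forall>t\<ge>0. norm (\<Phi> g t - \<Phi> g' t) \<le> d / 2"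
  shows "\<exists>g. continuous_on {0..} g \<and> (\<forall>t\<ge>0. norm (g t) \<le> G) \<and> (\<forall>t\<ge>0. g t = \<Phi> g t)"
proof -
  define B where "B = cball (0 :: real \<Rightarrow>\<^sub>C 'a) G"
  define T where "T b = Bcontfun (\<lambda>t. \<Phi> (apply_bcontfun b) (max 0 t))" for b
  have b_cont: "continuous_on S (apply_bcontfun b)" for S and b :: "real \<Rightarrow>\<^sub>C 'a"
    by (rule continuous_on_subset[OF continuous_on_apply_bcontfun]) auto
  have b_bd: "norm (apply_bcontfun b t) \<le> G" if "b \<in> B" for b t
    using dist_bounded[of b t 0] that by (simp add: B_def dist_norm norm_minus_commute)
  note mapsB = maps[OF b_cont b_bd]
  have T_apply: "apply_bcontfun (T b) t = \<Phi> (apply_bcontfun b) (max 0 t)" if b: "b \<in> B" for b t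
  proof -
    have "continuous_on UNIV (\<lambda>t. \<Phi> (apply_bcontfun b) (max 0 t))"
      by (rule continuous_on_compose2[OF conjunct1[OF mapsB[OF b]]]) (auto intro!: continuous_intros)
    moreover have "norm (\<Phi> (apply_bcontfun b) (max 0 t)) \<le> G" for t using mapsB[OF b] by simp
    ultimately have "(\<lambda>t. \<Phi> (apply_bcontfun b) (max 0 t)) \<in> bcontfun"
      by (intro bcontfun_normI) auto
    then show ?thesis unfolding T_def by (simp add: Bcontfun_inverse)
  qed
  have "\<exists>!b\<in>B. T b = b"
  proof (rule Banach_fix)
    show "complete B" unfolding B_def by (simp add: complete_eq_closed)
    show "B \<noteq> {}" unfolding B_def using G by auto
    show "T ` B \<subseteq> B"
    proof
      fix b' assume "b' \<in> T ` B"
      then obtain b where b: "b \<in> B" "b' = T b" by blast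
      have "dist (T b) 0 \<le> G"
        by (rule dist_bound) (use T_apply[OF b(1)] mapsB[OF b(1)] in \<open>simp add: dist_norm\<close>)
      then show "b' \<in> B" by (simp add: B_def b(2) dist_commute)
    qed
    fix b b' assume b: "b \<in> B" "b' \<in> B"
    show "dist (T b) (T b') \<le> 1 / 2 * dist b b'"
    proof (rule dist_bound)
      fix t
      have "\<forall>t\<ge>0. norm (\<Phi> (apply_bcontfun b) t - \<Phi> (apply_bcontfun b') t) \<le> dist b b' / 2"
        by (rule contr[OF b_cont b_bd[OF b(1)] b_cont b_bd[OF b(2)]])
          (use dist_bounded[of b _ b'] in \<open>simp add: dist_norm\<close>)
      then show "dist (apply_bcontfun (T b) t) (apply_bcontfun (T b') t) \<le> 1 / 2 * dist b b'"
        by (simp add: T_apply[OF b(1)] T_apply[OF b(2)] dist_norm)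
    qed
  qed auto
  then obtain b where b: "b \<in> B" "T b = b" by blast
  have "apply_bcontfun b t = \<Phi> (apply_bcontfun b) t" if "t \<ge> 0" for t
    using T_apply[OF b(1), of t] that b(2) by (simp add: max_def)
  then show ?thesis using b_cont b_bd[OF b(1)] by blast
qed

text \<open>A non-integrable function has Lebesgue integral \<open>0\<close> by convention, so the
  hypothesis that the integral does not vanish supplies integrability.\<close>

lemma even_integral:
  fixes u :: "real \<Rightarrow> real"
  assumes even: "\<And>t. u (- t) = u t" and nz: "(LINT t|lborel. u t) \<noteq> 0"
  shows "(LINT t|lborel. u t) = 2 * integral {0..} u"
proof -
  have int: "integrable lborel u" using nz not_integrable_integral_eq by blast
  have "set_integrable lborel {0..} u"
    unfolding set_integrable_def using int by (intro integrable_mult_indicator) auto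
  then have "has_bochner_integral lborel (\<lambda>x. indicator {0..} x *\<^sub>R u x) (integral {0..} u)"
    unfolding has_bochner_integral_iff using set_borel_integral_eq_integral(2)[of "{0..}" u]
    by (simp add: set_integrable_def set_lebesgue_integral_def)
  from has_bochner_integral_even_function[OF this even] show ?thesis
    by (simp add: has_bochner_integral_iff)
qed

lemma exp_integral_le:
  fixes a t :: real
  assumes "a > 0" "t \<ge> 0"
  shows "(\<lambda>s. exp (- a * (t - s))) integrable_on {0..t}" "integral {0..t} (\<lambda>s. exp (- a * (t - s))) \<le> 1 / a"
proof -
  have "((\<lambda>s. exp (- a * (t - s))) has_integral exp (- a * (t - t)) / a - exp (- a * (t - 0)) / a) {0..t}"
    using assms by (intro fundamental_theorem_of_calculus)
      (auto intro!: derivative_eq_intros simp: has_real_derivative_iff_has_vector_derivative[symmetric])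
  then show "(\<lambda>s. exp (- a * (t - s))) integrable_on {0..t}"
    "integral {0..t} (\<lambda>s. exp (- a * (t - s))) \<le> 1 / a"
    using assms by (auto simp: has_integral_integrable integral_unique field_simps)
qed

lemma exp_tail_integral:
  fixes a t :: real
  assumes "a > 0"
  shows "((\<lambda>s. exp (- a * (s - t))) has_integral 1 / a) {t..}"
proof -
  have "((\<lambda>s. exp (- a * s) * exp (a * t)) has_integral exp (- a * t) / a * exp (a * t)) {t..}"
    by (intro has_integral_mult_left has_integral_exp_minus_to_infinity assms)
  then show ?thesis by (simp add: exp_add[symmetric] algebra_simps)
qed

lemma integrable_exp_bound:
  fixes u :: "real \<Rightarrow> 'a::euclidean_space"
  assumes a: "a > 0" and u: "continuous_on {t..} u" and le: "\<And>s. s \<ge> t \<Longrightarrow> norm (u s) \<le> M * exp (- a * (s - t))"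
  shows "u integrable_on {t..}" "norm (integral {t..} u) \<le> M / a"
proof -
  have e: "((\<lambda>s. M * exp (- a * (s - t))) has_integral M * (1 / a)) {t..}"
    by (intro has_integral_mult_right exp_tail_integral a)
  show int: "u integrable_on {t..}"
  proof (rule measurable_bounded_by_integrable_imp_integrable)
    show "u \<in> borel_measurable (lebesgue_on {t..})"
      by (rule continuous_imp_measurable_on_sets_lebesgue[OF u]) simp
    show "(\<lambda>s. M * exp (- a * (s - t))) integrable_on {t..}" using e by (rule has_integral_integrable)
  qed (use le in simp_all)
  have "norm (integral {t..} u) \<le> integral {t..} (\<lambda>s. M * exp (- a * (s - t)))"
    by (rule Henstock_Kurzweil_Integration.integral_norm_bound_integral[OF int]) (use e le in auto)
  also have "\<dots> = M / a" using integral_unique[OF e] by simp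
  finally show "norm (integral {t..} u) \<le> M / a" .
qed

lemma at_within_half_line:
  fixes t :: real
  assumes "0 \<le> t" shows "at t within {0..t + 1} = at t within {0..}"
  by (rule at_within_nhd[of t "{..<t + 1}"]) (use assms in auto)

section \<open>Bounded solutions of the inhomogeneous variational equation\<close>

context homoclinic_lyapunov
begin

definition "dich_const = (SOME C. C \<ge> 0 \<and> (\<forall>s t y. 0 \<le> s \<longrightarrow> s \<le> t \<longrightarrow>
     norm (stab t s y) \<le> C * exp (- \<sigma> * (t - s)) * norm y \<and>
     norm (unst s t y) \<le> C * exp (- \<sigma> * (t - s)) * norm y))"

lemma dich_const: "dich_const \<ge> 0"
  and stab_le: "0 \<le> s \<Longrightarrow> s \<le> t \<Longrightarrow> norm (stab t s y) \<le> dich_const * exp (- \<sigma> * (t - s)) * norm y"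
  and unst_le: "0 \<le> s \<Longrightarrow> s \<le> t \<Longrightarrow> norm (unst s t y) \<le> dich_const * exp (- \<sigma> * (t - s)) * norm y"
  using someI_ex[OF dichotomy] unfolding dich_const_def by blast+

text \<open>The number \<open>sp (\<psi> k s) y\<close> is the coordinate along \<open>\<phi> k 0\<close>
  of \<open>unst 0 s y\<close>, which decays by the dichotomy.\<close>

lemma psi_decay_ex:
  "\<exists>C\<ge>0. \<forall>k\<in>{n+1..2*n}. \<forall>s\<ge>0. \<forall>y. \<bar>sp (\<psi> k s) y\<bar> \<le> C * exp (- \<sigma> * s) * norm y"
proof -
  obtain S where S: "S > 0" "\<And>x y. norm (sp x y) \<le> norm x * norm y * S"
    using bounded_bilinear.pos_bounded[OF sp_bb] by blast
  define C where "C = (\<Sum>k\<in>{n+1..2*n}. norm (\<psi> k 0)) * dich_const * S"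
  have "\<bar>sp (\<psi> k s) y\<bar> \<le> C * exp (- \<sigma> * s) * norm y" if k: "k \<in> {n+1..2*n}" and s: "s \<ge> 0" for k s y
  proof -
    have I: "{n+1..2*n} \<subseteq> {1..2*n}" and k': "k \<in> {1..2*n}" using k by auto
    have "sp (\<psi> k 0) (unst 0 s y) = sp (\<psi> k s) y"
      unfolding evol_def using psi_coeff[OF I k', of 0 "\<lambda>k. sp (\<psi> k s) y"] unfolding if_P[OF k] .
    then have "\<bar>sp (\<psi> k s) y\<bar> \<le> norm (\<psi> k 0) * norm (unst 0 s y) * S" using S(2)[of "\<psi> k 0" "unst 0 s y"] by simp
    also have "\<dots> \<le> (\<Sum>k\<in>{n+1..2*n}. norm (\<psi> k 0)) * (dich_const * exp (- \<sigma> * s) * norm y) * S"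
    proof (intro mult_right_mono mult_mono)
      show "norm (\<psi> k 0) \<le> (\<Sum>k\<in>{n+1..2*n}. norm (\<psi> k 0))" using k by (intro member_le_sum) auto
      show "norm (unst 0 s y) \<le> dich_const * exp (- \<sigma> * s) * norm y" using unst_le[of 0 s y] s by simp
    qed (use S in \<open>auto intro: sum_nonneg\<close>)
    also have "\<dots> = C * exp (- \<sigma> * s) * norm y" by (simp add: C_def mult_ac)
    finally show ?thesis .
  qed
  moreover have "C \<ge> 0" unfolding C_def using dich_const S by (auto intro!: mult_nonneg_nonneg sum_nonneg)
  ultimately show ?thesis by blast
qed

definition "psi_const = (SOME C. C \<ge> 0 \<and> (\<forall>k\<in>{n+1..2*n}. \<forall>s\<ge>0. \<forall>y. \<bar>sp (\<psi> k s) y\<bar> \<le> C * exp (- \<sigma> * s) * norm y))"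

lemma psi_const: "psi_const \<ge> 0"
  and psi_decay: "k \<in> {n+1..2*n} \<Longrightarrow> s \<ge> 0 \<Longrightarrow> \<bar>sp (\<psi> k s) y\<bar> \<le> psi_const * exp (- \<sigma> * s) * norm y"
  using someI_ex[OF psi_decay_ex] unfolding psi_const_def by blast+

definition "psi_primitive k g t = integral {0..t} (\<lambda>s. sp (\<psi> k s) (g s))"
definition "psi_integral k g = integral {0..} (\<lambda>s. sp (\<psi> k s) (g s))"
text \<open>Variation of constants for \<open>w' = A(t) w + g\<close>: the stable coordinates are
  integrated from \<open>0\<close>, the unstable ones from infinity, which makes the solution
  bounded. The multiples of \<open>\<phi> j\<close> with \<open>3 \<le> j \<le> n\<close> are
  added in order to move the initial value towards \<open>Fix R\<close>.\<close>

definition "green g t = (\<Sum>k\<in>{1..2*n}. psi_primitive k g t *\<^sub>R \<phi> k t) - (\<Sum>j\<in>{3..n}. psi_integral (n+j) g *\<^sub>R \<phi> j t)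
    - (\<Sum>k\<in>{n+1..2*n}. psi_integral k g *\<^sub>R \<phi> k t)"

definition bdd_forcing :: "(real \<Rightarrow> real^'m) \<Rightarrow> real \<Rightarrow> bool" where
  "bdd_forcing g G \<longleftrightarrow> continuous_on {0..} g \<and> (\<forall>t\<ge>0. norm (g t) \<le> G)"

lemma bdd_forcingD: "bdd_forcing g G \<Longrightarrow> continuous_on {0..} g" "bdd_forcing g G \<Longrightarrow> t \<ge> 0 \<Longrightarrow> norm (g t) \<le> G"
  unfolding bdd_forcing_def by simp_all

lemma bdd_forcing_nonneg: "bdd_forcing g G \<Longrightarrow> G \<ge> 0"
  by (rule order_trans[OF norm_ge_zero bdd_forcingD(2)[of g G 0, OF _ order_refl]])

lemma integrand_cont:
  assumes "continuous_on {0..} g" "k \<in> {1..2*n}" "T \<subseteq> {0..}"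
  shows "continuous_on T (\<lambda>s. sp (\<psi> k s) (g s))"
  by (intro bounded_bilinear.continuous_on[OF sp_bb] psi_cont assms continuous_on_subset[OF assms(1,3)])

lemma integrand_le:
  assumes g: "bdd_forcing g G" and k: "k \<in> {n+1..2*n}" and s: "s \<ge> 0"
  shows "norm (sp (\<psi> k s) (g s)) \<le> (psi_const * G) * exp (- \<sigma> * (s - 0))"
proof -
  have "\<bar>sp (\<psi> k s) (g s)\<bar> \<le> psi_const * exp (- \<sigma> * s) * norm (g s)" by (rule psi_decay[OF k s])
  also have "\<dots> \<le> psi_const * exp (- \<sigma> * s) * G" using bdd_forcingD(2)[OF g s] psi_const by (intro mult_left_mono) auto
  finally show ?thesis by (simp add: mult_ac)
qed

lemma psi_integral_bound:
  assumes g: "bdd_forcing g G" and k: "k \<in> {n+1..2*n}"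
  shows "(\<lambda>s. sp (\<psi> k s) (g s)) integrable_on {0..}" "\<bar>psi_integral k g\<bar> \<le> psi_const / \<sigma> * G"
proof -
  have k': "k \<in> {1..2*n}" using k by auto
  note b = integrable_exp_bound[OF \<sigma> integrand_cont[OF bdd_forcingD(1)[OF g] k' order_refl] integrand_le[OF g k]]
  show "(\<lambda>s. sp (\<psi> k s) (g s)) integrable_on {0..}" by (rule b(1))
  show "\<bar>psi_integral k g\<bar> \<le> psi_const / \<sigma> * G" using b(2) by (simp add: psi_integral_def)
qed

lemma psi_primitive_integrable:
  assumes g: "continuous_on {0..} g" and k: "k \<in> {1..2*n}"
  shows "(\<lambda>s. sp (\<psi> k s) (g s)) integrable_on {0..t}"
  by (intro integrable_continuous_real integrand_cont[OF g k]) auto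

lemma psi_integral_split:
  assumes g: "bdd_forcing g G" and k: "k \<in> {n+1..2*n}" and t: "t \<ge> 0"
  shows "(\<lambda>s. sp (\<psi> k s) (g s)) integrable_on {t..}"
    "psi_integral k g - psi_primitive k g t = integral {t..} (\<lambda>s. sp (\<psi> k s) (g s))"
proof -
  have k': "k \<in> {1..2*n}" using k by auto
  show int: "(\<lambda>s. sp (\<psi> k s) (g s)) integrable_on {t..}"
  proof (rule integrable_exp_bound(1)[OF \<sigma>])
    show "continuous_on {t..} (\<lambda>s. sp (\<psi> k s) (g s))"
      using t by (intro integrand_cont[OF bdd_forcingD(1)[OF g] k']) auto
    show "norm (sp (\<psi> k s) (g s)) \<le> (psi_const * G * exp (- \<sigma> * t)) * exp (- \<sigma> * (s - t))" if "s \<ge> t" for s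
    proof -
      have "exp (- \<sigma> * (s - 0)) = exp (- \<sigma> * t) * exp (- \<sigma> * (s - t))"
        by (simp add: exp_add[symmetric] right_diff_distrib)
      then show ?thesis using integrand_le[OF g k, of s] t that by (simp only: mult.assoc)
    qed
  qed
  have "{0..} = {0..t} \<union> {t..}" "{0..t} \<inter> {t..} = {t}" using t by auto
  then have "psi_integral k g = psi_primitive k g t + integral {t..} (\<lambda>s. sp (\<psi> k s) (g s))"
    unfolding psi_integral_def psi_primitive_def using integral_Un[OF psi_primitive_integrable[OF bdd_forcingD(1)[OF g] k', of t] int] by simp
  then show "psi_integral k g - psi_primitive k g t = integral {t..} (\<lambda>s. sp (\<psi> k s) (g s))" by simp
qed

text \<open>The form of the Green operator to which the dichotomy applies.\<close>

lemma green_eq: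
  assumes g: "bdd_forcing g G" and t: "t \<ge> 0"
  shows "green g t = integral {0..t} (\<lambda>s. stab t s (g s)) - integral {t..} (\<lambda>s. unst t s (g s))
     - (\<Sum>j\<in>{3..n}. psi_integral (n+j) g *\<^sub>R \<phi> j t)"
proof -
  have 1: "integral {0..t} (\<lambda>s. stab t s (g s)) = (\<Sum>k\<in>{1..n}. psi_primitive k g t *\<^sub>R \<phi> k t)"
    unfolding evol_def psi_primitive_def
  proof (subst Henstock_Kurzweil_Integration.integral_sum, goal_cases)
    case (2 k)
    then show ?case by (intro integrable_on_scaleR_left psi_primitive_integrable[OF bdd_forcingD(1)[OF g]]) auto
  next
    case 3
    show ?case
    proof (intro sum.cong refl integral_unique has_integral_scaleR_left integrable_integral)
      fix k assume "k \<in> {1..n}"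
      then show "(\<lambda>s. sp (\<psi> k s) (g s)) integrable_on {0..t}" by (intro psi_primitive_integrable[OF bdd_forcingD(1)[OF g]]) auto
    qed
  qed simp
  have 2: "integral {t..} (\<lambda>s. unst t s (g s)) = (\<Sum>k\<in>{n+1..2*n}. (psi_integral k g - psi_primitive k g t) *\<^sub>R \<phi> k t)"
    unfolding evol_def
  proof (subst Henstock_Kurzweil_Integration.integral_sum, goal_cases)
    case (2 k)
    then show ?case by (intro integrable_on_scaleR_left psi_integral_split(1)[OF g _ t])
  next
    case 3
    show ?case
    proof (intro sum.cong refl)
      fix k assume k: "k \<in> {n+1..2*n}"
      show "integral {t..} (\<lambda>s. sp (\<psi> k s) (g s) *\<^sub>R \<phi> k t) = (psi_integral k g - psi_primitive k g t) *\<^sub>R \<phi> k t"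
        unfolding psi_integral_split(2)[OF g k t]
        by (intro integral_unique has_integral_scaleR_left integrable_integral psi_integral_split(1)[OF g k t])
    qed
  qed simp
  have u: "{1..2*n} = {1..n} \<union> {n+1..2*n}" by auto
  have "(\<Sum>k\<in>{1..2*n}. psi_primitive k g t *\<^sub>R \<phi> k t) = (\<Sum>k\<in>{1..n}. psi_primitive k g t *\<^sub>R \<phi> k t) + (\<Sum>k\<in>{n+1..2*n}. psi_primitive k g t *\<^sub>R \<phi> k t)"
    unfolding u by (rule sum.union_disjoint) auto
  then show ?thesis
    unfolding 1 2 green_def by (simp add: scaleR_diff_left sum_subtractf)
qed

lemma evol_cont:
  assumes "continuous_on {0..} g" "I \<subseteq> {1..2*n}" "T \<subseteq> {0..}"
  shows "continuous_on T (\<lambda>s. evol I t s (g s))"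
  unfolding evol_def
  by (intro continuous_on_sum continuous_on_scaleR continuous_on_const integrand_cont[OF assms(1) _ assms(3)])
    (use assms(2) in auto)

lemma green_bound: "\<exists>C\<ge>0. \<forall>g G. bdd_forcing g G \<longrightarrow> (\<forall>t\<ge>0. norm (green g t) \<le> C * G)"
proof -
  have "\<exists>M. \<forall>t\<ge>0. norm (\<phi> j t) \<le> M" if "j \<in> {3..n}" for j
    using that by (intro phi_stable_bounded) auto
  then obtain P where P: "\<And>j t. j \<in> {3..n} \<Longrightarrow> t \<ge> 0 \<Longrightarrow> norm (\<phi> j t) \<le> P j" by metis
  define C where "C = dich_const / \<sigma> + dich_const / \<sigma> + (\<Sum>j\<in>{3..n}. psi_const / \<sigma> * \<bar>P j\<bar>)"
  have "norm (green g t) \<le> C * G" if g: "bdd_forcing g G" and t: "t \<ge> 0" for g G t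
  proof -
    have G: "G \<ge> 0" using bdd_forcing_nonneg[OF g] .
    have 1: "norm (integral {0..t} (\<lambda>s. stab t s (g s))) \<le> dich_const / \<sigma> * G"
    proof -
      have "norm (integral {0..t} (\<lambda>s. stab t s (g s))) \<le> integral {0..t} (\<lambda>s. (dich_const * G) * exp (- \<sigma> * (t - s)))"
      proof (rule Henstock_Kurzweil_Integration.integral_norm_bound_integral)
        show "(\<lambda>s. stab t s (g s)) integrable_on {0..t}"
          by (intro integrable_continuous_real evol_cont[OF bdd_forcingD(1)[OF g]]) auto
        show "(\<lambda>s. (dich_const * G) * exp (- \<sigma> * (t - s))) integrable_on {0..t}"
          by (intro integrable_on_mult_right exp_integral_le \<sigma> t)
        fix s assume s: "s \<in> {0..t}"
        have "norm (stab t s (g s)) \<le> dich_const * exp (- \<sigma> * (t - s)) * norm (g s)" using s by (intro stab_le) auto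
        also have "\<dots> \<le> dich_const * exp (- \<sigma> * (t - s)) * G" using bdd_forcingD(2)[OF g, of s] s dich_const by (intro mult_left_mono) auto
        finally show "norm (stab t s (g s)) \<le> (dich_const * G) * exp (- \<sigma> * (t - s))" by (simp add: mult_ac)
      qed
      also have "\<dots> = (dich_const * G) * integral {0..t} (\<lambda>s. exp (- \<sigma> * (t - s)))" by simp
      also have "\<dots> \<le> (dich_const * G) * (1 / \<sigma>)" using dich_const G by (intro mult_left_mono exp_integral_le \<sigma> t) auto
      finally show ?thesis by simp
    qed
    have 2: "norm (integral {t..} (\<lambda>s. unst t s (g s))) \<le> dich_const / \<sigma> * G"
    proof -
      have "norm (integral {t..} (\<lambda>s. unst t s (g s))) \<le> (dich_const * G) / \<sigma>"
      proof (rule integrable_exp_bound(2)[OF \<sigma>])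
        show "continuous_on {t..} (\<lambda>s. unst t s (g s))"
          using t by (intro evol_cont[OF bdd_forcingD(1)[OF g]]) auto
        fix s assume s: "s \<ge> t"
        have "norm (unst t s (g s)) \<le> dich_const * exp (- \<sigma> * (s - t)) * norm (g s)" using s t by (intro unst_le) auto
        also have "\<dots> \<le> dich_const * exp (- \<sigma> * (s - t)) * G" using bdd_forcingD(2)[OF g, of s] s t dich_const by (intro mult_left_mono) auto
        finally show "norm (unst t s (g s)) \<le> (dich_const * G) * exp (- \<sigma> * (s - t))" by (simp add: mult_ac)
      qed
      then show ?thesis by simp
    qed
    have 3: "norm (\<Sum>j\<in>{3..n}. psi_integral (n+j) g *\<^sub>R \<phi> j t) \<le> (\<Sum>j\<in>{3..n}. psi_const / \<sigma> * \<bar>P j\<bar>) * G"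
    proof -
      have "norm (\<Sum>j\<in>{3..n}. psi_integral (n+j) g *\<^sub>R \<phi> j t) \<le> (\<Sum>j\<in>{3..n}. (psi_const / \<sigma> * \<bar>P j\<bar>) * G)"
      proof (rule order_trans[OF norm_sum], rule sum_mono)
        fix j assume j: "j \<in> {3..n}"
        have "\<bar>psi_integral (n+j) g\<bar> \<le> psi_const / \<sigma> * G" using j by (intro psi_integral_bound[OF g]) auto
        moreover have "norm (\<phi> j t) \<le> \<bar>P j\<bar>" using P[OF j t] by linarith
        ultimately have "\<bar>psi_integral (n+j) g\<bar> * norm (\<phi> j t) \<le> (psi_const / \<sigma> * G) * \<bar>P j\<bar>"
          using psi_const \<sigma> G by (intro mult_mono) auto
        then show "norm (psi_integral (n+j) g *\<^sub>R \<phi> j t) \<le> (psi_const / \<sigma> * \<bar>P j\<bar>) * G" by (simp add: mult_ac)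
      qed
      then show ?thesis by (simp only: sum_distrib_right)
    qed
    have "norm (green g t) \<le> dich_const / \<sigma> * G + dich_const / \<sigma> * G + (\<Sum>j\<in>{3..n}. psi_const / \<sigma> * \<bar>P j\<bar>) * G"
      unfolding green_eq[OF g t]
      using 1 2 3 norm_triangle_ineq4 by (meson add_mono order_trans)
    then show ?thesis by (simp only: C_def distrib_right)
  qed
  moreover have "C \<ge> 0" unfolding C_def using dich_const \<sigma> psi_const by (auto intro!: add_nonneg_nonneg sum_nonneg)
  ultimately show ?thesis by blast
qed

lemma bdd_forcing_comb: "bdd_forcing g1 G1 \<Longrightarrow> bdd_forcing g2 G2 \<Longrightarrow> bdd_forcing (\<lambda>t. a *\<^sub>R g1 t + b *\<^sub>R g2 t) (\<bar>a\<bar> * G1 + \<bar>b\<bar> * G2)"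
  unfolding bdd_forcing_def by (auto intro!: continuous_intros norm_triangle_le add_mono mult_left_mono)

lemma psi_integral_comb:
  assumes "bdd_forcing g1 G1" "bdd_forcing g2 G2" "k \<in> {n+1..2*n}"
  shows "psi_integral k (\<lambda>t. a *\<^sub>R g1 t + b *\<^sub>R g2 t) = a * psi_integral k g1 + b * psi_integral k g2"
  unfolding psi_integral_def using psi_integral_bound(1)[OF assms(1,3)] psi_integral_bound(1)[OF assms(2,3)]
  by (simp add: sp_simps Henstock_Kurzweil_Integration.integral_add integrable_on_mult_right)

lemma psi_primitive_comb:
  assumes "bdd_forcing g1 G1" "bdd_forcing g2 G2" "k \<in> {1..2*n}"
  shows "psi_primitive k (\<lambda>t. a *\<^sub>R g1 t + b *\<^sub>R g2 t) t = a * psi_primitive k g1 t + b * psi_primitive k g2 t"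
  unfolding psi_primitive_def
  using psi_primitive_integrable[OF bdd_forcingD(1)[OF assms(1)] assms(3)] psi_primitive_integrable[OF bdd_forcingD(1)[OF assms(2)] assms(3)]
  by (simp add: sp_simps Henstock_Kurzweil_Integration.integral_add integrable_on_mult_right)

lemma green_comb:
  assumes g: "bdd_forcing g1 G1" "bdd_forcing g2 G2"
  shows "green (\<lambda>t. a *\<^sub>R g1 t + b *\<^sub>R g2 t) t = a *\<^sub>R green g1 t + b *\<^sub>R green g2 t"
proof -
  have 1: "(\<Sum>k\<in>{1..2*n}. psi_primitive k (\<lambda>t. a *\<^sub>R g1 t + b *\<^sub>R g2 t) t *\<^sub>R \<phi> k t)
     = (\<Sum>k\<in>{1..2*n}. (a * psi_primitive k g1 t + b * psi_primitive k g2 t) *\<^sub>R \<phi> k t)"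
    using psi_primitive_comb[OF g] by (intro sum.cong) auto
  have 2: "(\<Sum>j\<in>{3..n}. psi_integral (n+j) (\<lambda>t. a *\<^sub>R g1 t + b *\<^sub>R g2 t) *\<^sub>R \<phi> j t)
     = (\<Sum>j\<in>{3..n}. (a * psi_integral (n+j) g1 + b * psi_integral (n+j) g2) *\<^sub>R \<phi> j t)"
    using psi_integral_comb[OF g] by (intro sum.cong) auto
  have 3: "(\<Sum>k\<in>{n+1..2*n}. psi_integral k (\<lambda>t. a *\<^sub>R g1 t + b *\<^sub>R g2 t) *\<^sub>R \<phi> k t)
     = (\<Sum>k\<in>{n+1..2*n}. (a * psi_integral k g1 + b * psi_integral k g2) *\<^sub>R \<phi> k t)"
    using psi_integral_comb[OF g] by (intro sum.cong) auto
  show ?thesis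
    unfolding green_def 1 2 3
    by (simp add: scaleR_add_left sum.distrib scaleR_diff_right scaleR_sum_right[symmetric] scaleR_scaleR[symmetric]
        del: scaleR_scaleR)
qed

lemma green_der:
  assumes g: "continuous_on {0..} g" and t: "t \<ge> 0"
  shows "(green g has_vector_derivative Dx f (xh t) 0 (green g t) + g t) (at t within {0..})"
proof -
  have c: "((\<lambda>t. psi_primitive k g t) has_real_derivative sp (\<psi> k t) (g t)) (at t within {0..})" if k: "k \<in> {1..2*n}" for k
  proof -
    have "((\<lambda>u. integral {0..u} (\<lambda>s. sp (\<psi> k s) (g s))) has_vector_derivative sp (\<psi> k t) (g t)) (at t within {0..t+1})"
      using t by (intro integral_has_vector_derivative integrand_cont[OF g k]) auto
    then show ?thesis
      unfolding psi_primitive_def by (simp add: at_within_half_line[OF t] has_real_derivative_iff_has_vector_derivative)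
  qed
  have p: "(\<phi> k has_vector_derivative Dx f (xh t) 0 (\<phi> k t)) (at t within {0..})" if "k \<in> {1..2*n}" for k
    using phi_der[OF that] by (rule has_vector_derivative_at_within)
  let ?A = "Dx f (xh t) 0"
  have "(green g has_vector_derivative
     (\<Sum>k\<in>{1..2*n}. psi_primitive k g t *\<^sub>R ?A (\<phi> k t) + sp (\<psi> k t) (g t) *\<^sub>R \<phi> k t)
      - (\<Sum>j\<in>{3..n}. psi_integral (n+j) g *\<^sub>R ?A (\<phi> j t)) - (\<Sum>k\<in>{n+1..2*n}. psi_integral k g *\<^sub>R ?A (\<phi> k t))) (at t within {0..})"
    unfolding green_def[abs_def]
    by (intro has_vector_derivative_diff has_vector_derivative_sum has_vector_derivative_scaleR c p
      bounded_linear.has_vector_derivative[OF bounded_linear_scaleR_right]) auto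
  also have "(\<Sum>k\<in>{1..2*n}. psi_primitive k g t *\<^sub>R ?A (\<phi> k t) + sp (\<psi> k t) (g t) *\<^sub>R \<phi> k t)
      - (\<Sum>j\<in>{3..n}. psi_integral (n+j) g *\<^sub>R ?A (\<phi> j t)) - (\<Sum>k\<in>{n+1..2*n}. psi_integral k g *\<^sub>R ?A (\<phi> k t))
    = ?A (green g t) + (\<Sum>k\<in>{1..2*n}. sp (\<psi> k t) (g t) *\<^sub>R \<phi> k t)"
    unfolding green_def by (simp only: linear_diff[OF lin_Dx] linear_sum[OF lin_Dx] linear_scale[OF lin_Dx] sum.distrib)
      (simp only: diff_add_eq add_diff_eq diff_diff_eq2 add.commute add.left_commute)
  also have "(\<Sum>k\<in>{1..2*n}. sp (\<psi> k t) (g t) *\<^sub>R \<phi> k t) = g t" by (rule phi_expand[symmetric])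
  finally show ?thesis .
qed

text \<open>At \<open>t = 0\<close> the sums combine to multiples of \<open>\<phi> (n+1) 0\<close> and of
  \<open>\<phi> j 0 + R (\<phi> j 0)\<close>, which lie in \<open>Fix R\<close>, and of
  \<open>\<phi> (n+2) 0\<close>, which lies in \<open>Fix (-R)\<close>. The coefficient of the
  last vector is thus the only obstruction.\<close>

lemma green_0_Fix:
  assumes L: "psi_integral (n+2) g = 0"
  shows "R (green g 0) = green g 0"
proof -
  have "psi_primitive k g 0 = 0" for k by (simp add: psi_primitive_def)
  then have c0: "(\<Sum>k\<in>{1..2*n}. psi_primitive k g 0 *\<^sub>R \<phi> k 0) = 0" by simp
  have split: "{n+1..2*n} = {n+1, n+2} \<union> (\<lambda>j. n + j) ` {3..n}"
  proof -
    have "(\<lambda>j. n + j) ` {3..n} = {n+3..2*n}" by (simp add: image_add_atLeastAtMost mult_2)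
    then show ?thesis using n2 by auto
  qed
  have "(\<Sum>k\<in>{n+1..2*n}. psi_integral k g *\<^sub>R \<phi> k 0)
      = (\<Sum>k\<in>{n+1, n+2}. psi_integral k g *\<^sub>R \<phi> k 0) + (\<Sum>k\<in>(\<lambda>j. n + j) ` {3..n}. psi_integral k g *\<^sub>R \<phi> k 0)"
    unfolding split by (rule sum.union_disjoint) auto
  also have "(\<Sum>k\<in>(\<lambda>j. n + j) ` {3..n}. psi_integral k g *\<^sub>R \<phi> k 0) = (\<Sum>j\<in>{3..n}. psi_integral (n+j) g *\<^sub>R \<phi> (n+j) 0)"
    by (subst sum.reindex) (auto simp: inj_on_def)
  also have "(\<Sum>k\<in>{n+1, n+2}. psi_integral k g *\<^sub>R \<phi> k 0) = psi_integral (n+1) g *\<^sub>R \<phi> (n+1) 0"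
    using L by simp
  finally have "(\<Sum>k\<in>{n+1..2*n}. psi_integral k g *\<^sub>R \<phi> k 0)
     = psi_integral (n+1) g *\<^sub>R \<phi> (n+1) 0 + (\<Sum>j\<in>{3..n}. psi_integral (n+j) g *\<^sub>R \<phi> (n+j) 0)" .
  then have e: "green g 0 = - (\<Sum>j\<in>{3..n}. psi_integral (n+j) g *\<^sub>R \<phi> j 0) - (psi_integral (n+1) g *\<^sub>R \<phi> (n+1) 0
      + (\<Sum>j\<in>{3..n}. psi_integral (n+j) g *\<^sub>R \<phi> (n+j) 0))"
    unfolding green_def c0 by simp
  have 1: "(\<Sum>j\<in>{3..n}. psi_integral (n+j) g *\<^sub>R R (\<phi> j 0)) = (\<Sum>j\<in>{3..n}. psi_integral (n+j) g *\<^sub>R \<phi> (n+j) 0)"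
    using phij_rev[of _ 0] by (intro sum.cong) auto
  have 2: "(\<Sum>j\<in>{3..n}. psi_integral (n+j) g *\<^sub>R R (\<phi> (n+j) 0)) = (\<Sum>j\<in>{3..n}. psi_integral (n+j) g *\<^sub>R \<phi> j 0)"
    using phinj_rev[of _ 0] by (intro sum.cong) auto
  show ?thesis
    unfolding e using phin1_rev[of 0] by (simp add: R_simps 1 2)
qed

end

section \<open>The rescaled remainder of the vector field\<close>

context homoclinic_setting
begin

lemma DF_cont:
  assumes "continuous_on T z" "continuous_on T v"
  shows "continuous_on T (\<lambda>t. DF (z t) (v t))"
proof -
  have "continuous_on T (\<lambda>t. \<Sum>b\<in>Basis. (v t \<bullet> b) *\<^sub>R DF (z t) b)"
    by (intro continuous_on_sum continuous_on_scaleR continuous_on_inner continuous_on_const assms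
        continuous_on_compose2[OF analytic_continuous[OF analytic_partial[OF analytic]] assms(1)]) auto
  then show ?thesis
    by (subst frechet_derivative_expand[OF analytic_differentiable[OF analytic]])
qed

lemma D2F_cont:
  assumes "continuous_on T z" "continuous_on T u" "continuous_on T v"
  shows "continuous_on T (\<lambda>t. D2F (z t) (u t) (v t))"
proof -
  have cont: "continuous_on T (\<lambda>t. \<Sum>b\<in>Basis. (u t \<bullet> b) *\<^sub>R (\<Sum>b'\<in>Basis. (v t \<bullet> b') *\<^sub>R D2F (z t) b b'))"
    by (intro continuous_on_sum continuous_on_scaleR continuous_on_inner continuous_on_const assms
        continuous_on_compose2[OF analytic_derivative2_continuous[OF analytic] assms(1)]) auto
  have "D2F z u v = (\<Sum>b\<in>Basis. (u \<bullet> b) *\<^sub>R (\<Sum>b'\<in>Basis. (v \<bullet> b') *\<^sub>R D2F z b b'))" for z u v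
    unfolding frechet_derivative2_expand[OF analytic, of u]
    by (subst frechet_derivative_expand[OF analytic_derivative_differentiable[OF analytic]]) (rule refl)
  then show ?thesis by (intro continuous_on_eq[OF cont]) (rule sym)
qed

lemma F_cont: "continuous_on T z \<Longrightarrow> continuous_on T (\<lambda>t. F (z t))"
  by (rule continuous_on_compose2[OF analytic_continuous[OF analytic]]) auto

lemma lin_D2F_left: "D2F z (a *\<^sub>R u) v = a *\<^sub>R D2F z u v"
  by (subst (1 2) frechet_derivative2_expand[OF analytic]) (simp add: scaleR_sum_right)

text \<open>The remainder of \<open>F\<close> at \<open>z + \<alpha> p + \<alpha>\<^sup>2 q\<close> with
  \<open>q = q0 + s p + \<alpha> Y\<close>, after removal of all terms up to order
  \<open>\<alpha>\<^sup>2\<close> and of the third order term that is linear in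
  \<open>s\<close>. It is of order \<open>\<alpha>\<^sup>3\<close>, but \<open>s\<close> and
  \<open>Y\<close> influence it only in order \<open>\<alpha>\<^sup>4\<close>.\<close>

definition "vf_rem z \<alpha> p q0 s Y =
   (let q = q0 + s *\<^sub>R p + \<alpha> *\<^sub>R Y in
    F (z + \<alpha> *\<^sub>R p + \<alpha>\<^sup>2 *\<^sub>R q) - F z - \<alpha> *\<^sub>R DF z p - \<alpha>\<^sup>2 *\<^sub>R DF z q
      - (\<alpha>\<^sup>2 / 2) *\<^sub>R D2F z p p - (\<alpha> ^ 3 * s) *\<^sub>R D2F z p p)"

lemma vf_rem_base:
  "\<exists>G\<ge>0. \<exists>\<epsilon>>0. \<forall>z \<alpha> p q0. norm z \<le> xh_bound \<longrightarrow> norm p \<le> P \<longrightarrow> norm q0 \<le> Q \<longrightarrow> \<bar>\<alpha>\<bar> \<le> \<epsilon> \<longrightarrow>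
     norm (vf_rem z \<alpha> p q0 0 0) \<le> G * \<bar>\<alpha>\<bar> ^ 3"
proof -
  define \<rho> where "\<rho> = \<bar>xh_bound\<bar> + \<bar>P\<bar> + \<bar>Q\<bar>"
  obtain C1 where C1: "C1 \<ge> 0" "\<And>x p. x \<in> cball 0 \<rho> \<Longrightarrow> x + p \<in> cball 0 \<rho> \<Longrightarrow>
     norm (F (x + p) - F x - DF x p - (1 / 2) *\<^sub>R D2F x p p) \<le> C1 * norm p ^ 3"
    using analytic_taylor2[OF analytic, of \<rho>] by blast
  obtain C2 where C2: "C2 \<ge> 0" "\<And>x p. x \<in> cball 0 \<rho> \<Longrightarrow> x + p \<in> cball 0 \<rho> \<Longrightarrow>
     norm (F (x + p) - F x - DF x p) \<le> C2 * norm p ^ 2"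
    using analytic_taylor1[OF analytic, of \<rho>] by blast
  obtain C3 where C3: "C3 \<ge> 0" "\<And>x y h. x \<in> cball 0 \<rho> \<Longrightarrow> y \<in> cball 0 \<rho> \<Longrightarrow>
     norm (DF x h - DF y h) \<le> C3 * norm (x - y) * norm h"
    using analytic_derivative_lipschitz[OF analytic, of \<rho>] by blast
  define G where "G = C1 * \<bar>P\<bar> ^ 3 + C2 * \<bar>Q\<bar>\<^sup>2 + C3 * \<bar>P\<bar> * \<bar>Q\<bar>"
  have "norm (vf_rem z \<alpha> p q0 0 0) \<le> G * \<bar>\<alpha>\<bar> ^ 3"
    if z: "norm z \<le> xh_bound" and p: "norm p \<le> P" and q: "norm q0 \<le> Q" and \<alpha>: "\<bar>\<alpha>\<bar> \<le> 1" for z \<alpha> p q0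
  proof -
    let ?E1 = "F (z + \<alpha> *\<^sub>R p) - F z - DF z (\<alpha> *\<^sub>R p) - (1 / 2) *\<^sub>R D2F z (\<alpha> *\<^sub>R p) (\<alpha> *\<^sub>R p)"
    let ?E2 = "F (z + \<alpha> *\<^sub>R p + \<alpha>\<^sup>2 *\<^sub>R q0) - F (z + \<alpha> *\<^sub>R p) - DF (z + \<alpha> *\<^sub>R p) (\<alpha>\<^sup>2 *\<^sub>R q0)"
    let ?E3 = "DF (z + \<alpha> *\<^sub>R p) (\<alpha>\<^sup>2 *\<^sub>R q0) - DF z (\<alpha>\<^sup>2 *\<^sub>R q0)"
    have nn: "xh_bound \<ge> 0" "P \<ge> 0" "Q \<ge> 0" using z p q norm_ge_zero order_trans by blast+
    have \<alpha>2: "\<bar>\<alpha>\<bar>\<^sup>2 \<le> 1" using \<alpha> by (simp add: abs_square_le_1)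
    have \<alpha>43: "\<bar>\<alpha>\<bar> ^ 4 \<le> \<bar>\<alpha>\<bar> ^ 3" using \<alpha> by (intro power_decreasing) auto
    have np: "norm (\<alpha> *\<^sub>R p) \<le> \<bar>\<alpha>\<bar> * P" using p by (simp add: mult_left_mono)
    have nq: "norm (\<alpha>\<^sup>2 *\<^sub>R q0) \<le> \<bar>\<alpha>\<bar>\<^sup>2 * Q" using q by (simp add: mult_left_mono)
    have np1: "norm (\<alpha> *\<^sub>R p) \<le> P" using np mult_right_mono[OF \<alpha> nn(2)] by simp
    have nq1: "norm (\<alpha>\<^sup>2 *\<^sub>R q0) \<le> Q" using nq mult_right_mono[OF \<alpha>2 nn(3)] by simp
    have b0: "z \<in> cball 0 \<rho>" using z nn by (simp add: \<rho>_def mem_cball_0 del: mem_cball)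
    have b1: "z + \<alpha> *\<^sub>R p \<in> cball 0 \<rho>"
      using norm_triangle_ineq[of z "\<alpha> *\<^sub>R p"] z np1 nn by (simp add: \<rho>_def mem_cball_0 del: mem_cball)
    have b2: "z + \<alpha> *\<^sub>R p + \<alpha>\<^sup>2 *\<^sub>R q0 \<in> cball 0 \<rho>"
      using norm_triangle_ineq[of "z + \<alpha> *\<^sub>R p" "\<alpha>\<^sup>2 *\<^sub>R q0"] norm_triangle_ineq[of z "\<alpha> *\<^sub>R p"] z np1 nq1 nn
      by (simp add: \<rho>_def mem_cball_0 del: mem_cball)
    have e: "vf_rem z \<alpha> p q0 0 0 =
        ?E1
      + ?E2
      + ?E3"
    proof -
      have "D2F z (\<alpha> *\<^sub>R p) (\<alpha> *\<^sub>R p) = \<alpha>\<^sup>2 *\<^sub>R D2F z p p"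
        by (simp only: lin_D2F_left linear_scale[OF lin_D2F] scaleR_scaleR power2_eq_square)
      then show ?thesis
        unfolding vf_rem_def Let_def linear_scale[OF lin_DF] by simp
    qed
    have "norm ?E1
        \<le> C1 * norm (\<alpha> *\<^sub>R p) ^ 3" by (rule C1(2)[OF b0 b1])
    also have "\<dots> \<le> C1 * (\<bar>\<alpha>\<bar> * P) ^ 3" using C1(1) np by (intro mult_left_mono power_mono) auto
    finally have 1: "norm ?E1
        \<le> C1 * \<bar>P\<bar> ^ 3 * \<bar>\<alpha>\<bar> ^ 3" using nn by (simp add: power_mult_distrib mult_ac)
    have "norm ?E2
        \<le> C2 * norm (\<alpha>\<^sup>2 *\<^sub>R q0) ^ 2" by (rule C2(2)[OF b1 b2])
    also have "\<dots> \<le> C2 * (\<bar>\<alpha>\<bar>\<^sup>2 * Q) ^ 2" using C2(1) nq by (intro mult_left_mono power_mono) auto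
    also have "\<dots> = C2 * Q\<^sup>2 * \<bar>\<alpha>\<bar> ^ 4" by (simp add: power_mult_distrib mult_ac)
    also have "\<dots> \<le> C2 * Q\<^sup>2 * \<bar>\<alpha>\<bar> ^ 3" using \<alpha>43 C2(1) by (intro mult_left_mono) auto
    finally have 2: "norm ?E2
        \<le> C2 * \<bar>Q\<bar>\<^sup>2 * \<bar>\<alpha>\<bar> ^ 3" by simp
    have "norm ?E3 \<le> C3 * norm (z + \<alpha> *\<^sub>R p - z) * norm (\<alpha>\<^sup>2 *\<^sub>R q0)"
      by (rule C3(2)[OF b1 b0])
    also have "\<dots> \<le> C3 * (\<bar>\<alpha>\<bar> * P) * (\<bar>\<alpha>\<bar>\<^sup>2 * Q)"
      using C3(1) np nq nn by (intro mult_mono mult_left_mono) auto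
    finally have 3: "norm ?E3 \<le> C3 * \<bar>P\<bar> * \<bar>Q\<bar> * \<bar>\<alpha>\<bar> ^ 3"
      using nn by (simp add: power2_eq_square power3_eq_cube mult_ac)
    have "norm (vf_rem z \<alpha> p q0 0 0) \<le> C1 * \<bar>P\<bar> ^ 3 * \<bar>\<alpha>\<bar> ^ 3 + C2 * \<bar>Q\<bar>\<^sup>2 * \<bar>\<alpha>\<bar> ^ 3 + C3 * \<bar>P\<bar> * \<bar>Q\<bar> * \<bar>\<alpha>\<bar> ^ 3"
      unfolding e by (intro norm_triangle_le add_mono 1 2 3)
    then show ?thesis by (simp only: G_def distrib_right)
  qed
  moreover have "G \<ge> 0" unfolding G_def using C1 C2 C3 by simp
  ultimately show ?thesis by (intro exI[of _ G] conjI exI[of _ 1]) auto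
qed

text \<open>Put \<open>z1 = z + \<alpha> p\<close>. The dependence on \<open>q\<close> enters through
  \<open>F (z1 + \<alpha>\<^sup>2 q) - DF z1 (\<alpha>\<^sup>2 q)\<close>, whose derivative in
  \<open>q\<close> has order \<open>\<alpha>\<^sup>4\<close>, and through
  \<open>\<alpha>\<^sup>2 (DF z1 - DF z) q\<close>. In the latter, the contribution of
  \<open>\<alpha> Y\<close> has order \<open>\<alpha>\<^sup>4\<close>, and the one of \<open>s
  p\<close> is \<open>\<alpha>\<^sup>3 s D2F z p p\<close>, which the definition subtracts, up
  to order \<open>\<alpha>\<^sup>4\<close>.\<close>

lemma vf_rem_lipschitz:
  "\<exists>K\<ge>0. \<exists>\<epsilon>>0. \<forall>z \<alpha> p q0 s Y s' Y'. norm z \<le> xh_bound \<longrightarrow> norm p \<le> P \<longrightarrow> norm q0 \<le> Q \<longrightarrow> \<bar>\<alpha>\<bar> \<le> \<epsilon> \<longrightarrow>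
     \<bar>s\<bar> \<le> r \<longrightarrow> norm Y \<le> r \<longrightarrow> \<bar>s'\<bar> \<le> r \<longrightarrow> norm Y' \<le> r \<longrightarrow>
     norm (vf_rem z \<alpha> p q0 s Y - vf_rem z \<alpha> p q0 s' Y') \<le> K * \<bar>\<alpha>\<bar> ^ 4 * (\<bar>s - s'\<bar> + norm (Y - Y'))"
proof -
  define W where "W = \<bar>Q\<bar> + \<bar>r\<bar> * \<bar>P\<bar> + \<bar>r\<bar>"
  define \<rho> where "\<rho> = \<bar>xh_bound\<bar> + \<bar>P\<bar> + W"
  obtain C3 where C3: "C3 \<ge> 0" "\<And>x y h. x \<in> cball 0 \<rho> \<Longrightarrow> y \<in> cball 0 \<rho> \<Longrightarrow>
     norm (DF x h - DF y h) \<le> C3 * norm (x - y) * norm h"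
    using analytic_derivative_lipschitz[OF analytic, of \<rho>] by blast
  obtain C4 where C4: "C4 \<ge> 0" "\<And>x p h. x \<in> cball 0 \<rho> \<Longrightarrow> x + p \<in> cball 0 \<rho> \<Longrightarrow>
     norm (DF (x + p) h - DF x h - D2F x h p) \<le> C4 * norm p ^ 2 * norm h"
    using analytic_derivative_taylor1[OF analytic, of \<rho>] by blast
  define K where "K = C3 * W * (\<bar>P\<bar> + 1) + C4 * \<bar>P\<bar> ^ 3 + C3 * \<bar>P\<bar>"
  have "norm (vf_rem z \<alpha> p q0 s Y - vf_rem z \<alpha> p q0 s' Y') \<le> K * \<bar>\<alpha>\<bar> ^ 4 * (\<bar>s - s'\<bar> + norm (Y - Y'))"
    if z: "norm z \<le> xh_bound" and p: "norm p \<le> P" and q0: "norm q0 \<le> Q" and \<alpha>: "\<bar>\<alpha>\<bar> \<le> 1"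
      and s: "\<bar>s\<bar> \<le> r" "\<bar>s'\<bar> \<le> r" and Y: "norm Y \<le> r" "norm Y' \<le> r" for z \<alpha> p q0 s Y s' Y'
  proof -
    have nn: "xh_bound \<ge> 0" "P \<ge> 0" "Q \<ge> 0" "r \<ge> 0" using z p q0 Y norm_ge_zero order_trans by blast+
    have W0: "W \<ge> 0" using nn by (simp add: W_def)
    have \<alpha>2: "\<alpha>\<^sup>2 \<le> 1" using \<alpha> by (simp add: abs_square_le_1)
    define q where "q = q0 + s *\<^sub>R p + \<alpha> *\<^sub>R Y"
    define q' where "q' = q0 + s' *\<^sub>R p + \<alpha> *\<^sub>R Y'"
    define d where "d = \<bar>s - s'\<bar> + norm (Y - Y')"
    have qW: "norm (q0 + s *\<^sub>R p + \<alpha> *\<^sub>R Y) \<le> W" if "\<bar>s\<bar> \<le> r" "norm Y \<le> r" for s Y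
    proof -
      have "norm (s *\<^sub>R p) \<le> r * P" using that p nn by (simp add: mult_mono)
      moreover have "norm (\<alpha> *\<^sub>R Y) \<le> 1 * r" using that \<alpha> unfolding norm_scaleR by (intro mult_mono) auto
      ultimately show ?thesis
        using q0 nn unfolding W_def by (intro norm_triangle_le) (simp, intro add_mono norm_triangle_le, simp_all)
    qed
    have qs: "norm q \<le> W" "norm q' \<le> W" unfolding q_def q'_def using s Y by (auto intro: qW)
    have qq: "q - q' = (s - s') *\<^sub>R p + \<alpha> *\<^sub>R (Y - Y')" by (simp add: q_def q'_def algebra_simps)
    have nqq: "norm (q - q') \<le> (P + 1) * d"
    proof -
      have "norm (q - q') \<le> \<bar>s - s'\<bar> * P + 1 * norm (Y - Y')"
        unfolding qq using p mult_right_mono[OF \<alpha> norm_ge_zero[of "Y - Y'"]]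
        by (intro norm_triangle_le add_mono) (auto intro: mult_left_mono)
      also have "\<dots> \<le> (P + 1) * d" using nn by (simp add: d_def algebra_simps)
      finally show ?thesis .
    qed
    let ?z1 = "z + \<alpha> *\<^sub>R p"
    let ?E1 = "F (?z1 + \<alpha>\<^sup>2 *\<^sub>R q) - F (?z1 + \<alpha>\<^sup>2 *\<^sub>R q') - DF ?z1 ((?z1 + \<alpha>\<^sup>2 *\<^sub>R q) - (?z1 + \<alpha>\<^sup>2 *\<^sub>R q'))"
    let ?E2 = "(\<alpha>\<^sup>2 * (s - s')) *\<^sub>R (DF ?z1 p - DF z p - D2F z p (\<alpha> *\<^sub>R p))"
    let ?E3 = "\<alpha> ^ 3 *\<^sub>R (DF ?z1 (Y - Y') - DF z (Y - Y'))"
    have np: "norm (\<alpha> *\<^sub>R p) \<le> \<bar>\<alpha>\<bar> * P" using p by (simp add: mult_left_mono)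
    have np1: "norm (\<alpha> *\<^sub>R p) \<le> P" using np mult_right_mono[OF \<alpha> nn(2)] by simp
    have b0: "z \<in> cball 0 \<rho>" using z nn W0 by (simp add: \<rho>_def mem_cball_0 del: mem_cball)
    have nz1: "norm ?z1 \<le> xh_bound + P" using norm_triangle_ineq[of z "\<alpha> *\<^sub>R p"] z np1 by linarith
    have b1: "?z1 \<in> cball 0 \<rho>" using nz1 nn W0 by (simp add: \<rho>_def mem_cball_0 del: mem_cball)
    have bq: "?z1 + \<alpha>\<^sup>2 *\<^sub>R v \<in> cball 0 \<rho>" if "norm v \<le> W" for v
    proof -
      have "norm (\<alpha>\<^sup>2 *\<^sub>R v) \<le> 1 * W" unfolding norm_scaleR using \<alpha>2 that W0 by (intro mult_mono) auto
      then show ?thesis using norm_triangle_ineq[of ?z1 "\<alpha>\<^sup>2 *\<^sub>R v"] nz1 nn by (simp add: \<rho>_def mem_cball_0 del: mem_cball)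
    qed
    have e: "vf_rem z \<alpha> p q0 s Y - vf_rem z \<alpha> p q0 s' Y' =
        ?E1
      + (\<alpha>\<^sup>2 * (s - s')) *\<^sub>R (DF ?z1 p - DF z p - D2F z p (\<alpha> *\<^sub>R p))
      + \<alpha> ^ 3 *\<^sub>R (DF ?z1 (Y - Y') - DF z (Y - Y'))"
    proof -
      have "DF w (q - q') = (s - s') *\<^sub>R DF w p + \<alpha> *\<^sub>R DF w (Y - Y')" for w
        unfolding qq by (simp only: linear_add[OF lin_DF] linear_scale[OF lin_DF])
      then have D: "DF w q = DF w q' + (s - s') *\<^sub>R DF w p + \<alpha> *\<^sub>R DF w (Y - Y')" for w
        by (simp add: linear_diff[OF lin_DF] algebra_simps)
      have d: "(?z1 + \<alpha>\<^sup>2 *\<^sub>R q) - (?z1 + \<alpha>\<^sup>2 *\<^sub>R q') = \<alpha>\<^sup>2 *\<^sub>R (q - q')" by (simp add: scaleR_diff_right)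
      show ?thesis
        unfolding vf_rem_def Let_def q_def[symmetric] q'_def[symmetric] d linear_scale[OF lin_DF] linear_scale[OF lin_D2F]
          linear_diff[OF lin_DF, of _ q q'] D
        by (simp add: algebra_simps power2_eq_square power3_eq_cube)
    qed
    have 1: "norm ?E1
       \<le> (C3 * W * (P + 1)) * \<bar>\<alpha>\<bar> ^ 4 * d"
    proof -
      let ?S = "cball ?z1 (\<alpha>\<^sup>2 * W)"
      have sub: "?S \<subseteq> cball 0 \<rho>"
      proof
        fix v assume "v \<in> ?S"
        then have "norm (v - ?z1) \<le> \<alpha>\<^sup>2 * W" by (simp add: dist_norm norm_minus_commute)
        moreover have "\<alpha>\<^sup>2 * W \<le> W" using \<alpha>2 W0 mult_right_mono by fastforce
        ultimately show "v \<in> cball 0 \<rho>"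
          using norm_triangle_ineq[of ?z1 "v - ?z1"] nz1 nn by (simp add: \<rho>_def mem_cball_0 del: mem_cball)
      qed
      have inS: "?z1 + \<alpha>\<^sup>2 *\<^sub>R v \<in> ?S" if "norm v \<le> W" for v
        using that by (simp add: dist_norm mult_left_mono)
      have "norm ?E1
          \<le> norm ((?z1 + \<alpha>\<^sup>2 *\<^sub>R q) - (?z1 + \<alpha>\<^sup>2 *\<^sub>R q')) * (C3 * (\<alpha>\<^sup>2 * W))"
      proof (rule differentiable_bound_linearization[where S = ?S and f' = "\<lambda>w. DF w"])
        show "(?z1 + \<alpha>\<^sup>2 *\<^sub>R q') + t *\<^sub>R ((?z1 + \<alpha>\<^sup>2 *\<^sub>R q) - (?z1 + \<alpha>\<^sup>2 *\<^sub>R q')) \<in> ?S" if "t \<in> {0..1}" for t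
        proof -
          have "closed_segment (?z1 + \<alpha>\<^sup>2 *\<^sub>R q') (?z1 + \<alpha>\<^sup>2 *\<^sub>R q) \<subseteq> ?S"
            by (intro closed_segment_subset inS qs) auto
          moreover have "(?z1 + \<alpha>\<^sup>2 *\<^sub>R q') + t *\<^sub>R ((?z1 + \<alpha>\<^sup>2 *\<^sub>R q) - (?z1 + \<alpha>\<^sup>2 *\<^sub>R q'))
             \<in> closed_segment (?z1 + \<alpha>\<^sup>2 *\<^sub>R q') (?z1 + \<alpha>\<^sup>2 *\<^sub>R q)"
            unfolding in_segment using that by (intro exI[of _ t]) (simp add: algebra_simps)
          ultimately show ?thesis by blast
        qed
        show "(F has_derivative DF w) (at w within ?S)" for w by (rule has_derivative_at_withinI[OF F_der])
        show "onorm (DF w - DF ?z1) \<le> C3 * (\<alpha>\<^sup>2 * W)" if w: "w \<in> ?S" for w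
        proof (rule onorm_le)
          fix v
          have "norm (DF w v - DF ?z1 v) \<le> C3 * norm (w - ?z1) * norm v" using w sub b1 by (intro C3(2)) auto
          also have "\<dots> \<le> C3 * (\<alpha>\<^sup>2 * W) * norm v"
            using w C3(1) by (intro mult_right_mono mult_left_mono) (auto simp: dist_norm norm_minus_commute)
          finally show "norm ((DF w - DF ?z1) v) \<le> C3 * (\<alpha>\<^sup>2 * W) * norm v" by simp
        qed
        show "?z1 \<in> ?S" using W0 by simp
      qed
      also have "\<dots> = \<alpha>\<^sup>2 * norm (q - q') * (C3 * (\<alpha>\<^sup>2 * W))"
        by (simp add: scaleR_diff_right[symmetric])
      also have "\<dots> \<le> \<alpha>\<^sup>2 * ((P + 1) * d) * (C3 * (\<alpha>\<^sup>2 * W))"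
        using nqq C3(1) W0 by (intro mult_right_mono mult_left_mono) auto
      also have "\<dots> = (C3 * W * (P + 1)) * \<bar>\<alpha>\<bar> ^ 4 * d"
      proof -
        have "\<bar>\<alpha>\<bar> ^ 4 = \<alpha>\<^sup>2 * \<alpha>\<^sup>2" by (simp add: power_even_abs power2_eq_square power4_eq_xxxx mult.assoc)
        then show ?thesis by (simp add: mult_ac)
      qed
      finally show ?thesis .
    qed
    have "norm ?E2 \<le>
        (\<alpha>\<^sup>2 * \<bar>s - s'\<bar>) * (C4 * norm (\<alpha> *\<^sub>R p) ^ 2 * norm p)"
      using C4(2)[OF b0 b1, of p] by (simp add: abs_mult mult_left_mono)
    also have "\<dots> \<le> (\<alpha>\<^sup>2 * d) * (C4 * (\<bar>\<alpha>\<bar> * P) ^ 2 * P)"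
      using np p C4(1) by (intro mult_mono power_mono mult_left_mono) (auto simp: d_def)
    also have "\<dots> = C4 * P ^ 3 * \<bar>\<alpha>\<bar> ^ 4 * d"
    proof -
      have "\<bar>\<alpha>\<bar> ^ 4 = \<alpha>\<^sup>2 * \<alpha>\<^sup>2" by (simp add: power_even_abs power2_eq_square power4_eq_xxxx mult.assoc)
      then show ?thesis by (simp add: power_mult_distrib power3_eq_cube power2_eq_square[of P] mult_ac)
    qed
    finally have 2: "norm ?E2 \<le> C4 * P ^ 3 * \<bar>\<alpha>\<bar> ^ 4 * d" .
    have "norm ?E3 \<le> \<bar>\<alpha>\<bar> ^ 3 * (C3 * norm (?z1 - z) * norm (Y - Y'))"
      using C3(2)[OF b1 b0, of "Y - Y'"] by (simp add: power_abs mult_left_mono)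
    also have "\<dots> \<le> \<bar>\<alpha>\<bar> ^ 3 * (C3 * (\<bar>\<alpha>\<bar> * P) * d)"
      using np C3(1) nn by (intro mult_left_mono mult_mono) (auto simp: d_def)
    also have "\<dots> = C3 * P * \<bar>\<alpha>\<bar> ^ 4 * d" by (simp add: power4_eq_xxxx power3_eq_cube mult_ac)
    finally have 3: "norm ?E3 \<le> C3 * P * \<bar>\<alpha>\<bar> ^ 4 * d" .
    have "norm (vf_rem z \<alpha> p q0 s Y - vf_rem z \<alpha> p q0 s' Y')
       \<le> (C3 * W * (P + 1)) * \<bar>\<alpha>\<bar> ^ 4 * d + C4 * P ^ 3 * \<bar>\<alpha>\<bar> ^ 4 * d + C3 * P * \<bar>\<alpha>\<bar> ^ 4 * d"
      unfolding e by (intro norm_triangle_le add_mono 1 2 3)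
    also have "\<dots> = K * \<bar>\<alpha>\<bar> ^ 4 * d" using nn by (simp add: K_def distrib_right)
    finally show ?thesis by (simp add: d_def)
  qed
  moreover have "K \<ge> 0" unfolding K_def W_def using C3 C4 by simp
  ultimately show ?thesis by (intro exI[of _ K] conjI exI[of _ 1]) auto
qed


section \<open>Reversibility and reduction to the half line\<close>

definition "param_forcing t = Dmu f (xh t) 0"
definition "quad_forcing t = Dxx f (xh t) 0 (\<phi> 2 t) (\<phi> 2 t)"

lemma xh_rev: "xh (- t) = R (xh t)"
  using xh_sym[of "- t"] by simp

lemma psi_rev': "\<psi> (n+2) (- t) = - R (\<psi> (n+2) t)"
  using psi_rev[of t] by simp

text \<open>The signs in the reversal rules for \<open>\<psi> (n+2)\<close> and for the forcing cancel.\<close>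

lemma param_forcing_even: "sp (\<psi> (n+2) (- t)) (param_forcing (- t)) = sp (\<psi> (n+2) t) (param_forcing t)"
  unfolding param_forcing_def psi_rev' xh_rev Dmu_R by (simp only: sp_simps sp_R minus_minus)

lemma quad_forcing_even: "sp (\<psi> (n+2) (- t)) (quad_forcing (- t)) = sp (\<psi> (n+2) t) (quad_forcing t)"
  unfolding quad_forcing_def psi_rev' xh_rev phi2_rev[symmetric] Dxx_R by (simp only: sp_simps sp_R minus_minus)

lemma R_norm_ex: "\<exists>C>0. \<forall>x. norm (R x) \<le> C * norm x"
  using bounded_linear.pos_bounded[OF bounded_linear_R] by (metis mult.commute)

text \<open>A half orbit that starts in \<open>Fix R\<close> is continued by its own mirror image. The two
  pieces fit together at \<open>t = 0\<close> because \<open>f\<close> anticommutes with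
  \<open>R\<close>.\<close>

lemma symmetric_extension:
  assumes der: "\<And>t. t \<ge> 0 \<Longrightarrow> (x has_vector_derivative f (x t) \<mu>) (at t within {0..})"
    and x0: "R (x 0) = x 0" and lim: "(x \<longlongrightarrow> 0) at_top" and nz: "t0 \<ge> 0" "x t0 \<noteq> 0"
  defines "Z \<equiv> (\<lambda>t. if t \<ge> 0 then x t else R (x (- t)))"
  shows "homoclinic_to_origin f \<mu> Z" "symmetric_orbit R Z" "Z 0 \<in> Fix R"
proof -
  show Zsym: "symmetric_orbit R Z"
    unfolding symmetric_orbit_def Z_def using x0 by (auto simp: RR)
  show "Z 0 \<in> Fix R" using x0 by (simp add: Z_def Fix_def)
  have right: "(Z has_vector_derivative f (Z t) \<mu>) (at t within {0..})" if "t \<ge> 0" for t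
  proof (rule has_vector_derivative_transform[of t _ Z x])
    show "(x has_vector_derivative f (Z t) \<mu>) (at t within {0..})"
      using der[OF that] that by (simp add: Z_def)
  qed (use that in \<open>auto simp: Z_def\<close>)
  have left: "(Z has_vector_derivative f (Z t) \<mu>) (at t within {..0})" if t: "t \<le> 0" for t
  proof -
    have im: "uminus ` {..0::real} = {0..}" by auto
    have "(x has_vector_derivative f (x (- t)) \<mu>) (at (- t) within uminus ` {..0})"
      unfolding im using t by (intro der) auto
    from vector_diff_chain_within[OF uminus_vector_derivative this]
    have "((\<lambda>s. x (- s)) has_vector_derivative - f (x (- t)) \<mu>) (at t within {..0})" by (simp add: o_def)
    then have "((\<lambda>s. R (x (- s))) has_vector_derivative R (- f (x (- t)) \<mu>)) (at t within {..0})"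
      by (rule bounded_linear.has_vector_derivative[OF bounded_linear_R])
    moreover have "R (- f (x (- t)) \<mu>) = f (Z t) \<mu>"
    proof -
      have "Z t = R (x (- t))" using t x0 by (auto simp: Z_def)
      then show ?thesis by (simp add: fR R_simps)
    qed
    ultimately have d: "((\<lambda>s. R (x (- s))) has_vector_derivative f (Z t) \<mu>) (at t within {..0})" by simp
    show ?thesis
      by (rule has_vector_derivative_transform[OF _ _ d]) (use t x0 in \<open>auto simp: Z_def\<close>)
  qed
  have sol: "(Z has_vector_derivative f (Z t) \<mu>) (at t)" for t
  proof -
    consider "t > 0" | "t < 0" | "t = 0" by linarith
    then show ?thesis
    proof cases
      case 1
      have "at t within {0..} = at t" using 1 by (intro at_within_interior) auto
      then show ?thesis using right[of t] 1 by simp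
    next
      case 2
      have "at t within {..0} = at t" using 2 by (intro at_within_interior) auto
      then show ?thesis using left[of t] 2 by simp
    next
      case 3
      have "(Z has_vector_derivative f (Z t) \<mu>) (at t within ({..0} \<union> {0..}))"
        using left[of t] right[of t] 3 unfolding has_vector_derivative_def
        by (simp add: has_derivative_within Lim_within_Un)
      moreover have "{..0} \<union> {0..} = (UNIV :: real set)" by auto
      ultimately show ?thesis by simp
    qed
  qed
  have top: "(Z \<longlongrightarrow> 0) at_top"
    by (rule Lim_transform_eventually[OF lim])
      (auto simp: Z_def eventually_at_top_linorder intro!: exI[of _ 0])
  have "((\<lambda>t. R (Z (- t))) \<longlongrightarrow> R 0) at_bot"
    by (intro bounded_linear.tendsto[OF bounded_linear_R] filterlim_compose[OF top filterlim_uminus_at_top_at_bot])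
  moreover have "R (Z (- t)) = Z t" for t using Zsym[unfolded symmetric_orbit_def, rule_format, of t] by (rule HOL.sym)
  ultimately have bot: "(Z \<longlongrightarrow> 0) at_bot" by (simp add: R_simps)
  have "\<exists>t. Z t \<noteq> 0" using nz by (intro exI[of _ t0]) (simp add: Z_def)
  then show "homoclinic_to_origin f \<mu> Z"
    unfolding homoclinic_to_origin_def solution_def using sol top bot by blast
qed

lemma vf_rem_cont:
  assumes "continuous_on T z" "continuous_on T p" "continuous_on T q0" "continuous_on T Y"
  shows "continuous_on T (\<lambda>t. vf_rem (z t) \<alpha> (p t) (q0 t) s (Y t))"
  unfolding vf_rem_def Let_def
  by (intro continuous_on_diff continuous_on_scaleR continuous_on_const F_cont DF_cont D2F_cont
      continuous_on_add assms)

end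

section \<open>The solvability condition\<close>

context homoclinic_lyapunov
begin

lemma even_psi_integral:
  assumes "\<And>t. sp (\<psi> (n+2) (- t)) (g (- t)) = sp (\<psi> (n+2) t) (g t)"
    and "(LINT t|lborel. sp (\<psi> (n+2) t) (g t)) \<noteq> 0"
  shows "(LINT t|lborel. sp (\<psi> (n+2) t) (g t)) = 2 * psi_integral (n+2) g"
  unfolding psi_integral_def by (rule even_integral[OF assms])

lemma phi2_bdd_forcing: "\<exists>P. bdd_forcing (\<phi> 2) P"
  using phi_stable_bounded[of 2 0] n2 phi_cont[of 2 "{0..}"] unfolding bdd_forcing_def by auto

lemma param_forcing_bdd_forcing: "\<exists>G. bdd_forcing param_forcing G"
proof -
  obtain C where C: "C \<ge> 0" "\<And>z h. z \<in> cball 0 xh_bound \<Longrightarrow> norm (DF z h) \<le> C * norm h"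
    using analytic_derivative_bounded[OF analytic, of xh_bound] by blast
  have "norm (param_forcing t) \<le> C" for t
    using C(2)[of "(xh t, 0)" "(0, 1)"] xh0_in[of 0 t] by (simp add: param_forcing_def Dmu_eq)
  moreover have "continuous_on {0..} param_forcing"
    unfolding param_forcing_def Dmu_eq by (intro DF_cont continuous_on_Pair xh_cont continuous_on_const)
  ultimately show ?thesis unfolding bdd_forcing_def by blast
qed

lemma quad_forcing_bdd_forcing: "\<exists>G. bdd_forcing quad_forcing G"
proof -
  obtain C where C: "C \<ge> 0" "\<And>z h p. z \<in> cball 0 xh_bound \<Longrightarrow> norm (D2F z h p) \<le> C * norm h * norm p"
    using analytic_derivative2_bounded[OF analytic, of xh_bound] by blast
  obtain P where P: "bdd_forcing (\<phi> 2) P" using phi2_bdd_forcing by blast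
  have "norm (quad_forcing t) \<le> C * P * P" if "t \<ge> 0" for t
  proof -
    have "norm (quad_forcing t) \<le> C * norm (\<phi> 2 t, 0::real) * norm (\<phi> 2 t, 0::real)"
      unfolding quad_forcing_def Dxx_eq using xh0_in[of 0 t] by (intro C) simp
    also have "\<dots> = C * norm (\<phi> 2 t) * norm (\<phi> 2 t)" by (simp add: norm_Pair)
    also have "\<dots> \<le> C * P * P" using bdd_forcingD(2)[OF P that] bdd_forcing_nonneg[OF P] C(1) by (intro mult_mono mult_nonneg_nonneg) auto
    finally show ?thesis .
  qed
  moreover have "continuous_on {0..} quad_forcing"
    unfolding quad_forcing_def Dxx_eq using n2
    by (intro D2F_cont continuous_on_Pair xh_cont phi_cont continuous_on_const) auto
  ultimately show ?thesis unfolding bdd_forcing_def by blast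
qed

lemma green_cont: "continuous_on {0..} g \<Longrightarrow> continuous_on {0..} (green g)"
  by (rule continuous_on_vector_derivative) (auto intro: green_der)

text \<open>The solvability condition selects the multiple of \<open>quad_forcing\<close> to be added to
  \<open>g\<close>; this is possible since its own integral, which is \<open>b2\<close>, does
  not vanish.\<close>

definition "multiplier g = - psi_integral (n+2) g / psi_integral (n+2) quad_forcing"
definition "solvable_part g = (\<lambda>t. 1 *\<^sub>R g t + multiplier g *\<^sub>R quad_forcing t)"

lemma solve_bound:
  "\<exists>\<kappa>\<ge>0. \<forall>g G. bdd_forcing g G \<longrightarrow> (\<exists>H. bdd_forcing (solvable_part g) H) \<and> \<bar>multiplier g\<bar> \<le> \<kappa> * G \<and> (\<forall>t\<ge>0. norm (green (solvable_part g) t) \<le> \<kappa> * G)"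
proof -
  obtain H where H: "bdd_forcing quad_forcing H" using quad_forcing_bdd_forcing by blast
  obtain CG where CG: "CG \<ge> 0" "\<And>g G t. bdd_forcing g G \<Longrightarrow> t \<ge> 0 \<Longrightarrow> norm (green g t) \<le> CG * G"
    using green_bound by blast
  define m where "m = psi_const / \<sigma> / \<bar>psi_integral (n+2) quad_forcing\<bar>"
  have m: "m \<ge> 0" using psi_const \<sigma> by (simp add: m_def)
  have H0: "H \<ge> 0" by (rule bdd_forcing_nonneg[OF H])
  define \<kappa>' where "\<kappa>' = m + CG * (1 + m * H)"
  have k: "m \<le> \<kappa>'" "CG * (1 + m * H) \<le> \<kappa>'" using m CG(1) H0 by (simp_all add: \<kappa>'_def)
  have "(\<exists>H. bdd_forcing (solvable_part g) H) \<and> \<bar>multiplier g\<bar> \<le> \<kappa>' * G \<and> (\<forall>t\<ge>0. norm (green (solvable_part g) t) \<le> \<kappa>' * G)"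
    if g: "bdd_forcing g G" for g G
  proof -
    have G0: "G \<ge> 0" by (rule bdd_forcing_nonneg[OF g])
    have "n + 2 \<in> {n+1..2*n}" using n2 by auto
    then have "\<bar>psi_integral (n+2) g\<bar> \<le> psi_const / \<sigma> * G" by (rule psi_integral_bound(2)[OF g])
    then have "\<bar>psi_integral (n+2) g\<bar> / \<bar>psi_integral (n+2) quad_forcing\<bar> \<le> (psi_const / \<sigma> * G) / \<bar>psi_integral (n+2) quad_forcing\<bar>"
      by (rule divide_right_mono) simp
    then have mult: "\<bar>multiplier g\<bar> \<le> m * G"
      by (simp add: multiplier_def m_def)
    have p: "bdd_forcing (solvable_part g) (\<bar>1\<bar> * G + \<bar>multiplier g\<bar> * H)"
      unfolding solvable_part_def by (rule bdd_forcing_comb[OF g H])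
    have "\<bar>1\<bar> * G + \<bar>multiplier g\<bar> * H \<le> (1 + m * H) * G"
      using mult_right_mono[OF mult H0] by (simp add: algebra_simps)
    then have "CG * (\<bar>1\<bar> * G + \<bar>multiplier g\<bar> * H) \<le> CG * ((1 + m * H) * G)"
      using CG(1) by (rule mult_left_mono)
    also have "\<dots> \<le> \<kappa>' * G" unfolding mult.assoc[symmetric] by (rule mult_right_mono[OF k(2) G0])
    finally have le: "CG * (\<bar>1\<bar> * G + \<bar>multiplier g\<bar> * H) \<le> \<kappa>' * G" .
    have "norm (green (solvable_part g) t) \<le> \<kappa>' * G" if "t \<ge> 0" for t
      using CG(2)[OF p that] le by linarith
    moreover have "\<bar>multiplier g\<bar> \<le> \<kappa>' * G" using mult mult_right_mono[OF k(1) G0] by linarith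
    ultimately show ?thesis using p by blast
  qed
  moreover have "\<kappa>' \<ge> 0" using m k by linarith
  ultimately show ?thesis by blast
qed

lemma multiplier_diff:
  assumes "bdd_forcing g G" "bdd_forcing g' G'"
  shows "multiplier (\<lambda>t. 1 *\<^sub>R g t + (-1) *\<^sub>R g' t) = multiplier g - multiplier g'"
  unfolding multiplier_def using psi_integral_comb[OF assms, of "n+2" 1 "-1"] n2
  by (simp add: diff_divide_distrib)

lemma green_solvable_part_diff:
  assumes g: "bdd_forcing g G" "bdd_forcing g' G'"
  shows "green (solvable_part (\<lambda>t. 1 *\<^sub>R g t + (-1) *\<^sub>R g' t)) t = green (solvable_part g) t - green (solvable_part g') t"
proof -
  obtain H H' where "bdd_forcing (solvable_part g) H" "bdd_forcing (solvable_part g') H'" using solve_bound g by blast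
  from green_comb[OF this, of 1 "-1"]
  have "green (\<lambda>t. 1 *\<^sub>R solvable_part g t + (-1) *\<^sub>R solvable_part g' t) t = green (solvable_part g) t - green (solvable_part g') t" by simp
  moreover have "(\<lambda>t. 1 *\<^sub>R solvable_part g t + (-1) *\<^sub>R solvable_part g' t) = solvable_part (\<lambda>t. 1 *\<^sub>R g t + (-1) *\<^sub>R g' t)"
    unfolding solvable_part_def multiplier_diff[OF g] by (simp add: fun_eq_iff scaleR_diff_left)
  ultimately show ?thesis by simp
qed

lemma psi_integral_solvable_part:
  assumes "bdd_forcing g G" "psi_integral (n+2) quad_forcing \<noteq> 0"
  shows "psi_integral (n+2) (solvable_part g) = 0"
proof -
  obtain H where H: "bdd_forcing quad_forcing H" using quad_forcing_bdd_forcing by blast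
  show ?thesis unfolding solvable_part_def using psi_integral_comb[OF assms(1) H, of "n+2" 1 "multiplier g"] n2 assms(2)
    by (simp add: multiplier_def)
qed


section \<open>The bifurcating family of symmetric homoclinic orbits\<close>

text \<open>The second order correction \<open>w0\<close> will be fixed by \<open>k\<close>; the unknowns
  \<open>s\<close> and \<open>y\<close> stay bounded as \<open>\<alpha>\<close> tends to
  \<open>0\<close>.\<close>

definition "ansatz w0 \<alpha> s y t = xh t + \<alpha> *\<^sub>R \<phi> 2 t + \<alpha>\<^sup>2 *\<^sub>R (w0 t + s *\<^sub>R \<phi> 2 t + \<alpha> *\<^sub>R y t)"

text \<open>The equation for \<open>w0\<close> collects the terms of order \<open>\<alpha>\<^sup>2\<close>,
  the one for \<open>y\<close> all that remains, divided by \<open>\<alpha>\<^sup>3\<close>.\<close>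

lemma ansatz_der:
  assumes w0: "\<And>t. t \<ge> 0 \<Longrightarrow> (w0 has_vector_derivative Dx f (xh t) 0 (w0 t) + (k *\<^sub>R param_forcing t + (1 / 2) *\<^sub>R quad_forcing t)) (at t within {0..})"
    and y: "\<And>t. t \<ge> 0 \<Longrightarrow> (y has_vector_derivative Dx f (xh t) 0 (y t) + (g t + s *\<^sub>R quad_forcing t)) (at t within {0..})"
    and g: "\<And>t. t \<ge> 0 \<Longrightarrow> \<alpha> ^ 3 *\<^sub>R g t = vf_rem (xh t, 0) \<alpha> (\<phi> 2 t, 0) (w0 t, k) s (y t, 0)"
    and t: "t \<ge> 0"
  shows "(ansatz w0 \<alpha> s y has_vector_derivative f (ansatz w0 \<alpha> s y t) (k * \<alpha>\<^sup>2)) (at t within {0..})"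
proof -
  let ?A = "Dx f (xh t) 0"
  let ?z = "(xh t, 0) :: (real^'m) \<times> real"
  let ?p = "(\<phi> 2 t, 0) :: (real^'m) \<times> real"
  let ?u = "w0 t + s *\<^sub>R \<phi> 2 t + \<alpha> *\<^sub>R y t"
  have q: "(w0 t, k) + s *\<^sub>R ?p + \<alpha> *\<^sub>R (y t, 0) = (?u, k)" by simp
  have arg: "?z + \<alpha> *\<^sub>R ?p + \<alpha>\<^sup>2 *\<^sub>R (?u, k) = (ansatz w0 \<alpha> s y t, k * \<alpha>\<^sup>2)"
    by (simp add: ansatz_def)
  have DFq: "DF ?z (?u, k) = ?A (w0 t) + s *\<^sub>R ?A (\<phi> 2 t) + \<alpha> *\<^sub>R ?A (y t) + k *\<^sub>R param_forcing t"
  proof -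
    have "(?u, k) = (?u, 0) + k *\<^sub>R (0, 1)" by simp
    then have "DF ?z (?u, k) = DF ?z ((?u, 0) + k *\<^sub>R (0, 1))" by (rule arg_cong)
    also have "\<dots> = ?A ?u + k *\<^sub>R param_forcing t"
      unfolding param_forcing_def Dmu_eq Dx_eq by (simp only: linear_add[OF lin_DF] linear_scale[OF lin_DF])
    finally show ?thesis by (simp only: linear_add[OF lin_Dx] linear_scale[OF lin_Dx])
  qed
  have "\<alpha> ^ 3 *\<^sub>R g t = f (ansatz w0 \<alpha> s y t) (k * \<alpha>\<^sup>2) - f (xh t) 0 - \<alpha> *\<^sub>R ?A (\<phi> 2 t)
      - \<alpha>\<^sup>2 *\<^sub>R (?A (w0 t) + s *\<^sub>R ?A (\<phi> 2 t) + \<alpha> *\<^sub>R ?A (y t) + k *\<^sub>R param_forcing t)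
      - (\<alpha>\<^sup>2 / 2) *\<^sub>R quad_forcing t - (\<alpha> ^ 3 * s) *\<^sub>R quad_forcing t"
    unfolding g[OF t] vf_rem_def Let_def q arg DFq quad_forcing_def Dxx_eq unfolding Dx_eq by simp
  then have eq: "f (ansatz w0 \<alpha> s y t) (k * \<alpha>\<^sup>2) = f (xh t) 0 + \<alpha> *\<^sub>R ?A (\<phi> 2 t)
      + \<alpha>\<^sup>2 *\<^sub>R ((?A (w0 t) + (k *\<^sub>R param_forcing t + (1 / 2) *\<^sub>R quad_forcing t)) + s *\<^sub>R ?A (\<phi> 2 t) + \<alpha> *\<^sub>R (?A (y t) + (g t + s *\<^sub>R quad_forcing t)))"
    by (simp add: algebra_simps power2_eq_square power3_eq_cube)
  have p: "(\<phi> 2 has_vector_derivative ?A (\<phi> 2 t)) (at t within {0..})"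
    using n2 by (intro has_vector_derivative_at_within[OF phi_der]) auto
  show ?thesis
    unfolding eq unfolding ansatz_def[abs_def]
    by (intro has_vector_derivative_add bounded_linear.has_vector_derivative[OF bounded_linear_scaleR_right]
        has_vector_derivative_at_within[OF xh_sol] p w0[OF t] y[OF t])
qed

text \<open>The unknown of the fixed point problem is the rescaled remainder \<open>g\<close>: it
  determines \<open>s\<close> through the solvability condition and then \<open>y\<close>
  through the Green operator, and these determine the remainder. By
  \<open>vf_rem_lipschitz\<close> the resulting map has a Lipschitz constant proportional to
  \<open>\<alpha>\<close>.\<close>

lemma correction_exists:
  assumes w0: "bdd_forcing w0 W" and b: "psi_integral (n+2) quad_forcing \<noteq> 0"
  shows "\<exists>\<epsilon>>0. \<exists>r. \<forall>\<alpha>. \<alpha> \<noteq> 0 \<longrightarrow> \<bar>\<alpha>\<bar> \<le> \<epsilon> \<longrightarrow> (\<exists>g G. bdd_forcing g G \<and> \<bar>multiplier g\<bar> \<le> r \<and> (\<forall>t\<ge>0. norm (green (solvable_part g) t) \<le> r) \<and>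
     (\<forall>t\<ge>0. \<alpha> ^ 3 *\<^sub>R g t = vf_rem (xh t, 0) \<alpha> (\<phi> 2 t, 0) (w0 t, k) (multiplier g) (green (solvable_part g) t, 0)))"
proof -
  obtain P where P: "bdd_forcing (\<phi> 2) P" using phi2_bdd_forcing by blast
  define Q where "Q = W + \<bar>k\<bar>"
  have zb: "norm (xh t, 0 :: real) \<le> xh_bound" for t using xh_bounded[of t] by (simp add: norm_Pair)
  have pb: "norm (\<phi> 2 t, 0 :: real) \<le> P" if "t \<ge> 0" for t using bdd_forcingD(2)[OF P that] by (simp add: norm_Pair)
  have qb: "norm (w0 t, k) \<le> Q" if "t \<ge> 0" for t
    using norm_Pair_le[of "w0 t" k] bdd_forcingD(2)[OF w0 that] by (simp add: Q_def)
  obtain G0 e1 where G0: "G0 \<ge> 0" "e1 > 0" "\<And>z \<alpha> p q0. norm z \<le> xh_bound \<Longrightarrow> norm p \<le> P \<Longrightarrow> norm q0 \<le> Q \<Longrightarrow> \<bar>\<alpha>\<bar> \<le> e1 \<Longrightarrow>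
     norm (vf_rem z \<alpha> p q0 0 0) \<le> G0 * \<bar>\<alpha>\<bar> ^ 3" using vf_rem_base[of P Q] by blast
  obtain \<kappa>' where \<kappa>': "\<kappa>' \<ge> 0" "\<And>g G. bdd_forcing g G \<Longrightarrow> \<exists>H. bdd_forcing (solvable_part g) H"
    "\<And>g G. bdd_forcing g G \<Longrightarrow> \<bar>multiplier g\<bar> \<le> \<kappa>' * G"
    "\<And>g G t. bdd_forcing g G \<Longrightarrow> t \<ge> 0 \<Longrightarrow> norm (green (solvable_part g) t) \<le> \<kappa>' * G" using solve_bound by metis
  define G where "G = G0 + 1"
  define r where "r = \<kappa>' * G"
  obtain K e2 where K: "K \<ge> 0" "e2 > 0" "\<And>z \<alpha> p q0 s Y s' Y'. norm z \<le> xh_bound \<Longrightarrow> norm p \<le> P \<Longrightarrow> norm q0 \<le> Q \<Longrightarrow> \<bar>\<alpha>\<bar> \<le> e2 \<Longrightarrow>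
     \<bar>s\<bar> \<le> r \<Longrightarrow> norm Y \<le> r \<Longrightarrow> \<bar>s'\<bar> \<le> r \<Longrightarrow> norm Y' \<le> r \<Longrightarrow>
     norm (vf_rem z \<alpha> p q0 s Y - vf_rem z \<alpha> p q0 s' Y') \<le> K * \<bar>\<alpha>\<bar> ^ 4 * (\<bar>s - s'\<bar> + norm (Y - Y'))"
    using vf_rem_lipschitz[of P Q r] by blast
  have G: "G \<ge> 1" using G0 by (simp add: G_def)
  have r: "r \<ge> 0" using \<kappa>' G by (simp add: r_def)
  \<comment> \<open>for \<open>\<bar>\<alpha>\<bar> \<le> 1 / D\<close> the ball of radius \<open>G\<close> is mapped into itself and the Lipschitz constant is at most \<open>1 / 2\<close>\<close>
  define D where "D = 4 * (K * r + K * \<kappa>' + 1)"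
  have D: "D > 0" unfolding D_def using K(1) r \<kappa>'(1) by (simp add: add_nonneg_pos)
  define \<epsilon> where "\<epsilon> = min (min e1 e2) (1 / D)"
  have \<epsilon>: "\<epsilon> > 0" using G0 K D by (simp add: \<epsilon>_def)
  have "\<exists>g G. bdd_forcing g G \<and> \<bar>multiplier g\<bar> \<le> r \<and> (\<forall>t\<ge>0. norm (green (solvable_part g) t) \<le> r) \<and>
     (\<forall>t\<ge>0. \<alpha> ^ 3 *\<^sub>R g t = vf_rem (xh t, 0) \<alpha> (\<phi> 2 t, 0) (w0 t, k) (multiplier g) (green (solvable_part g) t, 0))"
    if \<alpha>0: "\<alpha> \<noteq> 0" and \<alpha>: "\<bar>\<alpha>\<bar> \<le> \<epsilon>" for \<alpha>
  proof -
    have \<alpha>12: "\<bar>\<alpha>\<bar> \<le> e1" "\<bar>\<alpha>\<bar> \<le> e2" using \<alpha> by (simp_all add: \<epsilon>_def)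
    have \<alpha>D: "\<bar>\<alpha>\<bar> * D \<le> 1" using \<alpha> D by (simp add: \<epsilon>_def field_simps)
    have \<alpha>r: "\<bar>\<alpha>\<bar> * (K * r) \<le> 1 / 4" "\<bar>\<alpha>\<bar> * (K * \<kappa>') \<le> 1 / 4"
    proof -
      have "\<bar>\<alpha>\<bar> * D = 4 * (\<bar>\<alpha>\<bar> * (K * r + K * \<kappa>' + 1))" unfolding D_def by (rule mult.left_commute)
      then have "\<bar>\<alpha>\<bar> * (K * r + K * \<kappa>' + 1) \<le> 1 / 4" using \<alpha>D by linarith
      moreover have "0 \<le> \<bar>\<alpha>\<bar> * (K * r)" "0 \<le> \<bar>\<alpha>\<bar> * (K * \<kappa>')" using K r \<kappa>' by auto
      ultimately show "\<bar>\<alpha>\<bar> * (K * r) \<le> 1 / 4" "\<bar>\<alpha>\<bar> * (K * \<kappa>') \<le> 1 / 4"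
        unfolding distrib_left by linarith+
    qed
    have \<alpha>3: "\<bar>\<alpha>\<bar> ^ 3 > 0" using \<alpha>0 by simp
    have \<alpha>4: "\<bar>\<alpha>\<bar> ^ 4 = \<bar>\<alpha>\<bar> ^ 3 * \<bar>\<alpha>\<bar>" by (simp add: power4_eq_xxxx power3_eq_cube)
    define N where "N s Y t = (1 / \<alpha> ^ 3) *\<^sub>R vf_rem (xh t, 0) \<alpha> (\<phi> 2 t, 0) (w0 t, k) s (Y, 0)" for s Y t
    have N_diff: "norm (N s Y t - N s' Y' t) \<le> K * \<bar>\<alpha>\<bar> * (\<bar>s - s'\<bar> + norm (Y - Y'))"
      if "t \<ge> 0" "\<bar>s\<bar> \<le> r" "norm Y \<le> r" "\<bar>s'\<bar> \<le> r" "norm Y' \<le> r" for s Y s' Y' t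
    proof -
      let ?v = "\<lambda>s Y. vf_rem (xh t, 0) \<alpha> (\<phi> 2 t, 0) (w0 t, k) s (Y, 0)"
      have "norm (?v s Y - ?v s' Y') \<le> K * \<bar>\<alpha>\<bar> ^ 4 * (\<bar>s - s'\<bar> + norm ((Y, 0 :: real) - (Y', 0)))"
        using that by (intro K(3) zb pb qb \<alpha>12) (simp_all add: norm_Pair)
      also have "\<dots> = \<bar>\<alpha>\<bar> ^ 3 * (K * \<bar>\<alpha>\<bar> * (\<bar>s - s'\<bar> + norm (Y - Y')))"
        by (simp add: norm_Pair \<alpha>4)
      finally have "norm (?v s Y - ?v s' Y') / \<bar>\<alpha>\<bar> ^ 3 \<le> K * \<bar>\<alpha>\<bar> * (\<bar>s - s'\<bar> + norm (Y - Y'))"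
        using \<alpha>3 by (simp add: divide_le_eq mult.commute)
      moreover have "N s Y t - N s' Y' t = (1 / \<alpha> ^ 3) *\<^sub>R (?v s Y - ?v s' Y')"
        by (simp add: N_def scaleR_diff_right)
      ultimately show ?thesis by (simp add: power_abs)
    qed
    have N_base: "norm (N 0 0 t) \<le> G0" if "t \<ge> 0" for t
    proof -
      have "norm (vf_rem (xh t, 0) \<alpha> (\<phi> 2 t, 0) (w0 t, k) 0 0) \<le> G0 * \<bar>\<alpha>\<bar> ^ 3"
        using that by (intro G0(3) zb pb qb \<alpha>12)
      then have "norm (vf_rem (xh t, 0) \<alpha> (\<phi> 2 t, 0) (w0 t, k) 0 0) / \<bar>\<alpha>\<bar> ^ 3 \<le> G0"
        using \<alpha>3 by (simp add: divide_le_eq)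
      then show ?thesis by (simp add: N_def power_abs zero_prod_def)
    qed
    have N_le: "norm (N s Y t) \<le> G" if "t \<ge> 0" "\<bar>s\<bar> \<le> r" "norm Y \<le> r" for s Y t
    proof -
      have "norm (N s Y t) \<le> norm (N 0 0 t) + norm (N s Y t - N 0 0 t)" by (metis add.commute diff_add_cancel norm_triangle_ineq)
      also have "\<dots> \<le> G0 + K * \<bar>\<alpha>\<bar> * (\<bar>s - 0\<bar> + norm (Y - 0))"
        using that r by (intro add_mono N_base N_diff) auto
      also have "\<dots> \<le> G0 + K * \<bar>\<alpha>\<bar> * (r + r)" using that K by (intro add_left_mono mult_left_mono add_mono) auto
      also have "\<dots> \<le> G" using \<alpha>r(1) by (simp add: G_def algebra_simps)
      finally show ?thesis .
    qed
    define \<Phi> where "\<Phi> g t = N (multiplier g) (green (solvable_part g) t) t" for g t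
    have bd: "\<bar>multiplier g\<bar> \<le> r" "\<And>t. t \<ge> 0 \<Longrightarrow> norm (green (solvable_part g) t) \<le> r" if "bdd_forcing g G" for g
      using \<kappa>'(3,4)[OF that] by (auto simp: r_def)
    have "\<exists>g. continuous_on {0..} g \<and> (\<forall>t\<ge>0. norm (g t) \<le> G) \<and> (\<forall>t\<ge>0. g t = \<Phi> g t)"
    proof (rule half_line_fixed_point)
      show "G \<ge> 0" using G by simp
    next
      fix g :: "real \<Rightarrow> real^'m"
      assume "continuous_on {0..} g" "\<And>t. t \<ge> 0 \<Longrightarrow> norm (g t) \<le> G"
      then have g: "bdd_forcing g G" by (simp add: bdd_forcing_def)
      obtain H where H: "bdd_forcing (solvable_part g) H" using \<kappa>'(2)[OF g] by blast
      have "continuous_on {0..} (\<Phi> g)"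
        unfolding \<Phi>_def[abs_def] N_def using n2
        by (intro continuous_on_scaleR continuous_on_const vf_rem_cont continuous_on_Pair xh_cont phi_cont
            bdd_forcingD(1)[OF w0] green_cont[OF bdd_forcingD(1)[OF H]]) auto
      moreover have "norm (\<Phi> g t) \<le> G" if "t \<ge> 0" for t
        unfolding \<Phi>_def using that bd[OF g] by (intro N_le) auto
      ultimately show "continuous_on {0..} (\<Phi> g) \<and> (\<forall>t\<ge>0. norm (\<Phi> g t) \<le> G)" by blast
    next
      fix g g' :: "real \<Rightarrow> real^'m" and d
      assume g1: "continuous_on {0..} g" "\<And>t. t \<ge> 0 \<Longrightarrow> norm (g t) \<le> G"
        and g2: "continuous_on {0..} g'" "\<And>t. t \<ge> 0 \<Longrightarrow> norm (g' t) \<le> G"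
        and d: "\<And>t. t \<ge> 0 \<Longrightarrow> norm (g t - g' t) \<le> d"
      have g: "bdd_forcing g G" "bdd_forcing g' G" using g1 g2 by (simp_all add: bdd_forcing_def)
      have diff: "bdd_forcing (\<lambda>t. 1 *\<^sub>R g t + (-1) *\<^sub>R g' t) d"
        unfolding bdd_forcing_def using d g1(1) g2(1) by (auto intro!: continuous_intros)
      have d0: "d \<ge> 0" by (rule bdd_forcing_nonneg[OF diff])
      show "\<forall>t\<ge>0. norm (\<Phi> g t - \<Phi> g' t) \<le> d / 2"
      proof (intro allI impI)
        fix t :: real assume t: "t \<ge> 0"
        have "norm (\<Phi> g t - \<Phi> g' t) \<le> K * \<bar>\<alpha>\<bar> * (\<bar>multiplier g - multiplier g'\<bar> + norm (green (solvable_part g) t - green (solvable_part g') t))"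
          unfolding \<Phi>_def using t bd[OF g(1)] bd[OF g(2)] by (intro N_diff) auto
        also have "\<dots> \<le> K * \<bar>\<alpha>\<bar> * (\<kappa>' * d + \<kappa>' * d)"
          using \<kappa>'(3)[OF diff] \<kappa>'(4)[OF diff t] K(1)
          unfolding multiplier_diff[OF g] green_solvable_part_diff[OF g] by (intro mult_left_mono add_mono) auto
        also have "\<dots> = (\<bar>\<alpha>\<bar> * (K * \<kappa>')) * (2 * d)" by (simp add: algebra_simps)
        also have "\<dots> \<le> (1 / 4) * (2 * d)" using \<alpha>r(2) d0 by (intro mult_right_mono) auto
        finally show "norm (\<Phi> g t - \<Phi> g' t) \<le> d / 2" by simp
      qed
    qed
    then obtain g where g: "bdd_forcing g G" "\<And>t. t \<ge> 0 \<Longrightarrow> g t = \<Phi> g t" unfolding bdd_forcing_def by blast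
    have "\<alpha> ^ 3 *\<^sub>R g t = vf_rem (xh t, 0) \<alpha> (\<phi> 2 t, 0) (w0 t, k) (multiplier g) (green (solvable_part g) t, 0)" if "t \<ge> 0" for t
    proof -
      have "\<alpha> ^ 3 *\<^sub>R g t = \<alpha> ^ 3 *\<^sub>R N (multiplier g) (green (solvable_part g) t) t"
        by (rule arg_cong[OF g(2)[OF that, unfolded \<Phi>_def]])
      then show ?thesis using \<alpha>0 by (simp add: N_def)
    qed
    then show ?thesis using g(1) bd[OF g(1)] by blast
  qed
  then show ?thesis using \<epsilon> by blast
qed

text \<open>The condition on \<open>k\<close> says that the forcing of order
  \<open>\<alpha>\<^sup>2\<close> is solvable, which gives \<open>w0\<close>; the corrections
  \<open>s\<close> and \<open>y\<close> follow. The half orbit so obtained is uniformly close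
  to \<open>xh\<close>. It is therefore small from \<open>tail_time\<close> on, hence tends to
  \<open>0\<close>, and it does not vanish identically.\<close>

lemma symmetric_homoclinic_family:
  assumes b: "psi_integral (n+2) quad_forcing \<noteq> 0" and k: "k * psi_integral (n+2) param_forcing + 1 / 2 * psi_integral (n+2) quad_forcing = 0"
  shows "\<exists>\<epsilon>>0. \<exists>C. \<forall>\<alpha>. \<bar>\<alpha>\<bar> < \<epsilon> \<longrightarrow> (\<exists>x. homoclinic_to_origin f (k * \<alpha>\<^sup>2) x \<and> symmetric_orbit R x \<and> x 0 \<in> Fix R \<and>
      (\<forall>t. norm (x t - (xh t + \<alpha> *\<^sub>R \<phi> 2 t)) \<le> C * \<alpha>\<^sup>2))"
proof -
  define h0 where "h0 = (\<lambda>t. k *\<^sub>R param_forcing t + (1 / 2) *\<^sub>R quad_forcing t)"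
  define w0 where "w0 = green h0"
  obtain H1 H2 where H: "bdd_forcing param_forcing H1" "bdd_forcing quad_forcing H2" using param_forcing_bdd_forcing quad_forcing_bdd_forcing by blast
  have h0: "bdd_forcing h0 (\<bar>k\<bar> * H1 + \<bar>1 / 2\<bar> * H2)" unfolding h0_def by (rule bdd_forcing_comb[OF H])
  have Lam0: "psi_integral (n+2) h0 = 0"
    unfolding h0_def using psi_integral_comb[OF H, of "n+2" k "1 / 2"] n2 k by simp
  obtain W where W: "bdd_forcing w0 W"
  proof -
    obtain C where "\<forall>g G. bdd_forcing g G \<longrightarrow> (\<forall>t\<ge>0. norm (green g t) \<le> C * G)" using green_bound by blast
    then have "bdd_forcing w0 (C * (\<bar>k\<bar> * H1 + \<bar>1 / 2\<bar> * H2))"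
      unfolding w0_def using h0 green_cont[OF bdd_forcingD(1)[OF h0]] by (simp add: bdd_forcing_def)
    then show ?thesis using that by blast
  qed
  obtain P where P: "bdd_forcing (\<phi> 2) P" using phi2_bdd_forcing by blast
  obtain e r where e: "e > 0" and corr: "\<And>\<alpha>. \<alpha> \<noteq> 0 \<Longrightarrow> \<bar>\<alpha>\<bar> \<le> e \<Longrightarrow>
     \<exists>g G. bdd_forcing g G \<and> \<bar>multiplier g\<bar> \<le> r \<and> (\<forall>t\<ge>0. norm (green (solvable_part g) t) \<le> r) \<and>
     (\<forall>t\<ge>0. \<alpha> ^ 3 *\<^sub>R g t = vf_rem (xh t, 0) \<alpha> (\<phi> 2 t, 0) (w0 t, k) (multiplier g) (green (solvable_part g) t, 0))"
    using correction_exists[OF W b, of k] by blast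
  obtain t0 where t0: "t0 \<ge> 0" "xh t0 \<noteq> 0"
  proof -
    obtain t where "xh t \<noteq> 0" using xh_nz by blast
    moreover have "xh (- t) \<noteq> 0" if "xh t \<noteq> 0" using that xh_sym[of t] linear_0[OF linR] by metis
    ultimately show ?thesis using that[of t] that[of "- t"] by (cases "t \<ge> 0") auto
  qed
  obtain CR where CR: "CR > 0" "\<And>x. norm (R x) \<le> CR * norm x" using R_norm_ex by blast
  define U where "U = W + \<bar>r\<bar> * P + \<bar>r\<bar>"
  have P0: "P \<ge> 0" and W0: "W \<ge> 0" using bdd_forcing_nonneg P W by blast+
  have U0: "U \<ge> 0" using P0 W0 by (simp add: U_def)
  \<comment> \<open>a deviation of at most \<open>m\<close> keeps the tail within \<open>\<delta>\<close> and the orbit away from \<open>0\<close> at time \<open>t0\<close>\<close>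
  define m where "m = min \<delta> (norm (xh t0)) / 2"
  have m: "m > 0" "m \<le> \<delta> / 2" "m < norm (xh t0)" using \<delta> t0 by (auto simp: m_def min_def)
  define \<epsilon> where "\<epsilon> = min (min 1 e) (min (m / (P + U + 1)) (\<delta> / (\<bar>k\<bar> + 1)))"
  have \<epsilon>: "\<epsilon> > 0" using e m \<delta> P0 U0 by (simp add: \<epsilon>_def)
  define C where "C = max 1 CR * U"
  have C: "U \<le> C" "CR * U \<le> C" using U0 mult_right_mono[of 1 "max 1 CR" U] mult_right_mono[of CR "max 1 CR" U]
    by (simp_all add: C_def)
  have "\<exists>x. homoclinic_to_origin f (k * \<alpha>\<^sup>2) x \<and> symmetric_orbit R x \<and> x 0 \<in> Fix R \<and>
      (\<forall>t. norm (x t - (xh t + \<alpha> *\<^sub>R \<phi> 2 t)) \<le> C * \<alpha>\<^sup>2)" if \<alpha>: "\<bar>\<alpha>\<bar> < \<epsilon>" for \<alpha>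
  proof (cases "\<alpha> = 0")
    case True
    have "xh 0 \<in> Fix R" "symmetric_orbit R xh" "homoclinic_to_origin f 0 xh" using R4 by (simp_all add: R4_def)
    then show ?thesis using True by (intro exI[of _ xh]) simp
  next
    case False
    have \<alpha>e: "\<bar>\<alpha>\<bar> \<le> e" and \<alpha>1: "\<bar>\<alpha>\<bar> \<le> 1" using \<alpha> by (simp_all add: \<epsilon>_def)
    have \<alpha>2: "\<alpha>\<^sup>2 \<le> \<bar>\<alpha>\<bar>"
      using mult_left_mono[OF \<alpha>1, of "\<bar>\<alpha>\<bar>"] by (simp add: power2_eq_square abs_mult[symmetric])
    obtain g G where g: "bdd_forcing g G" "\<bar>multiplier g\<bar> \<le> r" "\<And>t. t \<ge> 0 \<Longrightarrow> norm (green (solvable_part g) t) \<le> r"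
      "\<And>t. t \<ge> 0 \<Longrightarrow> \<alpha> ^ 3 *\<^sub>R g t = vf_rem (xh t, 0) \<alpha> (\<phi> 2 t, 0) (w0 t, k) (multiplier g) (green (solvable_part g) t, 0)"
      using corr[OF False \<alpha>e] by blast
    define y where "y = green (solvable_part g)"
    obtain H' where H': "bdd_forcing (solvable_part g) H'" using solve_bound g(1) by blast
    define xp where "xp = ansatz w0 \<alpha> (multiplier g) y"
    have der: "(xp has_vector_derivative f (xp t) (k * \<alpha>\<^sup>2)) (at t within {0..})" if t: "t \<ge> 0" for t
      unfolding xp_def
    proof (rule ansatz_der[OF _ _ _ t])
      fix t :: real assume t: "0 \<le> t"
      show "(w0 has_vector_derivative Dx f (xh t) 0 (w0 t) + (k *\<^sub>R param_forcing t + (1 / 2) *\<^sub>R quad_forcing t)) (at t within {0..})"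
        using green_der[OF bdd_forcingD(1)[OF h0] t] unfolding w0_def h0_def .
      show "(y has_vector_derivative Dx f (xh t) 0 (y t) + (g t + multiplier g *\<^sub>R quad_forcing t)) (at t within {0..})"
        using green_der[OF bdd_forcingD(1)[OF H'] t] unfolding y_def by (simp add: solvable_part_def)
      show "\<alpha> ^ 3 *\<^sub>R g t = vf_rem (xh t, 0) \<alpha> (\<phi> 2 t, 0) (w0 t, k) (multiplier g) (y t, 0)"
        unfolding y_def by (rule g(4)[OF t])
    qed
    have "R (w0 0) = w0 0" unfolding w0_def by (rule green_0_Fix[OF Lam0])
    moreover have "R (y 0) = y 0" unfolding y_def by (rule green_0_Fix[OF psi_integral_solvable_part[OF g(1) b]])
    ultimately have xp0: "R (xp 0) = xp 0"
      unfolding xp_def ansatz_def using xh_sym[of 0] phi2_rev[of 0] by (simp add: R_simps)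
    have dev: "norm (xp t - (xh t + \<alpha> *\<^sub>R \<phi> 2 t)) \<le> U * \<alpha>\<^sup>2" if t: "t \<ge> 0" for t
    proof -
      have "norm (w0 t + multiplier g *\<^sub>R \<phi> 2 t + \<alpha> *\<^sub>R y t) \<le> W + \<bar>r\<bar> * P + 1 * \<bar>r\<bar>"
      proof (intro norm_triangle_le add_mono)
        show "norm (w0 t) \<le> W" by (rule bdd_forcingD(2)[OF W t])
        show "norm (multiplier g *\<^sub>R \<phi> 2 t) \<le> \<bar>r\<bar> * P"
          unfolding norm_scaleR using g(2) bdd_forcingD(2)[OF P t] by (intro mult_mono) auto
        show "norm (\<alpha> *\<^sub>R y t) \<le> 1 * \<bar>r\<bar>"
          unfolding norm_scaleR y_def using \<alpha>1 g(3)[OF t] by (intro mult_mono) auto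
      qed
      then have "\<alpha>\<^sup>2 * norm (w0 t + multiplier g *\<^sub>R \<phi> 2 t + \<alpha> *\<^sub>R y t) \<le> \<alpha>\<^sup>2 * U"
        unfolding U_def by (intro mult_left_mono) auto
      then show ?thesis by (simp add: xp_def ansatz_def mult.commute)
    qed
    have close: "norm (xp t - xh t) \<le> m" if t: "t \<ge> 0" for t
    proof -
      have "norm (xp t - xh t) \<le> norm (xp t - (xh t + \<alpha> *\<^sub>R \<phi> 2 t)) + norm (\<alpha> *\<^sub>R \<phi> 2 t)"
        using norm_triangle_ineq[of "xp t - (xh t + \<alpha> *\<^sub>R \<phi> 2 t)" "\<alpha> *\<^sub>R \<phi> 2 t"] by (simp add: algebra_simps)
      also have "\<dots> \<le> U * \<bar>\<alpha>\<bar> + \<bar>\<alpha>\<bar> * P"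
      proof (rule add_mono)
        show "norm (xp t - (xh t + \<alpha> *\<^sub>R \<phi> 2 t)) \<le> U * \<bar>\<alpha>\<bar>"
          using dev[OF t] mult_left_mono[OF \<alpha>2 U0] by linarith
        show "norm (\<alpha> *\<^sub>R \<phi> 2 t) \<le> \<bar>\<alpha>\<bar> * P" using bdd_forcingD(2)[OF P t] by (simp add: mult_left_mono)
      qed
      also have "\<dots> \<le> \<bar>\<alpha>\<bar> * (P + U + 1)" by (simp add: algebra_simps)
      also have "\<dots> \<le> m / (P + U + 1) * (P + U + 1)"
        using \<alpha> P0 U0 by (intro mult_right_mono) (auto simp: \<epsilon>_def)
      also have "\<dots> = m" using P0 U0 by simp
      finally show ?thesis .
    qed
    have \<mu>: "\<bar>k * \<alpha>\<^sup>2\<bar> \<le> \<delta>"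
    proof -
      have "\<bar>k * \<alpha>\<^sup>2\<bar> \<le> \<bar>k\<bar> * \<bar>\<alpha>\<bar>" using \<alpha>2 by (simp add: abs_mult mult_left_mono)
      also have "\<dots> \<le> (\<bar>k\<bar> + 1) * (\<delta> / (\<bar>k\<bar> + 1))" using \<alpha> by (intro mult_mono) (auto simp: \<epsilon>_def)
      also have "\<dots> = \<delta>" by (simp add: add_nonneg_eq_0_iff)
      finally show ?thesis .
    qed
    have lim: "(xp \<longlongrightarrow> 0) at_top"
    proof (rule small_solution_tends_to_0[OF _ _ \<mu>])
      fix t assume t: "tail_time \<le> t"
      then have t': "0 \<le> t" using tail_time by simp
      show "(xp has_vector_derivative f (xp t) (k * \<alpha>\<^sup>2)) (at t within {tail_time..})"
        using der[OF t'] tail_time by (rule_tac has_vector_derivative_within_subset) auto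
      show "norm (xp t) \<le> \<delta>"
        using close[OF t'] xh_small[OF t] m(2) norm_triangle_sub[of "xp t" "xh t"] by linarith
    qed
    have nz: "xp t0 \<noteq> 0"
    proof
      assume "xp t0 = 0"
      then show False using close[OF t0(1)] m(3) by simp
    qed
    define x where "x = (\<lambda>t. if t \<ge> 0 then xp t else R (xp (- t)))"
    have ext: "homoclinic_to_origin f (k * \<alpha>\<^sup>2) x" "symmetric_orbit R x" "x 0 \<in> Fix R"
      unfolding x_def by (rule symmetric_extension[OF der xp0 lim t0(1) nz]; assumption)+
    have "norm (x t - (xh t + \<alpha> *\<^sub>R \<phi> 2 t)) \<le> C * \<alpha>\<^sup>2" for t
    proof (cases "t \<ge> 0")
      case True
      then have "norm (x t - (xh t + \<alpha> *\<^sub>R \<phi> 2 t)) \<le> U * \<alpha>\<^sup>2" using dev[OF True] by (simp add: x_def)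
      also have "\<dots> \<le> C * \<alpha>\<^sup>2" using C(1) by (rule mult_right_mono) simp
      finally show ?thesis .
    next
      case False
      have "x t - (xh t + \<alpha> *\<^sub>R \<phi> 2 t) = R (xp (- t) - (xh (- t) + \<alpha> *\<^sub>R \<phi> 2 (- t)))"
        using False xh_rev[of "- t"] phi2_rev[of "- t"] by (simp add: x_def R_simps)
      then have "norm (x t - (xh t + \<alpha> *\<^sub>R \<phi> 2 t)) \<le> CR * norm (xp (- t) - (xh (- t) + \<alpha> *\<^sub>R \<phi> 2 (- t)))"
        using CR(2) by metis
      also have "\<dots> \<le> CR * (U * \<alpha>\<^sup>2)" using dev[of "- t"] False CR(1) by (intro mult_left_mono) auto
      also have "\<dots> \<le> C * \<alpha>\<^sup>2" unfolding mult.assoc[symmetric] using C(2) by (rule mult_right_mono) simp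
      finally show ?thesis .
    qed
    then show ?thesis using ext by blast
  qed
  then show ?thesis using \<epsilon> by blast
qed

end

section \<open>The saddle-node bifurcation\<close>

theorem theorem3p6:
  fixes f :: "real^'m \<Rightarrow> real \<Rightarrow> real^'m"
    and R :: "real^'m \<Rightarrow> real^'m"
    and sp :: "real^'m \<Rightarrow> real^'m \<Rightarrow> real"
    and n :: nat
    and xh :: "real \<Rightarrow> real^'m"
    and \<phi> \<psi> :: "nat \<Rightarrow> real \<Rightarrow> real^'m"
    and a2 b2 :: real
  assumes "CARD('m) = 2 * n" and "n \<ge> 2"
    and "real_analytic_on (\<lambda>(x, \<mu>). f x \<mu>) UNIV"
    and "R1 f R n" and "R2 f" and "R3 f n" and "R4 f R xh" and "R5 f R xh \<phi>"
    and "is_scalar_product sp"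
    and "Fix (\<lambda>x. - R x) = {y. \<forall>x\<in>Fix R. sp x y = 0}"
    and "VE_fundamental_system f R n xh \<phi>"
    and "dual_system sp n \<phi> \<psi>"
    and "a2 = (LINT t|lborel. sp (\<psi> (n+2) t) (Dmu f (xh t) 0))"
    and "b2 = 1/2 * (LINT t|lborel. sp (\<psi> (n+2) t) (Dxx f (xh t) 0 (\<phi> 2 t) (\<phi> 2 t)))"
    and "a2 \<noteq> 0" and "b2 \<noteq> 0"
  shows "\<exists>(I :: real set) (h :: real \<Rightarrow> real).
      open I \<and> is_interval I \<and> 0 \<in> I \<and>
      h differentiable_on I \<and> deriv h differentiable (at 0) \<and>
      h 0 = 0 \<and> deriv h 0 = 0 \<and> deriv (deriv h) 0 \<noteq> 0 \<and>
      (\<exists>C. \<forall>\<alpha>\<in>I. \<exists>x.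
         homoclinic_to_origin f (h \<alpha>) x \<and> symmetric_orbit R x \<and> x 0 \<in> Fix R \<and>
         (\<forall>t. norm (x t - (xh t + \<alpha> *\<^sub>R \<phi> 2 t)) \<le> C * sqrt (\<bar>\<alpha>\<bar> ^ 4 + \<bar>h \<alpha>\<bar> ^ 2))) \<and>
      (a2 * b2 < 0 \<longrightarrow> supercritical h) \<and>
      (a2 * b2 > 0 \<longrightarrow> subcritical h)"
proof -
  interpret homoclinic_setting f R sp n xh \<phi> \<psi>
    using assms(1-12) by (rule homoclinic_setting.intro)
  obtain B c h L \<delta> where "homoclinic_lyapunov f R sp n xh \<phi> \<psi> B c h L \<delta>" using lyapunov_exists by blast
  then interpret homoclinic_lyapunov f R sp n xh \<phi> \<psi> B c h L \<delta> .
  have a2: "a2 = 2 * psi_integral (n+2) param_forcing"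
    unfolding assms(13) using assms(13,15) even_psi_integral[OF param_forcing_even] by (simp add: param_forcing_def[symmetric])
  have b2: "b2 = psi_integral (n+2) quad_forcing"
    unfolding assms(14) using assms(14,16) even_psi_integral[OF quad_forcing_even] by (simp add: quad_forcing_def[symmetric])
  \<comment> \<open>the parabola \<open>\<mu> = k \<alpha>\<^sup>2\<close> on which the second order forcing satisfies the solvability condition\<close>
  define k where "k = - (b2 / a2)"
  have k0: "k \<noteq> 0" using assms(15,16) by (simp add: k_def)
  have "psi_integral (n+2) quad_forcing \<noteq> 0" using b2 assms(16) by simp
  moreover have "k * psi_integral (n+2) param_forcing + 1 / 2 * psi_integral (n+2) quad_forcing = 0"
    using assms(15) unfolding k_def b2[symmetric] a2 by (simp add: field_simps)
  ultimately obtain \<epsilon> C where \<epsilon>: "\<epsilon> > 0" and orbit: "\<And>\<alpha>. \<bar>\<alpha>\<bar> < \<epsilon> \<Longrightarrow>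
      \<exists>x. homoclinic_to_origin f (k * \<alpha>\<^sup>2) x \<and> symmetric_orbit R x \<and> x 0 \<in> Fix R \<and>
      (\<forall>t. norm (x t - (xh t + \<alpha> *\<^sub>R \<phi> 2 t)) \<le> C * \<alpha>\<^sup>2)"
    using symmetric_homoclinic_family by blast
  define H where "H = (\<lambda>\<alpha>::real. k * \<alpha>\<^sup>2)"
  have H_der: "(H has_real_derivative 2 * k * \<alpha>) (at \<alpha>)" for \<alpha>
    unfolding H_def by (auto intro!: derivative_eq_intros)
  have dH: "deriv H = (\<lambda>\<alpha>. 2 * k * \<alpha>)" using H_der DERIV_imp_deriv by blast
  have dH_der: "(deriv H has_real_derivative 2 * k) (at 0)"
    unfolding dH by (auto intro!: derivative_eq_intros)
  have ddH: "deriv (deriv H) 0 = 2 * k" using dH_der by (rule DERIV_imp_deriv)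
  have est: "\<exists>x. homoclinic_to_origin f (H \<alpha>) x \<and> symmetric_orbit R x \<and> x 0 \<in> Fix R \<and>
      (\<forall>t. norm (x t - (xh t + \<alpha> *\<^sub>R \<phi> 2 t)) \<le> \<bar>C\<bar> * sqrt (\<bar>\<alpha>\<bar> ^ 4 + \<bar>H \<alpha>\<bar> ^ 2))"
    if "\<alpha> \<in> {-\<epsilon><..<\<epsilon>}" for \<alpha>
  proof -
    have small: "\<bar>\<alpha>\<bar> < \<epsilon>" using that by auto
    obtain x where x: "homoclinic_to_origin f (H \<alpha>) x" "symmetric_orbit R x" "x 0 \<in> Fix R"
      "\<And>t. norm (x t - (xh t + \<alpha> *\<^sub>R \<phi> 2 t)) \<le> C * \<alpha>\<^sup>2"
      using orbit[of \<alpha>] small unfolding H_def by blast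
    have "\<alpha>\<^sup>2 = sqrt (\<bar>\<alpha>\<bar> ^ 4)" by (rule real_sqrt_unique[symmetric]) simp_all
    also have "\<dots> \<le> sqrt (\<bar>\<alpha>\<bar> ^ 4 + \<bar>H \<alpha>\<bar> ^ 2)" by simp
    finally have le: "C * \<alpha>\<^sup>2 \<le> \<bar>C\<bar> * sqrt (\<bar>\<alpha>\<bar> ^ 4 + \<bar>H \<alpha>\<bar> ^ 2)" by (intro mult_mono) auto
    show ?thesis using x(1-3) order_trans[OF x(4) le] by blast
  qed
  have pos: "\<forall>\<^sub>F \<alpha> in at 0. \<alpha> \<noteq> (0::real)" by (simp add: eventually_at_filter)
  have super: "supercritical H" if "a2 * b2 < 0"
  proof -
    have "k > 0" using that unfolding k_def by (auto simp: mult_less_0_iff divide_less_0_iff)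
    then have "\<forall>\<^sub>F \<alpha> in at 0. H \<alpha> > 0" using pos by (auto elim!: eventually_mono simp: H_def)
    then show ?thesis unfolding supercritical_def ddH using \<open>k > 0\<close> by simp
  qed
  have sub: "subcritical H" if "a2 * b2 > 0"
  proof -
    have "k < 0" using that unfolding k_def by (auto simp: zero_less_mult_iff zero_less_divide_iff)
    then have "\<forall>\<^sub>F \<alpha> in at 0. H \<alpha> < 0" using pos by (auto elim!: eventually_mono simp: H_def mult_less_0_iff)
    then show ?thesis unfolding subcritical_def ddH using \<open>k < 0\<close> by simp
  qed
  have 1: "H differentiable_on {-\<epsilon><..<\<epsilon>}"
    using H_der by (intro differentiable_at_imp_differentiable_on) (auto simp: real_differentiable_def)
  have 2: "deriv H differentiable (at 0)" using dH_der by (auto simp: real_differentiable_def)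
  have 3: "H 0 = 0" "deriv H 0 = 0" "deriv (deriv H) 0 \<noteq> 0" using k0 by (simp_all add: ddH) (simp_all add: H_def dH[unfolded H_def])
  show ?thesis
    by (intro exI[of _ "{-\<epsilon><..<\<epsilon>}"] exI[of _ H] conjI impI exI[of _ "\<bar>C\<bar>"] ballI est super sub 1 2 3)
      (use \<epsilon> in \<open>auto simp: is_interval_1\<close>)
qed

end
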